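(* Let $\mu$ be a probability measure on the unit circle $\partial\mathbb{D}$ whose support contains infinitely many points, let $(\alpha_n)_{n\ge 0}$ be its Verblunsky coefficients, and write $d\mu(\theta)=w(\theta)\frac{d\theta}{2\pi}+d\mu_s$ with $\mu_s$ singular with respect to $d\theta$. Let $\theta_1\in[0,2\pi)$ and $m_1\in\mathbb{Z}_+$. If $$(S-e^{-i\theta_1})^{m_1}\alpha\in \ell^2 \quad\text{and}\quad \alpha\in \ell^{2m_1+2},$$ then $$\int_0^{2\pi}(1-\cos(\theta-\theta_1))^{m_1}\log(w(\theta))\,d\theta>-\infty .$$
   Context: $\mathbb{D}$ is the open unit disk in $\mathbb{C}$. The Verblunsky coefficients $\alpha=(\alpha_n)_{n\ge0}\in\mathbb{D}^\infty$ are the recursion coefficients of the monic orthogonal polynomials of $\mu$ (Szegő recursion); they are in bijection with nontrivial probability measures on $\partial\mathbb{D}$. $S$ is the left shift on sequences, $(S\alpha)_n:=\alpha_{n+1}$, and $(S-e^{-i\theta_1})^{m_1}\alpha$ denotes the sequence obtained by applying the operator $S-e^{-i\theta_1}I$ $m_1$ times to $\alpha$. $\ell^p$ denotes the space of $p$-summable sequences indexed by $n\ge0$. *)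

theory Defs
  imports "HOL-Probability.Probability" "HOL-Computational_Algebra.Polynomial"
begin

definition msupport :: "complex measure \<Rightarrow> complex set" where
  "msupport \<mu> = {z. \<forall>e>0. emeasure \<mu> (ball z e) > 0}"

definition circle_prob :: "complex measure \<Rightarrow> bool" where
  "circle_prob \<mu> \<longleftrightarrow> prob_space \<mu> \<and> sets \<mu> = sets borel
     \<and> emeasure \<mu> (UNIV - sphere 0 1) = 0"

definition nontrivial_circle_prob :: "complex measure \<Rightarrow> bool" where
  "nontrivial_circle_prob \<mu> \<longleftrightarrow> circle_prob \<mu> \<and> infinite (msupport \<mu>)"

definition is_monic_OP :: "complex measure \<Rightarrow> nat \<Rightarrow> complex poly \<Rightarrow> bool" where
  "is_monic_OP \<mu> n p \<longleftrightarrow> degree p = n \<and> lead_coeff p = 1 \<and>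
     (\<forall>k<n. (\<integral>z. poly p z * cnj (z ^ k) \<partial>\<mu>) = 0)"

definition monic_OP :: "complex measure \<Rightarrow> nat \<Rightarrow> complex poly" where
  "monic_OP \<mu> n = (THE p. is_monic_OP \<mu> n p)"

text \<open>Verblunsky coefficients via the Szego recursion
  Phi_{n+1}(z) = z Phi_n(z) - conj(alpha_n) Phi_n^*(z), so Phi_{n+1}(0) = - conj(alpha_n).\<close>
definition verblunsky :: "complex measure \<Rightarrow> nat \<Rightarrow> complex" where
  "verblunsky \<mu> n = - cnj (poly (monic_OP \<mu> (Suc n)) 0)"

definition shift_minus :: "complex \<Rightarrow> (nat \<Rightarrow> complex) \<Rightarrow> nat \<Rightarrow> complex" where
  "shift_minus c a = (\<lambda>n. a (Suc n) - c * a n)"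

definition in_lp :: "nat \<Rightarrow> (nat \<Rightarrow> complex) \<Rightarrow> bool" where
  "in_lp p a \<longleftrightarrow> summable (\<lambda>n. norm (a n) ^ p)"

definition lebesgue_decomp :: "complex measure \<Rightarrow> (real \<Rightarrow> real) \<Rightarrow> complex measure \<Rightarrow> bool" where
  "lebesgue_decomp \<mu> w \<mu>s \<longleftrightarrow>
     w \<in> borel_measurable borel \<and> (\<forall>\<theta>. 0 \<le> w \<theta>) \<and> sets \<mu>s = sets borel \<and>
     (\<forall>A\<in>sets borel. emeasure \<mu> A =
        (\<integral>\<^sup>+\<theta>. ennreal (w \<theta> / (2 * pi)) * indicator {0..<2*pi} \<theta> * indicator A (cis \<theta>) \<partial>lborel)
        + emeasure \<mu>s A) \<and>
     (\<exists>N\<in>sets borel. emeasure \<mu>s (UNIV - N) = 0 \<and>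
        emeasure lborel {\<theta>\<in>{0..<2*pi}. cis \<theta> \<in> N} = 0)"

end

theory Submission
  imports Defs "HOL-Complex_Analysis.Complex_Analysis"
begin

text \<open>
  Put \<open>a\<^sub>n = e\<^sup>i\<^sup>n\<^sup>\<theta> \<alpha>\<^sub>n\<close> with \<open>\<theta> = \<theta>1\<close>, so that \<open>S - e\<^sup>-\<^sup>i\<^sup>\<theta>\<close> acts on \<open>\<alpha>\<close> as the forward
  difference \<open>D\<close> acts on \<open>a\<close>. By lower semicontinuity of relative entropy it suffices to bound
  \<open>\<integral> (1 - cos (t - \<theta>))\<^sup>m log |\<phi>\<^sub>N|\<^sup>2\<close> uniformly in \<open>N\<close>; here semicontinuity only uses that the measures
  \<open>dt / (2\<pi> |\<phi>\<^sub>N|\<^sup>2)\<close> have the same moments as \<open>\<mu>\<close> up to order \<open>N\<close>. The reversed polynomial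
  \<open>\<phi>\<^sub>N\<^sup>*\<close> is, up to a constant, the product of the factors \<open>1 - a\<^sub>n z b\<^sub>n(z)\<close>, where
  \<open>b\<^sub>n\<^sub>+\<^sub>1 (1 - a\<^sub>n z b\<^sub>n) = z b\<^sub>n - cnj a\<^sub>n\<close>. These logarithms are analytic in the disc, so the integral
  against the Laurent polynomial \<open>(1 - z)\<^sup>m (1 - 1/z)\<^sup>m\<close> may be taken over \<open>|z| = 1/2\<close>.

  On that circle \<open>b\<^sub>n\<close> is replaced by a formal solution \<open>\<beta>\<^sub>n\<close> of the same recursion, a polynomial in
  \<open>u = 1 / (1 - z)\<close>. Counting \<open>D\<^sup>j a\<close> with homogeneity \<open>j + 1\<close>, terms of homogeneity \<open>2m + 2\<close> are
  summable by a discrete Gagliardo--Nirenberg inequality, and the residual of \<open>\<beta>\<close> has homogeneity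
  \<open>m + 1\<close>; an exact identity shows that it enters the logarithms only quadratically. With \<open>*\<close> the
  reflection in the unit circle, \<open>log (1 - a z \<beta>) + log (1 - a z \<beta>)\<^sup>*\<close> equals \<open>log (1 - |a|\<^sup>2)\<close> plus
  a telescoping term, which cancels the norming constants of \<open>\<phi>\<^sub>N\<close>. The zero of order \<open>2m\<close> of the weight
  at \<open>z = 1\<close> is what makes the reflection compatible with the functional on powers \<open>u\<^sup>k\<close>, \<open>k \<le> 2m\<close>,
  while the coefficients of higher powers are summable.
\<close>

section \<open>Discrete Gagliardo--Nirenberg interpolation\<close>

text \<open>The obstacle is the residual of \<open>\<beta>\<close>. Only m differences of
  \<open>a\<close> are under control, so the residual has size \<open>s^(m+1)\<close>, which is
  square summable but need not be summable; an estimate linear in it would be useless. The exact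
  identities therefore multiply each factor by expressions in the reflected solution that telescope
  in the logarithm, and leave only products of two quantities of size \<open>s^(m+1)\<close>. The
  radius 1/2 has two reasons. The function u is bounded there, while its pole z = 1 lies on the unit
  circle. Moreover \<open>b - \<beta>\<close> obeys a linear recursion with multiplier close to z,
  hence contracts, and inherits the size of the residual. The contraction survives division by
  \<open>s^(m+1)\<close> only if \<open>s\<close> varies slowly, which is the reason for the ratio
  3/4 in the construction of \<open>s\<close>. The price is that reflection in the unit circle does
  not preserve the circle of radius 1/2. So it is performed algebraically, on polynomials in u, and
  is turned into complex conjugation only by the integral functional.\<close>

definition fdiff :: "(nat \<Rightarrow> 'a::ab_group_add) \<Rightarrow> nat \<Rightarrow> 'a" where
  "fdiff f n = f (Suc n) - f n"

lemma norm_fdiff_iter_le: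
  fixes a :: "nat \<Rightarrow> 'a::real_normed_vector"
  assumes "\<And>n. norm (a n) \<le> 1"
  shows "norm ((fdiff ^^ j) a n) \<le> 2 ^ j"
proof (induction j arbitrary: n)
  case (Suc j)
  have "norm ((fdiff ^^ Suc j) a n) \<le> norm ((fdiff ^^ j) a (Suc n)) + norm ((fdiff ^^ j) a n)"
    by (simp add: fdiff_def norm_triangle_ineq4)
  also have "\<dots> \<le> 2 ^ Suc j" using Suc.IH[of n] Suc.IH[of "Suc n"] by simp
  finally show ?case .
qed (use assms in auto)

text \<open>The map z -> cnj z |z|^r has derivative of size at most (1 + r) |z|^r. Once the
  difference of the first factor is split off, scaling by the larger modulus leaves t (1 - t^r) <= r
  (1 - t), which combines e^x >= 1 + x with ln (1/t) <= 1/t - 1.\<close>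

lemma norm_cnj_powr_diff_le:
  fixes a b :: complex
  assumes r: "r > 0"
  shows "norm (cnj a * of_real (norm a powr r) - cnj b * of_real (norm b powr r))
    \<le> (1 + r) * norm (a - b) * max (norm a) (norm b) powr r"
proof -
  have *: "norm (cnj a * of_real (norm a powr r) - cnj b * of_real (norm b powr r))
    \<le> (1 + r) * norm (a - b) * norm a powr r" if le: "norm b \<le> norm a" for a b :: complex
  proof -
    have eq: "cnj a * of_real (norm a powr r) - cnj b * of_real (norm b powr r)
      = cnj (a - b) * of_real (norm a powr r) + cnj b * of_real (norm a powr r - norm b powr r)"
      by (simp add: algebra_simps)
    have mono: "norm b powr r \<le> norm a powr r"
      using le r by (intro powr_mono2) auto
    have n2: "norm (cnj b * of_real (norm a powr r - norm b powr r)) = norm b * (norm a powr r - norm b powr r)"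
      using mono by (simp add: norm_mult del: of_real_diff)
    have "norm b * (norm a powr r - norm b powr r) \<le> r * norm a powr r * (norm a - norm b)"
    proof (cases "b = 0")
      case True
      then show ?thesis using r by simp
    next
      case False
      hence b: "norm b > 0" and a: "norm a > 0" using le by (auto simp: less_le_trans)
      define t where "t = norm b / norm a"
      have t: "t > 0" using a b by (simp add: t_def)
      have bt: "norm b = t * norm a" using a by (simp add: t_def)
      have "1 + r * ln t \<le> exp (r * ln t)" by (rule exp_ge_add_one_self)
      also have "exp (r * ln t) = t powr r" using t by (simp add: powr_def)
      finally have "1 - t powr r \<le> r * (- ln t)" by simp
      also have "- ln t = ln (1 / t)" using t by (simp add: ln_div)
      also have "r * ln (1/t) \<le> r * (1 / t - 1)"
        using r t by (intro mult_left_mono ln_le_minus_one) auto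
      finally have "t * (1 - t powr r) \<le> t * (r * (1 / t - 1))"
        using t by (intro mult_left_mono) auto
      also have "\<dots> = r * (1 - t)" using t by (simp add: field_simps)
      finally have k: "t * (1 - t powr r) \<le> r * (1 - t)" .
      have "norm b * (norm a powr r - norm b powr r) = (norm a * norm a powr r) * (t * (1 - t powr r))"
        using t a by (simp add: bt powr_mult algebra_simps)
      also have "\<dots> \<le> (norm a * norm a powr r) * (r * (1 - t))"
        using k by (intro mult_left_mono) auto
      also have "\<dots> = r * norm a powr r * (norm a - norm b)" by (simp add: bt algebra_simps)
      finally show ?thesis .
    qed
    also have "\<dots> \<le> r * norm a powr r * norm (a - b)"
      using r norm_triangle_ineq2[of a b] by (intro mult_left_mono) auto
    finally have "norm (cnj b * of_real (norm a powr r - norm b powr r)) \<le> r * norm a powr r * norm (a - b)"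
      using n2 by simp
    moreover have "norm (cnj (a - b) * of_real (norm a powr r)) = norm (a - b) * norm a powr r"
      by (simp only: norm_mult complex_mod_cnj norm_of_real) simp
    ultimately show ?thesis unfolding eq
      by (intro order_trans[OF norm_triangle_ineq]) (simp add: algebra_simps)
  qed
  show ?thesis
  proof (cases "norm b \<le> norm a")
    case True
    then show ?thesis using *[of b a] by simp
  next
    case False
    then show ?thesis using *[of a b] by (simp add: norm_minus_commute max_def)
  qed
qed

text \<open>Summation by parts of \<open>g = fdiff f\<close> against \<open>k\<close>, which is
  chosen so that g k = |g|^p. Each boundary term is at most B (2B)^(p-1), and the preceding lemma
  with r = p - 2 turns the difference of \<open>k\<close> into a second difference of
  \<open>f\<close>.\<close>

lemma sum_powr_fdiff_le:
  fixes f :: "nat \<Rightarrow> complex"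
  assumes B: "\<And>n. norm (f n) \<le> B" and p: "p > 2"
  shows "(\<Sum>n<N. norm (fdiff f n) powr p) \<le> 2 * B * (2 * B) powr (p - 1)
    + (p - 1) * (\<Sum>n<N. norm (f (Suc n)) * norm (fdiff (fdiff f) n)
        * max (norm (fdiff f (Suc n))) (norm (fdiff f n)) powr (p - 2))"
proof -
  define g where "g = fdiff f"
  define k where "k n = cnj (g n) * of_real (norm (g n) powr (p - 2))" for n
  have B0: "B \<ge> 0" using B[of 0] norm_ge_zero order_trans by blast
  have parts: "(\<Sum>n<N. g n * k n) = f N * k N - f 0 * k 0 - (\<Sum>n<N. f (Suc n) * (k (Suc n) - k n))"
    by (induction N) (simp_all add: g_def fdiff_def algebra_simps)
  have gk: "g n * k n = of_real (norm (g n) powr p)" for n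
  proof (cases "g n = 0")
    case False
    have "g n * k n = of_real ((norm (g n))\<^sup>2 * norm (g n) powr (p - 2))"
      unfolding k_def by (simp add: mult.assoc[symmetric] complex_norm_square[symmetric])
    also have "(norm (g n))\<^sup>2 = norm (g n) powr 2"
      using False by (subst powr_numeral) auto
    also have "norm (g n) powr 2 * norm (g n) powr (p - 2) = norm (g n) powr (2 + (p - 2))"
      by (rule powr_add[symmetric])
    finally show ?thesis by simp
  qed (simp add: k_def)
  have gB: "norm (g n) \<le> 2 * B" for n
    using norm_triangle_ineq4[of "f (Suc n)" "f n"] B[of n] B[of "Suc n"] by (simp add: g_def fdiff_def)
  have kB: "norm (k n) \<le> (2 * B) powr (p - 1)" for n
  proof (cases "g n = 0")
    case False
    have "norm (k n) = norm (g n) powr 1 * norm (g n) powr (p - 2)"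
      by (simp add: k_def norm_mult)
    also have "\<dots> = norm (g n) powr (1 + (p - 2))" by (rule powr_add[symmetric])
    also have "\<dots> = norm (g n) powr (p - 1)" by (simp add: algebra_simps)
    also have "\<dots> \<le> (2 * B) powr (p - 1)" using gB p by (intro powr_mono2) auto
    finally show ?thesis .
  qed (simp add: k_def)
  have bd: "norm (f n * k n) \<le> B * (2 * B) powr (p - 1)" for n
    unfolding norm_mult using B kB B0 by (intro mult_mono) auto
  have "(\<Sum>n<N. norm (g n) powr p) = norm (\<Sum>n<N. g n * k n)"
    unfolding gk of_real_sum[symmetric] norm_of_real by (simp add: sum_nonneg)
  also have "\<dots> \<le> norm (f N * k N) + norm (f 0 * k 0) + norm (\<Sum>n<N. f (Suc n) * (k (Suc n) - k n))"
    unfolding parts by (intro order_trans[OF norm_triangle_ineq4] add_right_mono norm_triangle_ineq4)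
  also have "norm (\<Sum>n<N. f (Suc n) * (k (Suc n) - k n)) \<le> (\<Sum>n<N. (p - 1) * (norm (f (Suc n)) * norm (fdiff g n)
        * max (norm (g (Suc n))) (norm (g n)) powr (p - 2)))"
  proof (intro sum_norm_le)
    fix n
    have "norm (k (Suc n) - k n) \<le> (p - 1) * norm (fdiff g n) * max (norm (g (Suc n))) (norm (g n)) powr (p - 2)"
      using norm_cnj_powr_diff_le[of "p - 2" "g (Suc n)" "g n"] p by (simp add: k_def fdiff_def)
    from mult_left_mono[OF this, of "norm (f (Suc n))"]
    show "norm (f (Suc n) * (k (Suc n) - k n)) \<le> (p - 1) * (norm (f (Suc n)) * norm (fdiff g n)
        * max (norm (g (Suc n))) (norm (g n)) powr (p - 2))"
      unfolding norm_mult by (simp add: mult_ac)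
  qed
  finally show ?thesis using bd[of N] bd[of 0] by (simp add: g_def sum_distrib_left)
qed

text \<open>Young's inequality with a small parameter and no attempt at good constants: replace X by
  X / \<eta>^P and Y, W by \<eta> Y, \<eta> W, then bound every factor by the largest. Because 1 <=
  j, the factor \<eta>^(P j) gained from X pays for \<eta>^(k + l).\<close>

lemma weighted_product_le:
  fixes X Y W \<eta> :: real
  assumes "X \<ge> 0" "Y \<ge> 0" "W \<ge> 0" "0 < \<eta>" "\<eta> \<le> 1" "1 \<le> j" "j + k + l = P"
  shows "X ^ j * Y ^ k * W ^ l \<le> (1 / \<eta>) ^ (P * P) * X ^ P + \<eta> * (Y ^ P + W ^ P)"
proof -
  define X' where "X' = X / \<eta> ^ P"
  define M where "M = max X' (max (\<eta> * Y) (\<eta> * W))"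
  have nn: "X' \<ge> 0" "\<eta> * Y \<ge> 0" "\<eta> * W \<ge> 0" using assms by (auto simp: X'_def)
  have M0: "M \<ge> 0" using nn by (auto simp: M_def)
  have P: "P \<ge> 1" using assms by simp
  have e: "\<eta> ^ (P * j) \<le> \<eta> ^ (k + l)"
    using assms by (intro power_decreasing) (auto intro: order_trans[of _ P])
  have "X ^ j * Y ^ k * W ^ l = \<eta> ^ (P * j) * (X' ^ j * (Y ^ k * W ^ l))"
    using assms by (simp add: X'_def power_divide power_mult[symmetric])
  also have "\<dots> \<le> \<eta> ^ (k + l) * (X' ^ j * (Y ^ k * W ^ l))"
    using e nn assms by (intro mult_right_mono) auto
  also have "\<dots> = X' ^ j * (\<eta> * Y) ^ k * (\<eta> * W) ^ l"
    by (simp add: power_add power_mult_distrib algebra_simps)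
  also have "\<dots> \<le> M ^ j * M ^ k * M ^ l"
    using M0 nn by (intro mult_mono power_mono mult_nonneg_nonneg[OF zero_le_power zero_le_power] zero_le_power
        mult_nonneg_nonneg[OF zero_le_power[OF nn(1)] zero_le_power[OF nn(2)]]) (auto simp: M_def)
  also have "\<dots> = M ^ P" using assms by (simp add: power_add[symmetric])
  also have "\<dots> \<le> X' ^ P + (\<eta> * Y) ^ P + (\<eta> * W) ^ P"
    using nn by (auto simp: M_def max_def zero_le_power add_nonneg_nonneg simp del: power_mult_distrib)
  also have "X' ^ P = (1 / \<eta>) ^ (P * P) * X ^ P"
    by (simp add: X'_def power_divide power_mult[symmetric])
  also have "(\<eta> * Y) ^ P \<le> \<eta> * Y ^ P" "(\<eta> * W) ^ P \<le> \<eta> * W ^ P"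
    using assms P power_decreasing[of 1 P \<eta>] by (auto simp: power_mult_distrib intro!: mult_right_mono)
  ultimately show ?thesis by (simp add: algebra_simps)
qed


text \<open>The discrete Gagliardo--Nirenberg step: the exponents are such that a \<open>j\<close>-th difference
  counts as a quantity of homogeneity \<open>j + 1\<close>.\<close>

lemma fdiff_interpolation_step:
  fixes a :: "nat \<Rightarrow> complex" and m :: nat
  assumes a: "\<And>n. norm (a n) \<le> 1" and j: "1 \<le> j" "j < m" and \<eta>: "0 < \<eta>" "\<eta> \<le> 1"
  defines "A \<equiv> \<lambda>j N. \<Sum>n<N. norm ((fdiff ^^ j) a n) powr (real (2*m+2) / real (j+1))"
  shows "\<exists>C\<ge>0. \<forall>N. A j N \<le> C + C * A (j - 1) N + 2 * real (m + 1) * \<eta> * (A (j + 1) N + 2 * A j N)"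
proof -
  define P where "P = 2 * m + 2"
  define p where "p = real P / real (j + 1)"
  define f where "f = (fdiff ^^ (j - 1)) a"
  have f1: "fdiff f = (fdiff ^^ j) a" using j by (cases j) (simp_all add: f_def)
  have f2: "fdiff (fdiff f) = (fdiff ^^ (j + 1)) a" using f1 by simp
  define Ki where "Ki i = (2 ^ i) powr (real P / real (i + 1))" for i :: nat
  have K: "norm ((fdiff ^^ i) a n) powr (real P / real (i + 1)) \<le> Ki i" for i n
    unfolding Ki_def using norm_fdiff_iter_le[OF a] by (intro powr_mono2) auto
  have Ki0: "Ki i \<ge> 0" for i by (simp add: Ki_def)
  have ASuc: "(\<Sum>n<N. norm ((fdiff ^^ i) a (Suc n)) powr (real P / real (i+1))) \<le> A i N + Ki i" for i N
  proof -
    have "(\<Sum>n<N. norm ((fdiff ^^ i) a (Suc n)) powr (real P / real (i+1)))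
        \<le> (\<Sum>n<Suc N. norm ((fdiff ^^ i) a n) powr (real P / real (i+1)))"
      by (subst sum.lessThan_Suc_shift) simp
    also have "\<dots> \<le> A i N + Ki i" using K[of i N] by (simp add: A_def P_def)
    finally show ?thesis .
  qed
  have p2: "p > 2" using j by (simp add: p_def P_def field_simps)
  have pm: "p \<le> real P" using j by (simp add: p_def field_simps)
  define c where "c = (1 / \<eta>) ^ (P * P)"
  have c0: "c \<ge> 0" using \<eta> by (simp add: c_def)
  have term_le: "norm (f (Suc n)) * norm (fdiff (fdiff f) n) * max (norm (fdiff f (Suc n))) (norm (fdiff f n)) powr (p - 2)
      \<le> c * norm (f (Suc n)) powr (real P / real j)
        + \<eta> * (norm (fdiff (fdiff f) n) powr (real P / real (j+2))
               + (norm (fdiff f (Suc n)) powr p + norm (fdiff f n) powr p))" for n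
  proof -
    define x y w where "x = norm (f (Suc n))" and "y = norm (fdiff (fdiff f) n)"
      and "w = max (norm (fdiff f (Suc n))) (norm (fdiff f n))"
    have nn: "x \<ge> 0" "y \<ge> 0" "w \<ge> 0" by (auto simp: x_def y_def w_def max_def)
    \<comment> \<open>These roots have homogeneity 1: \<open>f\<close> is a difference of order j -
      1, so x, y and w have homogeneity j, j + 2 and j + 1. The product to be estimated becomes X^j
      Y^(j+2) W^(2m-2j), of total degree P.\<close>
    define X Y W where "X = x powr (1 / real j)" and "Y = y powr (1 / real (j+2))" and "W = w powr (1 / real (j+1))"
    have root: "(t powr (1 / real i)) ^ k = t powr (real k / real i)" if "t \<ge> 0" "i > 0" "k > 0" for t and i k :: nat
      using that by (cases "t = 0") (auto simp: powr_realpow[symmetric] powr_powr)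
    have XP: "X ^ P = x powr (real P / real j)" unfolding X_def using nn j by (intro root) (auto simp: P_def)
    have YP: "Y ^ P = y powr (real P / real (j+2))" unfolding Y_def using nn j by (intro root) (auto simp: P_def)
    have WP: "W ^ P = w powr p" unfolding W_def p_def using nn j by (intro root) (auto simp: P_def)
    have Xj: "X ^ j = x" unfolding X_def using root[of x j j] nn j by simp
    have Yj: "Y ^ (j+2) = y" unfolding Y_def using root[of y "j+2" "j+2"] nn j by simp
    have Wj: "W ^ (2*m - 2*j) = w powr (p - 2)"
      unfolding W_def using root[of w "j+1" "2*m-2*j"] nn j
      by (simp add: p_def P_def field_simps)
    have "x * y * w powr (p - 2) \<le> c * X ^ P + \<eta> * (Y ^ P + W ^ P)"
    proof -
      have "X \<ge> 0" "Y \<ge> 0" "W \<ge> 0" by (simp_all add: X_def Y_def W_def)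
      hence "X ^ j * Y ^ (j+2) * W ^ (2*m-2*j) \<le> c * X ^ P + \<eta> * (Y ^ P + W ^ P)"
        unfolding c_def using \<eta> j by (intro weighted_product_le) (auto simp: P_def)
      thus ?thesis unfolding Xj Yj Wj .
    qed
    moreover have "w powr p \<le> norm (fdiff f (Suc n)) powr p + norm (fdiff f n) powr p"
      by (auto simp: w_def max_def)
    ultimately have "x * y * w powr (p - 2) \<le> c * x powr (real P / real j) + \<eta> * (y powr (real P / real (j+2))
       + (norm (fdiff f (Suc n)) powr p + norm (fdiff f n) powr p))"
      unfolding XP YP WP using \<eta> by (smt (verit) mult_left_mono)
    thus ?thesis by (simp add: x_def y_def w_def)
  qed
  define T where "T n = norm (f (Suc n)) * norm (fdiff (fdiff f) n) * max (norm (fdiff f (Suc n))) (norm (fdiff f n)) powr (p - 2)" for n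
  define B where "B = (2::real) ^ (j - 1)"
  have fB: "norm (f n) \<le> B" for n unfolding f_def B_def by (rule norm_fdiff_iter_le[OF a])
  define K0 where "K0 = 2 * B * (2 * B) powr (p - 1)"
  have K0: "K0 \<ge> 0" by (simp add: K0_def B_def)
  have main: "A j N \<le> (K0 + real P * (c * Ki (j - 1) + Ki j)) + real P * c * A (j - 1) N + real P * \<eta> * (A (j + 1) N + 2 * A j N)" for N
  proof -
    have sT: "(\<Sum>n<N. T n) \<le> c * (A (j-1) N + Ki (j-1)) + \<eta> * (A (j+1) N + ((A j N + Ki j) + A j N))"
    proof -
      have "(\<Sum>n<N. T n) \<le> (\<Sum>n<N. c * norm (f (Suc n)) powr (real P / real j)
        + \<eta> * (norm (fdiff (fdiff f) n) powr (real P / real (j+2))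
               + (norm (fdiff f (Suc n)) powr p + norm (fdiff f n) powr p)))"
        unfolding T_def by (intro sum_mono term_le)
      also have "\<dots> = c * (\<Sum>n<N. norm (f (Suc n)) powr (real P / real j))
         + \<eta> * ((\<Sum>n<N. norm (fdiff (fdiff f) n) powr (real P / real (j+2)))
         + ((\<Sum>n<N. norm (fdiff f (Suc n)) powr p) + (\<Sum>n<N. norm (fdiff f n) powr p)))"
        by (simp add: sum.distrib sum_distrib_left algebra_simps)
      also have "(\<Sum>n<N. norm (f (Suc n)) powr (real P / real j)) \<le> A (j-1) N + Ki (j-1)"
        using ASuc[of "j-1" N] j by (simp add: f_def)
      also have "(\<Sum>n<N. norm (fdiff (fdiff f) n) powr (real P / real (j+2))) = A (j+1) N"
        unfolding f2 A_def P_def by (simp add: add_ac)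
      also have "(\<Sum>n<N. norm (fdiff f (Suc n)) powr p) \<le> A j N + Ki j"
        using ASuc[of j N] unfolding f1 p_def .
      also have "(\<Sum>n<N. norm (fdiff f n) powr p) = A j N"
        unfolding f1 A_def p_def P_def ..
      finally show ?thesis using c0 \<eta> by (simp add: mult_left_mono add_mono)
    qed
    have T0: "(\<Sum>n<N. T n) \<ge> 0" unfolding T_def by (intro sum_nonneg) auto
    have "A j N = (\<Sum>n<N. norm (fdiff f n) powr p)" unfolding f1 A_def p_def P_def ..
    also have "\<dots> \<le> K0 + (p - 1) * (\<Sum>n<N. T n)"
      using sum_powr_fdiff_le[where f=f and N=N, OF fB p2] by (simp add: T_def K0_def)
    also have "\<dots> \<le> K0 + real P * (\<Sum>n<N. T n)"
      using T0 pm by (intro add_left_mono mult_right_mono) auto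
    also have "\<dots> \<le> K0 + real P * (c * (A (j-1) N + Ki (j-1)) + \<eta> * (A (j+1) N + ((A j N + Ki j) + A j N)))"
      using sT by (intro add_left_mono mult_left_mono) auto
    also have "\<dots> = K0 + real P * (c * Ki (j - 1) + \<eta> * Ki j) + real P * c * A (j - 1) N + real P * \<eta> * (A (j + 1) N + 2 * A j N)"
      by (simp add: algebra_simps)
    also have "\<eta> * Ki j \<le> Ki j" using \<eta> Ki0[of j] mult_right_mono[of \<eta> 1 "Ki j"] by simp
    finally show ?thesis by (simp add: mult_left_mono)
  qed
  define C where "C = (K0 + real P * (c * Ki (j - 1) + Ki j)) + real P * c"
  have A0: "A i N \<ge> 0" for i N unfolding A_def by (intro sum_nonneg) auto
  have C1: "K0 + real P * (c * Ki (j - 1) + Ki j) \<le> C" "real P * c \<le> C" "0 \<le> C"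
    using c0 Ki0 K0 by (auto simp: C_def)
  show ?thesis
  proof (intro exI[of _ C] conjI allI C1(3))
    fix N
    have "real P * c * A (j - 1) N \<le> C * A (j - 1) N" using C1 A0 by (intro mult_right_mono) auto
    thus "A j N \<le> C + C * A (j - 1) N + 2 * real (m + 1) * \<eta> * (A (j + 1) N + 2 * A j N)"
      using main[of N] C1 by (simp add: P_def algebra_simps)
  qed
qed

text \<open>The hypotheses are the endpoints j = 0 and j = m. Going up in j, absorption gives A j <=
  \<epsilon> A (j + 1) + C for every \<epsilon> > 0; going down from the bounded A m, the case
  \<epsilon> = 1 bounds all the others. Partial sums are used because absorption needs finite
  quantities.\<close>

lemma fdiff_summable_interpolation:
  fixes a :: "nat \<Rightarrow> complex" and m :: nat
  assumes a: "\<And>n. norm (a n) \<le> 1"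
    and lp: "summable (\<lambda>n. norm (a n) ^ (2*m+2))"
    and l2: "summable (\<lambda>n. norm ((fdiff ^^ m) a n) ^ 2)"
    and j: "j \<le> m"
  shows "summable (\<lambda>n. norm ((fdiff ^^ j) a n) powr (real (2*m+2) / real (j+1)))"
proof -
  define A where "A = (\<lambda>j N. \<Sum>n<N. norm ((fdiff ^^ j) a n) powr (real (2*m+2) / real (j+1)))"
  have A0: "A i N \<ge> 0" for i N unfolding A_def by (intro sum_nonneg) auto
  have np: "x powr real k = x ^ k" if "x \<ge> 0" "k > 0" for x :: real and k
    using that by (cases "x = 0") (auto simp: powr_realpow)
  have B0: "\<exists>C. \<forall>N. A 0 N \<le> C"
  proof -
    have "A 0 N \<le> (\<Sum>n. norm (a n) ^ (2*m+2))" for N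
    proof -
      have "A 0 N = (\<Sum>n<N. norm (a n) ^ (2*m+2))"
        unfolding A_def by (intro sum.cong) (use np[of _ "2*m+2"] in auto)
      thus ?thesis using lp by (auto intro: sum_le_suminf)
    qed
    thus ?thesis by blast
  qed
  have Bm: "\<exists>C. \<forall>N. A m N \<le> C"
  proof -
    have "real (2 * m + 2) / real (m + 1) = real 2" by (simp add: field_simps)
    hence "A m N = (\<Sum>n<N. norm ((fdiff ^^ m) a n) ^ 2)" for N
      unfolding A_def using np[of _ 2] by (intro sum.cong) auto
    hence "A m N \<le> (\<Sum>n. norm ((fdiff ^^ m) a n) ^ 2)" for N
      using l2 by (auto intro: sum_le_suminf)
    thus ?thesis by blast
  qed
  have eps: "j < m \<Longrightarrow> \<forall>\<epsilon>>0. \<exists>C. \<forall>N. A j N \<le> \<epsilon> * A (j + 1) N + C" for j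
  proof (induction j)
    case 0
    from B0 obtain C where "\<And>N. A 0 N \<le> C" by blast
    hence "A 0 N \<le> \<epsilon> * A (0 + 1) N + C" if "\<epsilon> > 0" for \<epsilon> N
      using A0[of 1 N] that by (simp add: add_increasing)
    thus ?case by blast
  next
    case (Suc i)
    show ?case
    proof (intro allI impI)
      fix \<epsilon> :: real assume \<epsilon>: "\<epsilon> > 0"
      \<comment> \<open>Makes the two terms with \<eta> at most a quarter of A (Suc i) and a quarter
        of \<epsilon> A (Suc i + 1). The induction hypothesis, taken at 1 / (4 C + 1), uses another
        quarter of A (Suc i), so half of it remains on the left.\<close>
      define \<eta> where "\<eta> = min 1 (min (1 / (16 * real (m + 1))) (\<epsilon> / (8 * real (m + 1))))"
      have \<eta>: "0 < \<eta>" "\<eta> \<le> 1" "16 * real (m + 1) * \<eta> \<le> 1" "8 * real (m + 1) * \<eta> \<le> \<epsilon>"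
      proof -
        have M: "real (m + 1) > 0" by simp
        show "0 < \<eta>" "\<eta> \<le> 1" using \<epsilon> by (auto simp: \<eta>_def)
        have "\<eta> \<le> 1 / (16 * real (m + 1))" "\<eta> \<le> \<epsilon> / (8 * real (m + 1))" by (auto simp: \<eta>_def)
        thus "16 * real (m + 1) * \<eta> \<le> 1" "8 * real (m + 1) * \<eta> \<le> \<epsilon>"
          using M by (simp_all add: pos_le_divide_eq mult_ac)
      qed
      have "\<exists>C\<ge>0. \<forall>N. A (Suc i) N \<le> C + C * A (Suc i - 1) N + 2 * real (m + 1) * \<eta> * (A (Suc i + 1) N + 2 * A (Suc i) N)"
        unfolding A_def using Suc.prems \<eta> a by (intro fdiff_interpolation_step) auto
      then obtain C where C: "C \<ge> 0" "\<And>N. A (Suc i) N \<le> C + C * A i N + 2 * real (m + 1) * \<eta> * (A (Suc i + 1) N + 2 * A (Suc i) N)"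
        by auto
      obtain C' where C': "\<And>N. A i N \<le> (1 / (4 * C + 1)) * A (i + 1) N + C'"
      proof -
        have "1 / (4 * C + 1) > 0" using C by simp
        thus ?thesis using Suc.IH Suc.prems that by (metis Suc_lessD)
      qed
      have "A (Suc i) N \<le> \<epsilon> * A (Suc i + 1) N + 2 * (C + C * C')" for N
      proof -
        have "C * A i N \<le> C * ((1 / (4 * C + 1)) * A (Suc i) N + C')"
          using C C'[of N] by (intro mult_left_mono) auto
        also have "\<dots> = (C / (4 * C + 1)) * A (Suc i) N + C * C'" by (simp add: algebra_simps)
        also have "(C / (4 * C + 1)) * A (Suc i) N \<le> 1/4 * A (Suc i) N"
          using C A0 by (intro mult_right_mono) (auto simp: field_simps)
        finally have 1: "C * A i N \<le> 1/4 * A (Suc i) N + C * C'" by simp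
        have 2: "2 * real (m + 1) * \<eta> * (2 * A (Suc i) N) \<le> 1/4 * A (Suc i) N"
          using mult_right_mono[OF \<eta>(3) A0[of "Suc i" N]] by (simp add: algebra_simps)
        have 3: "2 * real (m + 1) * \<eta> * A (Suc i + 1) N \<le> 1/4 * (\<epsilon> * A (Suc i + 1) N)"
          using mult_right_mono[OF \<eta>(4) A0[of "Suc i + 1" N]] by (simp add: algebra_simps)
        have 4: "\<epsilon> * A (Suc i + 1) N \<ge> 0" using \<epsilon> A0 by simp
        show ?thesis using C(2)[of N] 1 2 3 4 unfolding distrib_left by linarith
      qed
      thus "\<exists>C. \<forall>N. A (Suc i) N \<le> \<epsilon> * A (Suc i + 1) N + C" by blast
    qed
  qed
  have "j \<le> m \<Longrightarrow> \<exists>C. \<forall>N. A j N \<le> C"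
  proof (induction j rule: inc_induct)
    case base
    show ?case by (rule Bm)
  next
    case (step i)
    then obtain C where C: "\<And>N. A (Suc i) N \<le> C" by auto
    from eps[of i] step obtain C' where "\<And>N. A i N \<le> 1 * A (i + 1) N + C'"
      using zero_less_one by blast
    hence "A i N \<le> C + C'" for N using C[of N] by (smt (verit) Suc_eq_plus1 mult_1)
    thus ?case by blast
  qed
  with j obtain C where "\<And>N. A j N \<le> C" by blast
  thus ?thesis unfolding A_def by (intro summableI_nonneg_bounded) auto
qed

text \<open>S is the convolution of \<tau> with the kernel r^|k|: \<open>G\<close> collects the
  indices up to n and \<open>F\<close> those from n on. A summable kernel preserves summability, and
  moving n by one changes each weight by a factor between r and 1 / r.\<close>

lemma slowly_varying_majorant:
  fixes \<tau> :: "nat \<Rightarrow> real" and r :: real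
  assumes \<tau>: "\<And>n. \<tau> n \<ge> 0" "summable \<tau>" and r: "0 < r" "r < 1"
  obtains S where "summable S" "\<And>n. \<tau> n \<le> S n" "\<And>n. r * S n \<le> S (Suc n)" "\<And>n. r * S (Suc n) \<le> S n"
proof -
  define T where "T = suminf \<tau>"
  define F where "F n = (\<Sum>k. r ^ k * \<tau> (n + k))" for n
  define G where "G = rec_nat (\<tau> 0) (\<lambda>n g. r * g + \<tau> (Suc n))"
  have G0: "G 0 = \<tau> 0" and GS: "G (Suc n) = r * G n + \<tau> (Suc n)" for n
    by (simp_all add: G_def)
  have Gnn: "G n \<ge> 0" for n by (induction n) (use \<tau> r in \<open>auto simp: G0 GS\<close>)
  have sh: "summable (\<lambda>k. \<tau> (n + k))" for n
    using summable_iff_shift[of \<tau> n] \<tau>(2) by (simp add: add.commute)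
  have le: "r ^ k * \<tau> (n + k) \<le> \<tau> (n + k)" for n k
    using mult_right_mono[OF power_le_one[of r k] \<tau>(1)[of "n+k"]] r by simp
  have sF: "summable (\<lambda>k. r ^ k * \<tau> (n + k))" for n
    using sh[of n] by (rule summable_comparison_test[rotated]) (use le r \<tau> in auto)
  have Fnn: "F n \<ge> 0" for n unfolding F_def using sF r \<tau> by (intro suminf_nonneg) auto
  have FT: "F n \<le> T" for n
  proof -
    have "F n \<le> (\<Sum>k. \<tau> (n + k))" unfolding F_def by (intro suminf_le le sF sh)
    also have "\<dots> = T - sum \<tau> {..<n}"
      using suminf_minus_initial_segment[OF \<tau>(2), of n] by (simp add: T_def add.commute)
    also have "\<dots> \<le> T" using \<tau> by (simp add: sum_nonneg)
    finally show ?thesis .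
  qed
  have FS: "F n = \<tau> n + r * F (Suc n)" for n
  proof -
    have "F n = r ^ 0 * \<tau> (n + 0) + (\<Sum>k. r ^ Suc k * \<tau> (n + Suc k))"
      unfolding F_def using suminf_split_head[OF sF[of n]] by simp
    also have "(\<Sum>k. r ^ Suc k * \<tau> (n + Suc k)) = r * F (Suc n)"
      unfolding F_def by (subst suminf_mult[OF sF, symmetric]) (simp add: mult_ac)
    finally show ?thesis by simp
  qed
  define S where "S n = G n + r * F (Suc n)" for n
  have pT: "sum \<tau> {..<N} \<le> T" for N unfolding T_def using \<tau> by (intro sum_le_suminf) auto
  have Gsum: "(1 - r) * sum G {..<N} \<le> T" for N
  proof -
    \<comment> \<open>The extra term r * G (N - 1) makes the bound inductive. At N = 0 truncated
      subtraction turns it into r * G 0, which the right-hand side has to match.\<close>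
    have "(1 - r) * sum G {..<N} + r * G (N - 1) \<le> sum \<tau> {..<N} + (if N = 0 then r * G 0 else 0)"
    proof (induction N)
      case (Suc N)
      show ?case
      proof (cases N)
        case 0 thus ?thesis by (simp add: G0 algebra_simps)
      next
        case (Suc M)
        have "G N = r * G M + \<tau> N" using GS[of M] Suc by simp
        with Suc.IH Suc show ?thesis by (simp add: algebra_simps)
      qed
    qed auto
    moreover have "r * G (N - 1) \<ge> 0" using r Gnn by simp
    ultimately show ?thesis using pT[of N] by (auto split: if_splits)
  qed
  have Fsum: "(1 - r) * (\<Sum>n<N. F n) \<le> T + r * T" for N
  proof -
    have "(1 - r) * (\<Sum>n<N. F n) = sum \<tau> {..<N} - r * F 0 + r * F N"
    proof (induction N)
      case (Suc N)
      thus ?case using FS[of N] by (simp add: algebra_simps)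
    qed auto
    moreover have "r * F N \<le> r * T" "r * F 0 \<ge> 0" using r FT Fnn by auto
    ultimately show ?thesis using pT[of N] by linarith
  qed
  have "summable G"
    using Gsum r Gnn by (intro summableI_nonneg_bounded[of _ "T / (1 - r)"]) (auto simp: field_simps)
  moreover have "summable F"
    using Fsum r Fnn by (intro summableI_nonneg_bounded[of _ "(T + r * T) / (1 - r)"]) (auto simp: field_simps)
  ultimately have 1: "summable S" unfolding S_def
    by (intro summable_add summable_mult) (simp_all add: summable_Suc_iff)
  have 2: "\<tau> n \<le> S n" for n
  proof -
    have "\<tau> n \<le> G n" using r Gnn by (cases n) (auto simp: G0 GS)
    thus ?thesis using r Fnn[of "Suc n"] by (simp add: S_def add_increasing2)
  qed
  have SS: "S (Suc n) = r * G n + F (Suc n)" for n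
    using FS[of "Suc n"] by (simp add: S_def GS)
  have rr: "r * (r * x) \<le> x" if "x \<ge> 0" for x
    using that r mult_left_le_one_le[of x "r*r"] mult_le_one[of r r] by (simp add: mult.assoc[symmetric])
  have 3: "r * S n \<le> S (Suc n)" for n
    unfolding SS using rr[OF Fnn[of "Suc n"]] by (simp add: S_def algebra_simps)
  have 4: "r * S (Suc n) \<le> S n" for n
    unfolding SS using rr[OF Gnn[of n]] by (simp add: S_def algebra_simps)
  show ?thesis by (rule that[OF 1 2 3 4])
qed

text \<open>One scale sequence \<open>s\<close> that dominates \<open>|D\<^sup>j a|\<close> by \<open>s\<^sup>j\<^sup>+\<^sup>1\<close> for all \<open>j\<close> at once replaces all
  Hoelder estimates.\<close>

lemma scale_sequence_exists:
  fixes a :: "nat \<Rightarrow> complex" and m :: nat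
  assumes a: "\<And>n. norm (a n) \<le> 1"
    and lp: "summable (\<lambda>n. norm (a n) ^ (2*m+2))"
    and l2: "summable (\<lambda>n. norm ((fdiff ^^ m) a n) ^ 2)"
  obtains s :: "nat \<Rightarrow> real" and C :: real
  where "\<And>n. 0 < s n" "\<And>n. s n \<le> 1" "summable (\<lambda>n. s n ^ (2*m+2))"
    "\<And>n. 3 * s n ^ (2*m+2) \<le> 4 * s (Suc n) ^ (2*m+2)"
    "\<And>n. 3 * s (Suc n) ^ (2*m+2) \<le> 4 * s n ^ (2*m+2)"
    "\<And>n j. j \<le> m \<Longrightarrow> norm ((fdiff ^^ j) a n) \<le> C * s n ^ (j+1)"
proof -
  define P where "P = 2*m+2"
  have P: "P > 0" by (simp add: P_def)
  \<comment> \<open>The summand (1/2)^n makes \<tau>, and with it \<open>s\<close>, strictly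
    positive, so that division by powers of \<open>s\<close> is possible later.\<close>
  define \<tau> where "\<tau> n = (\<Sum>j\<le>m. norm ((fdiff ^^ j) a n) powr (real P / real (j+1))) + (1/2) ^ n" for n
  have "summable \<tau>" unfolding \<tau>_def P_def
    by (intro summable_add summable_sum fdiff_summable_interpolation assms summable_geometric) auto
  moreover have \<tau>0: "\<tau> n > 0" for n unfolding \<tau>_def by (intro add_nonneg_pos sum_nonneg) auto
  hence "\<tau> n \<ge> 0" for n by (simp add: less_imp_le)
  ultimately obtain S where S: "summable S" "\<And>n. \<tau> n \<le> S n" "\<And>n. 3/4 * S n \<le> S (Suc n)" "\<And>n. 3/4 * S (Suc n) \<le> S n"
    using slowly_varying_majorant[of \<tau> "3/4"] by auto
  have Spos: "S n > 0" for n using S(2)[of n] \<tau>0[of n] by linarith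
  hence S0: "S n \<ge> 0" for n by (simp add: less_imp_le)
  \<comment> \<open>Dividing by T gives s <= 1. Since T >= 1 and the exponents (j + 1) / P are at
    most 1, the single constant T serves every j.\<close>
  define T where "T = 1 + suminf S"
  have "S n \<le> suminf S" for n
    using sum_le_suminf[OF S(1), of "{n}"] S0 by simp
  moreover have "suminf S \<ge> 0" using S(1) S0 by (intro suminf_nonneg)
  ultimately have T: "T \<ge> 1" "S n \<le> T" for n by (auto simp: T_def intro: add_increasing)
  define s where "s n = root P (S n / T)" for n
  have s_pos: "0 < s n" for n using Spos T P by (simp add: s_def)
  hence s0: "0 \<le> s n" for n by (simp add: less_imp_le)
  have sP: "s n ^ P = S n / T" for n using S0 T P by (simp add: s_def)
  have s1: "s n \<le> 1" for n
  proof -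
    have "S n / T \<le> 1" using T by (simp add: field_simps)
    thus ?thesis using P by (simp add: s_def)
  qed
  have bd: "norm ((fdiff ^^ j) a n) \<le> T * s n ^ (j+1)" if "j \<le> m" for j n
  proof -
    define x where "x = norm ((fdiff ^^ j) a n)"
    have "x powr (real P / real (j+1)) \<le> \<tau> n" unfolding \<tau>_def x_def
      using that by (intro add_increasing2 member_le_sum) auto
    also have "\<dots> \<le> T * s n ^ P" using S(2)[of n] T by (simp add: sP)
    finally have "(x powr (real P / real (j+1))) powr (real (j+1) / real P) \<le> (T * s n ^ P) powr (real (j+1) / real P)"
      by (intro powr_mono2) auto
    also have "(x powr (real P / real (j+1))) powr (real (j+1) / real P) = x"
      using P by (simp add: powr_powr x_def)
    also have "(T * s n ^ P) powr (real (j+1) / real P) = T powr (real (j+1) / real P) * s n ^ (j+1)"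
    proof (cases "s n = 0")
      case True
      thus ?thesis using P by simp
    next
      case False
      hence "s n > 0" using s0[of n] by simp
      hence "s n ^ (j+1) = s n powr real (j+1)" "s n ^ P = s n powr real P"
        by (simp_all only: powr_realpow)
      thus ?thesis using T P by (simp add: powr_mult powr_powr del: of_nat_add power_Suc)
    qed
    also have "T powr (real (j+1) / real P) \<le> T powr 1"
      using T that by (intro powr_mono) (auto simp: P_def field_simps)
    also have "\<dots> = T" using T by simp
    finally show ?thesis unfolding x_def using s0 by (simp add: mult_right_mono)
  qed
  have "summable (\<lambda>n. S n / T)" using S(1) by (rule summable_divide)
  hence "summable (\<lambda>n. s n ^ (2*m+2))" unfolding P_def[symmetric] sP .
  moreover have "3 * s n ^ (2*m+2) \<le> 4 * s (Suc n) ^ (2*m+2)" "3 * s (Suc n) ^ (2*m+2) \<le> 4 * s n ^ (2*m+2)" for n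
    unfolding P_def[symmetric] sP using S(3,4)[of n] T by (auto simp: field_simps)
  ultimately show ?thesis using that[OF s_pos s1 _ _ _ bd] by blast
qed

section \<open>Homogeneity classes and formal solutions\<close>

lemma poly_eq_sum_le:
  fixes p :: "'a::comm_semiring_1 poly"
  assumes "degree p \<le> D"
  shows "poly p x = (\<Sum>i\<le>D. coeff p i * x ^ i)"
  unfolding poly_altdef using assms
  by (intro sum.mono_neutral_left) (auto simp: coeff_eq_0)

section \<open>Sequences graded by powers of a scale, and polynomials in u with such
  coefficients\<close>

locale scale_sequence =
  fixes s :: "nat \<Rightarrow> real"
  assumes s_nonneg: "0 \<le> s n" and s_le_1: "s n \<le> 1" and s_Suc_le: "3 * s (Suc n) \<le> 4 * s n"
begin

definition bigo :: "nat \<Rightarrow> (nat \<Rightarrow> complex) \<Rightarrow> bool" where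
  "bigo k f \<longleftrightarrow> (\<exists>C. \<forall>n. norm (f n) \<le> C * s n ^ k)"

lemma bigoE:
  assumes "bigo k f"
  obtains C where "C \<ge> 0" "\<And>n. norm (f n) \<le> C * s n ^ k"
proof -
  from assms obtain C where C: "\<And>n. norm (f n) \<le> C * s n ^ k" by (auto simp: bigo_def)
  have "norm (f n) \<le> \<bar>C\<bar> * s n ^ k" for n
    using C[of n] s_nonneg[of n] by (smt (verit) mult_right_mono zero_le_power)
  thus ?thesis using that[of "\<bar>C\<bar>"] by auto
qed

lemma bigo_add: "bigo k f \<Longrightarrow> bigo k g \<Longrightarrow> bigo k (\<lambda>n. f n + g n)"
proof -
  assume "bigo k f" "bigo k g"
  then obtain C D where "\<And>n. norm (f n) \<le> C * s n ^ k" "\<And>n. norm (g n) \<le> D * s n ^ k"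
    by (auto simp: bigo_def)
  hence "norm (f n + g n) \<le> (C + D) * s n ^ k" for n
    by (smt (verit) distrib_right norm_triangle_ineq)
  thus ?thesis by (auto simp: bigo_def)
qed

lemma bigo_mult: "bigo k f \<Longrightarrow> bigo l g \<Longrightarrow> bigo (k + l) (\<lambda>n. f n * g n)"
proof -
  assume "bigo k f" "bigo l g"
  then obtain C D where "C \<ge> 0" "\<And>n. norm (f n) \<le> C * s n ^ k" "\<And>n. norm (g n) \<le> D * s n ^ l"
    by (metis bigoE)
  hence "norm (f n * g n) \<le> (C * s n ^ k) * (D * s n ^ l)" for n
    unfolding norm_mult by (intro mult_mono) (auto simp: s_nonneg)
  thus ?thesis by (auto simp: bigo_def power_add mult_ac intro!: exI[of _ "C * D"])
qed

lemma bigo_const: "bigo 0 (\<lambda>n. c)" by (auto simp: bigo_def)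

lemma bigo_zero: "bigo k (\<lambda>n. 0)" by (auto simp: bigo_def intro: exI[of _ 0])

lemma bigo_weaken:
  assumes "bigo l f" "k \<le> l"
  shows "bigo k f"
proof -
  from assms(1) obtain C where C: "C \<ge> 0" "\<And>n. norm (f n) \<le> C * s n ^ l" by (rule bigoE) blast
  have "C * s n ^ l \<le> C * s n ^ k" for n
    using C(1) assms(2) s_nonneg s_le_1 by (intro mult_left_mono power_decreasing) auto
  hence "norm (f n) \<le> C * s n ^ k" for n by (rule order_trans[OF C(2)])
  thus ?thesis by (auto simp: bigo_def)
qed

lemma bigo_Suc:
  assumes "bigo k f"
  shows "bigo k (\<lambda>n. f (Suc n))"
proof -
  from assms obtain C where C: "C \<ge> 0" "\<And>n. norm (f n) \<le> C * s n ^ k" by (rule bigoE) blast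
  have "norm (f (Suc n)) \<le> (C * (4/3)^k) * s n ^ k" for n
  proof -
    have "s (Suc n) ^ k \<le> (4/3 * s n) ^ k"
      using s_Suc_le[of n] s_nonneg by (intro power_mono) auto
    hence "C * s (Suc n) ^ k \<le> C * (4/3 * s n) ^ k" using C by (intro mult_left_mono)
    thus ?thesis using C(2)[of "Suc n"] unfolding power_mult_distrib by (simp add: mult.assoc)
  qed
  thus ?thesis by (auto simp: bigo_def)
qed

lemma bigo_cnj: "bigo k (\<lambda>n. cnj (f n)) \<longleftrightarrow> bigo k f"
  by (simp add: bigo_def)

text \<open>A discrete symbol class. The parameter \<open>d\<close> is the budget of differences
  that may still be taken; each iteration of \<open>wkb\<close> spends one.\<close>

definition smooth :: "nat \<Rightarrow> nat \<Rightarrow> (nat \<Rightarrow> complex) \<Rightarrow> bool" where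
  "smooth k d f \<longleftrightarrow> (\<forall>j\<le>d. bigo (k + j) ((fdiff ^^ j) f))"

lemma smooth_0: "smooth k 0 f \<longleftrightarrow> bigo k f"
  by (simp add: smooth_def)

lemma smooth_Suc: "smooth k (Suc d) f \<longleftrightarrow> bigo k f \<and> smooth (Suc k) d (fdiff f)"
proof -
  have "(\<forall>j\<le>Suc d. bigo (k + j) ((fdiff ^^ j) f)) \<longleftrightarrow>
    bigo k f \<and> (\<forall>j\<le>d. bigo (k + Suc j) ((fdiff ^^ Suc j) f))"
    by (metis (no_types, lifting) Suc_le_mono add_0_right funpow_0 le0 not0_implies_Suc)
  thus ?thesis by (simp add: smooth_def funpow_swap1)
qed

lemma smooth_imp_bigo: "smooth k d f \<Longrightarrow> bigo k f"
  by (cases d) (auto simp: smooth_0 smooth_Suc)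

lemma smooth_weaken: "smooth l d f \<Longrightarrow> k \<le> l \<Longrightarrow> d' \<le> d \<Longrightarrow> smooth k d' f"
  unfolding smooth_def using bigo_weaken[of "l + j" "(fdiff ^^ j) f" "k + j" for j] by simp

lemma smooth_add: "smooth k d f \<Longrightarrow> smooth k d g \<Longrightarrow> smooth k d (\<lambda>n. f n + g n)"
proof (induction d arbitrary: k f g)
  case (Suc d)
  have "fdiff (\<lambda>n. f n + g n) = (\<lambda>n. fdiff f n + fdiff g n)" by (auto simp: fdiff_def)
  with Suc show ?case by (auto simp: smooth_Suc bigo_add)
qed (auto simp: smooth_0 bigo_add)

lemma smooth_zero: "smooth k d (\<lambda>n. 0)"
proof (induction d arbitrary: k)
  case (Suc d)
  have "fdiff (\<lambda>n. 0::complex) = (\<lambda>n. 0)" by (auto simp: fdiff_def)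
  with Suc show ?case by (auto simp: smooth_Suc bigo_zero)
qed (auto simp: smooth_0 bigo_zero)

lemma smooth_const: "smooth 0 d (\<lambda>n. c)"
proof (cases d)
  case (Suc d')
  have "fdiff (\<lambda>n. c) = (\<lambda>n. 0)" by (auto simp: fdiff_def)
  with Suc show ?thesis by (auto simp: smooth_Suc bigo_const smooth_zero)
qed (auto simp: smooth_0 bigo_const)

lemma smooth_shift: "smooth k d f \<Longrightarrow> smooth k d (\<lambda>n. f (Suc n))"
proof (induction d arbitrary: k f)
  case (Suc d)
  have "fdiff (\<lambda>n. f (Suc n)) = (\<lambda>n. fdiff f (Suc n))" by (auto simp: fdiff_def)
  with Suc show ?case by (auto simp: smooth_Suc bigo_Suc)
qed (auto simp: smooth_0 bigo_Suc)

lemma smooth_cnj: "smooth k d f \<Longrightarrow> smooth k d (\<lambda>n. cnj (f n))"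
proof (induction d arbitrary: k f)
  case (Suc d)
  have "fdiff (\<lambda>n. cnj (f n)) = (\<lambda>n. cnj (fdiff f n))" by (auto simp: fdiff_def)
  with Suc show ?case by (auto simp: smooth_Suc bigo_cnj)
qed (auto simp: smooth_0 bigo_cnj)

text \<open>The discrete Leibniz rule has one shifted factor. This is why the classes must be closed
  under n -> n + 1, and why \<open>s\<close> may grow only by a bounded factor in each step.\<close>

lemma smooth_mult: "smooth k d f \<Longrightarrow> smooth l d g \<Longrightarrow> smooth (k + l) d (\<lambda>n. f n * g n)"
proof (induction d arbitrary: k l f g)
  case (Suc d)
  have eq: "fdiff (\<lambda>n. f n * g n) = (\<lambda>n. fdiff f n * g n + f (Suc n) * fdiff g n)"
    by (auto simp: fdiff_def algebra_simps)
  have f: "smooth k d f" "smooth (Suc k) d (fdiff f)" "bigo k f"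
    using Suc.prems smooth_weaken[of k "Suc d" f k d] by (auto simp: smooth_Suc)
  have g: "smooth l d g" "smooth (Suc l) d (fdiff g)" "bigo l g"
    using Suc.prems smooth_weaken[of l "Suc d" g l d] by (auto simp: smooth_Suc)
  have "smooth (Suc (k + l)) d (\<lambda>n. fdiff f n * g n)" using Suc.IH[OF f(2) g(1)] by simp
  moreover have "smooth (Suc (k + l)) d (\<lambda>n. f (Suc n) * fdiff g n)"
    using Suc.IH[OF smooth_shift[OF f(1)] g(2)] by simp
  ultimately show ?case unfolding smooth_Suc eq using f g by (auto intro: smooth_add bigo_mult)
qed (auto simp: smooth_0 bigo_mult)

lemma smooth_cmult: "smooth k d f \<Longrightarrow> smooth k d (\<lambda>n. c * f n)"
  using smooth_mult[OF smooth_const, of k d f c] by simp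

lemma smooth_uminus: "smooth k d f \<Longrightarrow> smooth k d (\<lambda>n. - f n)"
  using smooth_cmult[of k d f "-1"] by simp

lemma smooth_sum: "(\<And>i. i \<in> I \<Longrightarrow> smooth k d (f i)) \<Longrightarrow> smooth k d (\<lambda>n. \<Sum>i\<in>I. f i n)"
  by (induction I rule: infinite_finite_induct) (auto simp: smooth_zero intro: smooth_add)

text \<open>Sequences of polynomials (in \<open>u = 1 / (1 - z)\<close>) of bounded degree whose \<open>i\<close>-th coefficient
  has homogeneity at least \<open>k + e i\<close>; only \<open>e = 0\<close> and \<open>e = 1\<close> are used.\<close>

definition pclass :: "nat \<Rightarrow> nat \<Rightarrow> nat \<Rightarrow> (nat \<Rightarrow> complex poly) \<Rightarrow> bool" where
  "pclass e k d p \<longleftrightarrow> (\<exists>D. \<forall>n. degree (p n) \<le> D) \<and> (\<forall>i. smooth (k + e * i) d (\<lambda>n. coeff (p n) i))"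

lemma pclass_weaken: "pclass e l d p \<Longrightarrow> k \<le> l \<Longrightarrow> d' \<le> d \<Longrightarrow> pclass e k d' p"
  unfolding pclass_def by (auto intro: smooth_weaken)

lemma pclass_1_imp_0: "pclass 1 k d p \<Longrightarrow> pclass 0 k d p"
  unfolding pclass_def by (auto intro: smooth_weaken)

lemma pclass_add: "pclass e k d p \<Longrightarrow> pclass e k d q \<Longrightarrow> pclass e k d (\<lambda>n. p n + q n)"
proof -
  assume pq: "pclass e k d p" "pclass e k d q"
  then obtain D E where "\<And>n. degree (p n) \<le> D" "\<And>n. degree (q n) \<le> E" by (auto simp: pclass_def)
  hence "degree (p n + q n) \<le> max D E" for n by (intro degree_add_le) (auto intro: max.coboundedI1 max.coboundedI2)
  with pq show ?thesis by (auto simp: pclass_def intro: smooth_add)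
qed

lemma pclass_uminus: "pclass e k d p \<Longrightarrow> pclass e k d (\<lambda>n. - p n)"
  unfolding pclass_def by (auto intro: smooth_uminus)

lemma pclass_diff: "pclass e k d p \<Longrightarrow> pclass e k d q \<Longrightarrow> pclass e k d (\<lambda>n. p n - q n)"
  using pclass_add[OF _ pclass_uminus, of e k d p q] by simp

lemma pclass_mult: "pclass e k d p \<Longrightarrow> pclass e l d q \<Longrightarrow> pclass e (k + l) d (\<lambda>n. p n * q n)"
proof -
  assume pq: "pclass e k d p" "pclass e l d q"
  then obtain D E where "\<And>n. degree (p n) \<le> D" "\<And>n. degree (q n) \<le> E" by (auto simp: pclass_def)
  hence "degree (p n * q n) \<le> D + E" for n using order_trans[OF degree_mult_le add_mono] by blast
  moreover have "smooth (k + l + e * i) d (\<lambda>n. coeff (p n * q n) i)" for i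
    unfolding coeff_mult
  proof (intro smooth_sum)
    fix j assume "j \<in> {..i}"
    then obtain h where "i = j + h" using le_Suc_ex by auto
    hence "k + l + e * i = (k + e * j) + (l + e * (i - j))"
      by (simp add: algebra_simps)
    moreover have "smooth (k + e * j) d (\<lambda>n. coeff (p n) j)" "smooth (l + e * (i - j)) d (\<lambda>n. coeff (q n) (i - j))"
      using pq unfolding pclass_def by blast+
    ultimately show "smooth (k + l + e * i) d (\<lambda>n. coeff (p n) j * coeff (q n) (i - j))"
      using smooth_mult by presburger
  qed
  ultimately show ?thesis by (auto simp: pclass_def)
qed

lemma pclass_const: "smooth k d f \<Longrightarrow> pclass e k d (\<lambda>n. [:f n:])"
proof -
  assume f: "smooth k d f"
  have "smooth (k + e * i) d (\<lambda>n. coeff [:f n:] i)" for i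
    using f by (cases i) (auto simp: smooth_zero)
  thus ?thesis by (auto simp: pclass_def)
qed

lemma pclass_one: "pclass e 0 d (\<lambda>n. 1)"
  using pclass_const[OF smooth_const, of e d 1] by (simp add: one_pCons)

lemma pclass_zero: "pclass e k d (\<lambda>n. 0)"
  using pclass_const[OF smooth_zero, of e k d] by simp

lemma pclass_smult: "smooth k d f \<Longrightarrow> pclass e l d p \<Longrightarrow> pclass e (k + l) d (\<lambda>n. smult (f n) (p n))"
  using pclass_mult[OF pclass_const, of k d f e l p] by simp

lemma pclass_cmult: "pclass e k d p \<Longrightarrow> pclass e k d (\<lambda>n. smult c (p n))"
  using pclass_smult[OF smooth_const[of d c], of e k p] by simp

lemma pclass_pCons: "pclass e (k + e) d p \<Longrightarrow> pclass e k d (\<lambda>n. pCons 0 (p n))"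
proof -
  assume p: "pclass e (k + e) d p"
  then obtain D where "\<And>n. degree (p n) \<le> D" by (auto simp: pclass_def)
  hence "degree (pCons 0 (p n)) \<le> Suc D" for n by (meson Suc_le_mono degree_pCons_le order_trans)
  moreover have "smooth (k + e * i) d (\<lambda>n. coeff (pCons 0 (p n)) i)" for i
  proof (cases i)
    case (Suc j)
    have "smooth (k + e + e * j) d (\<lambda>n. coeff (p n) j)" using p by (simp add: pclass_def)
    thus ?thesis by (simp add: Suc algebra_simps)
  qed (simp add: smooth_zero)
  ultimately show ?thesis unfolding pclass_def by blast
qed

lemma pclass_X_minus_1: "pclass e (k + e) d p \<Longrightarrow> pclass e k d (\<lambda>n. [:-1, 1:] * p n)"
  using pclass_diff[OF pclass_pCons pclass_weaken, of e k d p "k + e" d p] by simp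

lemma pclass_shift: "pclass e k d p \<Longrightarrow> pclass e k d (\<lambda>n. p (Suc n))"
  unfolding pclass_def using smooth_shift by blast

lemma pclass_fdiff: "pclass e k (Suc d) p \<Longrightarrow> pclass e (Suc k) d (fdiff p)"
proof -
  assume p: "pclass e k (Suc d) p"
  then obtain D where "\<And>n. degree (p n) \<le> D" by (auto simp: pclass_def)
  hence "degree (fdiff p n) \<le> D" for n unfolding fdiff_def by (intro degree_diff_le)
  moreover have "(\<lambda>n. coeff (fdiff p n) i) = fdiff (\<lambda>n. coeff (p n) i)" for i
    by (rule ext) (simp add: fdiff_def)
  moreover have "smooth (Suc k + e * i) d (fdiff (\<lambda>n. coeff (p n) i))" for i
    using p by (simp add: pclass_def smooth_Suc)
  ultimately show ?thesis unfolding pclass_def by metis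
qed

lemma pclass_power: "pclass e k d p \<Longrightarrow> pclass e (k * j) d (\<lambda>n. p n ^ j)"
proof (induction j)
  case (Suc j)
  show ?case using pclass_mult[OF Suc.prems Suc.IH[OF Suc.prems]] by simp
qed (simp add: pclass_one)

lemma pclass_sum: "(\<And>i. i \<in> I \<Longrightarrow> pclass e k d (f i)) \<Longrightarrow> pclass e k d (\<lambda>n. \<Sum>i\<in>I. f i n)"
proof (induction I rule: infinite_finite_induct)
  case (insert x F)
  have "pclass e k d (\<lambda>n. f x n + (\<Sum>i\<in>F. f i n))"
    using insert by (intro pclass_add) auto
  thus ?case using insert by simp
qed (simp_all add: pclass_zero)

text \<open>Since \<open>u\<close> becomes \<open>1 - u\<close> under \<open>z \<mapsto> 1 / z\<close>, reflecting a polynomial means conjugating its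
  values at points of the unit circle.\<close>

definition prefl :: "complex poly \<Rightarrow> complex poly" where
  "prefl p = pcompose (map_poly cnj p) [:1, -1:]"

lemma poly_prefl: "poly (prefl p) u = cnj (poly p (1 - cnj u))"
  using poly_cnj[of p "1 - cnj u"] by (simp add: prefl_def poly_pcompose)

text \<open>Expanding powers of 1 - u sends coefficient j only to coefficients i <= j, whose
  required homogeneity k + e i is no larger. So the grading survives the substitution.\<close>

lemma pclass_prefl:
  assumes "pclass e k d p"
  shows "pclass e k d (\<lambda>n. prefl (p n))"
proof -
  from assms obtain D where D: "\<And>n. degree (p n) \<le> D" by (auto simp: pclass_def)
  have eq: "prefl (p n) = (\<Sum>j\<le>D. smult (cnj (coeff (p n) j)) ([:1, -1:] ^ j))" for n
  proof (rule poly_eq_poly_eq_iff[THEN iffD1], rule ext)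
    fix u
    have "poly (prefl (p n)) u = (\<Sum>j\<le>D. cnj (coeff (p n) j) * (1 - u) ^ j)"
      using poly_eq_sum_le[OF D, of n "1 - cnj u"] by (simp add: poly_prefl)
    thus "poly (prefl (p n)) u = poly (\<Sum>j\<le>D. smult (cnj (coeff (p n) j)) ([:1, -1:] ^ j)) u"
      by (simp add: poly_sum poly_power)
  qed
  have "pclass e k d (\<lambda>n. smult (cnj (coeff (p n) j)) ([:1, -1:] ^ j))" for j
    unfolding pclass_def
  proof (intro conjI allI)
    show "\<exists>D. \<forall>n. degree (smult (cnj (coeff (p n) j)) ([:1, -1:] ^ j)) \<le> D"
      using degree_smult_le by blast
    fix i
    show "smooth (k + e * i) d (\<lambda>n. coeff (smult (cnj (coeff (p n) j)) ([:1, -1:] ^ j)) i)"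
    proof (cases "i \<le> j")
      case True
      have "smooth (k + e * j) d (\<lambda>n. cnj (coeff (p n) j))"
        using assms by (auto simp: pclass_def intro: smooth_cnj)
      hence "smooth (k + e * i) d (\<lambda>n. cnj (coeff (p n) j))"
        by (rule smooth_weaken) (use True in auto)
      hence "smooth (k + e * i) d (\<lambda>n. coeff ([:1, -1:] ^ j) i * cnj (coeff (p n) j))"
        by (rule smooth_cmult)
      thus ?thesis by (simp add: mult.commute)
    next
      case False
      hence "coeff ([:1, -1::complex:] ^ j) i = 0"
        by (intro coeff_eq_0) (simp add: degree_power_eq)
      thus ?thesis by (simp add: smooth_zero)
    qed
  qed
  hence "pclass e k d (\<lambda>n. \<Sum>j\<le>D. smult (cnj (coeff (p n) j)) ([:1, -1:] ^ j))"
    by (intro pclass_sum)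
  thus ?thesis by (simp add: eq)
qed

text \<open>\<open>u * wkb a k\<close> is the \<open>k\<close>-th iterate for the Riccati recursion, solved for the term \<open>(1 - z) b\<^sub>n\<close>;
  the products with \<open>u\<close> and \<open>u - 1 = z u\<close> keep everything polynomial in \<open>u\<close>.\<close>

primrec wkb :: "(nat \<Rightarrow> complex) \<Rightarrow> nat \<Rightarrow> nat \<Rightarrow> complex poly" where
  "wkb a 0 n = 0"
| "wkb a (Suc k) n = smult (a n) ([:0, 1:] * ([:-1, 1:] * (wkb a k n * wkb a k (Suc n))))
     - [:cnj (a n):] - [:0, 1:] * fdiff (wkb a k) n"

declare wkb.simps(2) [simp del]

text \<open>With e = 1 a factor u costs one unit of homogeneity. The recursion can afford it: u
  alone multiplies a difference, which has just gained a unit, and the quadratic term has two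
  factors linear in u against three factors of homogeneity 1.\<close>

lemma wkb_class:
  assumes a: "smooth 1 m a" and k: "k \<le> m + 1"
  shows "pclass 1 1 (m + 1 - k) (wkb a k)"
  using k
proof (induction k)
  case 0
  show ?case using pclass_zero by simp
next
  case (Suc k)
  define d where "d = m - k"
  have d: "m + 1 - k = Suc d" "m + 1 - Suc k = d" "d \<le> m" using Suc.prems by (auto simp: d_def)
  have IH: "pclass 1 1 (Suc d) (wkb a k)" using Suc.IH Suc.prems unfolding d by simp
  have IH': "pclass 1 1 d (wkb a k)" using IH by (rule pclass_weaken) auto
  have ad: "smooth 1 d a" using a by (rule smooth_weaken) (use d in auto)
  have 1: "pclass 1 1 d (\<lambda>n. [:cnj (a n):])" by (intro pclass_const smooth_cnj ad)
  have "pclass 1 (1 + 1) d (fdiff (wkb a k))" using pclass_fdiff[OF IH] by simp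
  hence 2: "pclass 1 1 d (\<lambda>n. [:0, 1:] * fdiff (wkb a k) n)" using pclass_pCons by simp
  have "pclass 1 (1 + 1) d (\<lambda>n. wkb a k n * wkb a k (Suc n))"
    by (intro pclass_mult pclass_shift IH')
  hence "pclass 1 1 d (\<lambda>n. [:-1, 1:] * (wkb a k n * wkb a k (Suc n)))"
    by (intro pclass_X_minus_1)
  hence "pclass 1 0 d (\<lambda>n. pCons 0 ([:-1, 1:] * (wkb a k n * wkb a k (Suc n))))"
    by (intro pclass_pCons) simp
  hence "pclass 1 0 d (\<lambda>n. [:0, 1:] * ([:-1, 1:] * (wkb a k n * wkb a k (Suc n))))" by simp
  from pclass_smult[OF ad this]
  have 3: "pclass 1 1 d (\<lambda>n. smult (a n) ([:0, 1:] * ([:-1, 1:] * (wkb a k n * wkb a k (Suc n)))))"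
    by simp
  show ?case unfolding d(2) wkb.simps(2) by (intro pclass_diff 1 2 3)
qed

text \<open>With e = 0 powers of u are free. An increment enters the next one either through a
  difference or multiplied by \<open>a\<close>, and gains one unit either way. At k = m no
  difference is left, but homogeneity m + 1 has been reached.\<close>

lemma wkb_increment_class:
  assumes a: "smooth 1 m a" and k: "k \<le> m"
  shows "pclass 0 (k + 1) (m - k) (\<lambda>n. wkb a (Suc k) n - wkb a k n)"
  using k
proof (induction k)
  case 0
  have "pclass 0 1 m (\<lambda>n. - [:cnj (a n):])" by (intro pclass_uminus pclass_const smooth_cnj a)
  thus ?case by (simp add: fdiff_def wkb.simps(2))
next
  case (Suc k)
  define d where "d = m - Suc k"
  have d: "m - k = Suc d" "d \<le> m" using Suc.prems by (auto simp: d_def)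
  define \<delta> where "\<delta> n = wkb a (Suc k) n - wkb a k n" for n
  have IH: "pclass 0 (k + 1) (Suc d) \<delta>" using Suc.IH Suc.prems unfolding d \<delta>_def by simp
  have IH': "pclass 0 (k + 1) d \<delta>" using IH by (rule pclass_weaken) auto
  have ad: "smooth 1 d a" using a by (rule smooth_weaken) (use d in auto)
  have w: "pclass 0 0 d (wkb a (Suc k))" "pclass 0 0 d (wkb a k)"
    using wkb_class[OF a, of "Suc k"] wkb_class[OF a, of k] Suc.prems
    by (auto intro!: pclass_weaken[OF pclass_1_imp_0] simp: d_def)
  have 1: "pclass 0 (k + 2) d (\<lambda>n. [:0, 1:] * fdiff \<delta> n)"
    using pclass_pCons[of 0 "k+2" d "fdiff \<delta>"] pclass_fdiff[OF IH] by simp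
  have "pclass 0 (k + 1 + 0) d (\<lambda>n. \<delta> n * wkb a (Suc k) (Suc n))"
    by (intro pclass_mult pclass_shift IH' w)
  moreover have "pclass 0 (0 + (k + 1)) d (\<lambda>n. wkb a k n * \<delta> (Suc n))"
    by (intro pclass_mult pclass_shift[of _ _ _ \<delta>] IH' w)
  ultimately have "pclass 0 (k + 1) d (\<lambda>n. \<delta> n * wkb a (Suc k) (Suc n) + wkb a k n * \<delta> (Suc n))"
    by (intro pclass_add) simp_all
  hence "pclass 0 (k + 1) d (\<lambda>n. pCons 0 ([:-1, 1:] * (\<delta> n * wkb a (Suc k) (Suc n) + wkb a k n * \<delta> (Suc n))))"
    by (intro pclass_X_minus_1 pclass_pCons) simp
  from pclass_smult[OF ad this]
  have 2: "pclass 0 (k + 2) d (\<lambda>n. smult (a n) ([:0, 1:] * ([:-1, 1:] * (\<delta> n * wkb a (Suc k) (Suc n) + wkb a k n * \<delta> (Suc n)))))"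
    by simp
  define W where "W = wkb a (Suc k)"
  define V where "V = wkb a k"
  have alg: "smult c (U * (M * (w * w'))) - A - U * (w' - w) - (smult c (U * (M * (v * v'))) - A - U * (v' - v))
    = smult c (U * (M * ((w - v) * w' + v * (w' - v')))) - U * ((w' - v') - (w - v))"
    for c :: complex and U M A w w' v v' :: "complex poly"
    by (simp add: algebra_simps smult_add_right smult_diff_right)
  have e1: "wkb a (Suc (Suc k)) n = smult (a n) ([:0, 1:] * ([:-1, 1:] * (W n * W (Suc n)))) - [:cnj (a n):] - [:0, 1:] * fdiff W n" for n
    unfolding W_def by (rule wkb.simps(2))
  have e2: "W n = smult (a n) ([:0, 1:] * ([:-1, 1:] * (V n * V (Suc n)))) - [:cnj (a n):] - [:0, 1:] * fdiff V n" for n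
    unfolding W_def V_def by (rule wkb.simps(2))
  have \<delta>: "\<delta> = (\<lambda>n. W n - V n)" by (auto simp: \<delta>_def W_def V_def)
  have "wkb a (Suc (Suc k)) n - W n =
    smult (a n) ([:0, 1:] * ([:-1, 1:] * (\<delta> n * W (Suc n) + V n * \<delta> (Suc n)))) - [:0, 1:] * fdiff \<delta> n" for n
    unfolding arg_cong2[where f = "(-)", OF e1 e2] \<delta> fdiff_def by (rule alg)
  hence "pclass 0 (k + 2) d (\<lambda>n. wkb a (Suc (Suc k)) n - W n)"
    using pclass_diff[OF 2 1] unfolding W_def V_def by presburger
  thus ?case by (simp add: d_def W_def)
qed

end

section \<open>Logarithms near 1\<close>

lemma Ln_taylor_bound:
  fixes x :: complex
  assumes "norm x \<le> 1/2"
  shows "norm (Ln (1 - x) + (\<Sum>j=1..m. x ^ j / of_nat j)) \<le> 2 * norm x ^ Suc m"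
proof -
  define f where "f n = (-1) ^ Suc n / of_nat n * (-x) ^ n" for n :: nat
  have f: "f n = - (x ^ n / of_nat n)" for n
    by (simp add: f_def power_mult_distrib[symmetric] mult_ac flip: power_mult_distrib)
  have "f sums Ln (1 - x)" using Ln_series[of "-x"] assms by (simp add: f_def[abs_def])
  hence t: "(\<lambda>n. f (n + Suc m)) sums (Ln (1 - x) - sum f {..<Suc m})"
    by (rule sums_split_initial_segment)
  have "sum f {..<Suc m} = (\<Sum>j=1..m. f j)"
    by (intro sum.mono_neutral_right) (auto simp: f)
  hence e: "Ln (1 - x) - sum f {..<Suc m} = Ln (1 - x) + (\<Sum>j=1..m. x ^ j / of_nat j)"
    by (simp add: f sum_negf)
  have bd: "norm (f (n + Suc m)) \<le> norm x ^ Suc m * (1/2) ^ n" for n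
  proof -
    have "norm (f (n + Suc m)) = norm x ^ (n + Suc m) / real (n + Suc m)"
      unfolding f by (simp add: norm_divide norm_mult norm_power del: of_nat_add of_nat_Suc)
    also have "\<dots> \<le> norm x ^ (n + Suc m) / 1" by (intro divide_left_mono) auto
    also have "\<dots> = norm x ^ Suc m * norm x ^ n" by (simp add: power_add)
    also have "\<dots> \<le> norm x ^ Suc m * (1/2) ^ n" using assms by (intro mult_left_mono power_mono) auto
    finally show ?thesis .
  qed
  have g: "(\<lambda>n. norm x ^ Suc m * (1/2) ^ n) sums (norm x ^ Suc m * 2)"
    using geometric_sums[of "1/2::real"] by (intro sums_mult) simp
  have "norm (\<Sum>n. f (n + Suc m)) \<le> (\<Sum>n. norm x ^ Suc m * (1/2) ^ n)"
    using bd sums_summable[OF g] by (intro norm_suminf_le)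
  thus ?thesis unfolding sums_unique[OF t, symmetric] sums_unique[OF g, symmetric] e by (simp add: mult.commute)
qed

lemma norm_Ln_le_twice:
  fixes x :: complex
  assumes "norm (x - 1) \<le> 1/2"
  shows "norm (Ln x) \<le> 2 * norm (x - 1)"
  using Ln_taylor_bound[of "1 - x" 0] assms by (simp add: norm_minus_commute)

lemma norm_le_exp_minus_1:
  fixes z :: complex
  assumes "norm z \<le> 1/2"
  shows "norm z \<le> 2 * norm (exp z - 1)"
proof (cases "norm (exp z - 1) \<le> 1/2")
  case True
  have "\<bar>Im z\<bar> < pi" using abs_Im_le_cmod[of z] assms pi_gt3 by linarith
  hence "Ln (exp z) = z" by (intro Ln_exp) auto
  thus ?thesis using norm_Ln_le_twice[OF True] by simp
qed (use assms in auto)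

text \<open>Branches cause no trouble: the six logarithms sum to at most 1/2 in modulus, so their
  signed sum is small enough to be compared with its exponential, the quotient of the products. The
  factor 16 is 2 from that comparison times 8 from the denominator, which is at least 1/8.\<close>

lemma Ln_prod3_diff_bound:
  fixes x1 x2 x3 y1 y2 y3 :: complex
  assumes x: "norm (x1 - 1) \<le> 1/24" "norm (x2 - 1) \<le> 1/24" "norm (x3 - 1) \<le> 1/24"
    and y: "norm (y1 - 1) \<le> 1/24" "norm (y2 - 1) \<le> 1/24" "norm (y3 - 1) \<le> 1/24"
  shows "norm ((Ln x1 + Ln x2 + Ln x3) - (Ln y1 + Ln y2 + Ln y3)) \<le> 16 * norm (x1 * x2 * x3 - y1 * y2 * y3)"
proof -
  define S where "S = (Ln x1 + Ln x2 + Ln x3) - (Ln y1 + Ln y2 + Ln y3)"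
  have ln: "norm (Ln x) \<le> 1/12" if "norm (x - 1) \<le> 1/24" for x :: complex
    using norm_Ln_le_twice[of x] that by simp
  have ne: "x \<noteq> 0" if "norm (x - 1) \<le> 1/24" for x :: complex
    using that by auto
  have half: "norm x \<ge> 1/2" if "norm (x - 1) \<le> 1/24" for x :: complex
    using that norm_triangle_ineq2[of 1 "1 - x"] by (simp add: norm_minus_commute)
  have "norm S \<le> norm (Ln x1) + norm (Ln x2) + norm (Ln x3) + (norm (Ln y1) + norm (Ln y2) + norm (Ln y3))"
    unfolding S_def by (intro order_trans[OF norm_triangle_ineq4] add_mono order_trans[OF norm_triangle_ineq]) auto
  also have "\<dots> \<le> 1/2" using ln[OF x(1)] ln[OF x(2)] ln[OF x(3)] ln[OF y(1)] ln[OF y(2)] ln[OF y(3)] by linarith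
  finally have "norm S \<le> 2 * norm (exp S - 1)" by (rule norm_le_exp_minus_1)
  also have "exp S - 1 = (x1 * x2 * x3 - y1 * y2 * y3) / (y1 * y2 * y3)"
    using ne[OF x(1)] ne[OF x(2)] ne[OF x(3)] ne[OF y(1)] ne[OF y(2)] ne[OF y(3)]
    unfolding S_def by (simp add: exp_diff exp_add diff_divide_distrib)
  also have "2 * norm \<dots> \<le> 16 * norm (x1 * x2 * x3 - y1 * y2 * y3)"
  proof -
    have "norm (y1 * y2 * y3) \<ge> 1/2 * (1/2) * (1/2)"
      unfolding norm_mult by (intro mult_mono half y) auto
    hence "2 * norm (x1 * x2 * x3 - y1 * y2 * y3) / norm (y1 * y2 * y3) \<le> 2 * norm (x1 * x2 * x3 - y1 * y2 * y3) / (1/8)"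
      by (intro divide_left_mono) (auto simp: ne[OF y(1)] ne[OF y(2)] ne[OF y(3)])
    thus ?thesis by (simp add: norm_divide)
  qed
  finally show ?thesis by (simp add: S_def)
qed

text \<open>In the next identities \<open>\<beta> = u g\<close>, a prime is the index shift, the suffix \<open>s\<close> is the reflection
  and \<open>r\<close> is the residual \<open>z \<beta> - cnj a - \<beta>' (1 - a z \<beta>)\<close> of the Riccati recursion.\<close>

lemma wkb_determinant_identity:
  fixes a ac u g g' gs gs' r rs :: "complex"
  assumes "r = a * u * (u - 1) * g * g' - ac - u * (g' - g) - g"
    and "rs = ac * u * (u - 1) * gs * gs' - a - (1 - u) * (gs' - gs) - gs"
  defines "w \<equiv> u * (1 - u) * g * gs" and "w' \<equiv> u * (1 - u) * g' * gs'"
  shows "((1 - a * (u - 1) * g) * (1 - w') - r * (1 - u) * gs') * ((1 + ac * u * gs) * (1 - w') - rs * u * g')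
    = r * rs + (1 - a * ac) * (1 - w) * (1 - w')"
  unfolding assms by algebra

text \<open>Relates the true factor 1 - a z b to the bracket of the determinant identity. Once that
  bracket is divided by 1 - w', all correcting factors occur at two consecutive indices and
  telescope in the logarithm. The error is a residual times b - \<beta>, hence quadratic.\<close>

lemma wkb_transfer_identity:
  fixes a ac u z g g' gs gs' r rs b b' :: "complex"
  assumes "r = a * u * (u - 1) * g * g' - ac - u * (g' - g) - g"
    and "rs = ac * u * (u - 1) * gs * gs' - a - (1 - u) * (gs' - gs) - gs"
    and "z * u = u - 1" and "b' * (1 - a * z * b) = z * b - ac"
  defines "w \<equiv> u * (1 - u) * g * gs" and "w' \<equiv> u * (1 - u) * g' * gs'"
  shows "(1 - a * z * b) * (1 - (1 - u) * gs' * b') * (1 - w) =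
    ((1 - a * (u - 1) * g) * (1 - w') - r * (1 - u) * gs') * (1 - (1 - u) * gs * b) + z * rs * (b - u * g)"
  using assms(3,4) unfolding assms(1,2,5,6) by algebra

text \<open>A linear recursion for b - \<beta> driven by the residual. Its multiplier is z (1 -
  |a|^2) divided by two factors close to 1, which is a contraction on |z| = 1/2.\<close>

lemma wkb_difference_identity:
  fixes a ac u z g g' r b b' :: "complex"
  assumes "r = a * u * (u - 1) * g * g' - ac - u * (g' - g) - g"
    and "z * u = u - 1" and "b' * (1 - a * z * b) = z * b - ac"
  shows "(b' - u * g') * (1 - a * z * b) * (1 - a * (u - 1) * g) = z * (1 - a * ac) * (b - u * g) + r * (1 - a * z * b)"
  using assms(2,3) unfolding assms(1) by algebra

section \<open>Comparison on the circle of radius 1/2\<close>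

context scale_sequence
begin

text \<open>Restricted to large n because the logarithms are controlled only once their arguments
  are close to 1.\<close>

definition ubigo :: "nat \<Rightarrow> (nat \<Rightarrow> complex \<Rightarrow> complex) \<Rightarrow> bool" where
  "ubigo k F \<longleftrightarrow> (\<exists>C. \<forall>\<^sub>F n in sequentially. \<forall>z. norm z = 1/2 \<longrightarrow> norm (F n z) \<le> C * s n ^ k)"

lemma ubigoE:
  assumes "ubigo k F"
  obtains C where "C \<ge> 0" "\<forall>\<^sub>F n in sequentially. \<forall>z. norm z = 1/2 \<longrightarrow> norm (F n z) \<le> C * s n ^ k"
proof -
  from assms obtain C where C: "\<forall>\<^sub>F n in sequentially. \<forall>z. norm z = 1/2 \<longrightarrow> norm (F n z) \<le> C * s n ^ k"
    by (auto simp: ubigo_def)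
  have "\<forall>\<^sub>F n in sequentially. \<forall>z. norm z = 1/2 \<longrightarrow> norm (F n z) \<le> \<bar>C\<bar> * s n ^ k"
    using C by eventually_elim (use s_nonneg in \<open>smt (verit) mult_right_mono zero_le_power\<close>)
  thus ?thesis using that[of "\<bar>C\<bar>"] by auto
qed

lemma ubigoI:
  assumes "\<forall>\<^sub>F n in sequentially. \<forall>z. norm z = 1/2 \<longrightarrow> norm (F n z) \<le> C * s n ^ k"
  shows "ubigo k F"
  using assms unfolding ubigo_def by blast

lemma ubigo_dominated:
  assumes "ubigo k G" and "\<forall>\<^sub>F n in sequentially. \<forall>z. norm z = 1/2 \<longrightarrow> norm (F n z) \<le> c * norm (G n z)" and "c \<ge> 0"
  shows "ubigo k F"
proof -
  from assms(1) obtain C where "C \<ge> 0" and C: "\<forall>\<^sub>F n in sequentially. \<forall>z. norm z = 1/2 \<longrightarrow> norm (G n z) \<le> C * s n ^ k"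
    by (rule ubigoE) blast
  from C assms(2) show ?thesis
  proof (intro ubigoI[of _ "c * C"], eventually_elim)
    case (elim n)
    show ?case
    proof (intro allI impI)
      fix z :: complex assume z: "norm z = 1/2"
      have "norm (F n z) \<le> c * norm (G n z)" using elim z by blast
      also have "\<dots> \<le> c * (C * s n ^ k)" using elim z assms(3) by (intro mult_left_mono) auto
      finally show "norm (F n z) \<le> c * C * s n ^ k" by (simp add: mult.assoc)
    qed
  qed
qed

lemma ubigo_cong:
  assumes "ubigo k G" and "\<And>n z. norm z = 1/2 \<Longrightarrow> F n z = G n z"
  shows "ubigo k F"
  by (rule ubigo_dominated[OF assms(1), of _ 1]) (use assms(2) in auto)

lemma ubigo_add: "ubigo k F \<Longrightarrow> ubigo k G \<Longrightarrow> ubigo k (\<lambda>n z. F n z + G n z)"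
proof -
  assume "ubigo k F" "ubigo k G"
  then obtain C D where "\<forall>\<^sub>F n in sequentially. \<forall>z. norm z = 1/2 \<longrightarrow> norm (F n z) \<le> C * s n ^ k"
    "\<forall>\<^sub>F n in sequentially. \<forall>z. norm z = 1/2 \<longrightarrow> norm (G n z) \<le> D * s n ^ k"
    by (auto simp: ubigo_def)
  thus ?thesis
  proof (intro ubigoI[of _ "C + D"], eventually_elim)
    case (elim n)
    show ?case
    proof (intro allI impI)
      fix z :: complex assume z: "norm z = 1/2"
      have "norm (F n z + G n z) \<le> norm (F n z) + norm (G n z)" by (rule norm_triangle_ineq)
      also have "\<dots> \<le> (C + D) * s n ^ k" using elim z by (simp add: distrib_right add_mono)
      finally show "norm (F n z + G n z) \<le> (C + D) * s n ^ k" .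
    qed
  qed
qed

lemma ubigo_mult: "ubigo k F \<Longrightarrow> ubigo l G \<Longrightarrow> ubigo (k + l) (\<lambda>n z. F n z * G n z)"
proof -
  assume F: "ubigo k F" and G: "ubigo l G"
  from F obtain C where C: "C \<ge> 0" "\<forall>\<^sub>F n in sequentially. \<forall>z. norm z = 1/2 \<longrightarrow> norm (F n z) \<le> C * s n ^ k"
    by (rule ubigoE) blast
  from G obtain D where D: "D \<ge> 0" "\<forall>\<^sub>F n in sequentially. \<forall>z. norm z = 1/2 \<longrightarrow> norm (G n z) \<le> D * s n ^ l"
    by (rule ubigoE) blast
  from C(2) D(2) show ?thesis
  proof (intro ubigoI[of _ "C * D"], eventually_elim)
    case (elim n)
    show ?case
    proof (intro allI impI)
      fix z :: complex assume z: "norm z = 1/2"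
      have "norm (F n z * G n z) \<le> (C * s n ^ k) * (D * s n ^ l)"
        unfolding norm_mult using elim z C D by (intro mult_mono) (auto simp: s_nonneg)
      thus "norm (F n z * G n z) \<le> C * D * s n ^ (k + l)" by (simp add: power_add mult_ac)
    qed
  qed
qed

lemma ubigo_bounded:
  assumes "\<And>n z. norm z = 1/2 \<Longrightarrow> norm (F n z) \<le> C"
  shows "ubigo 0 F"
  using assms by (intro ubigoI[of _ C]) auto

lemma ubigo_zero: "ubigo k (\<lambda>n z. 0)"
  by (intro ubigoI[of _ 0]) auto

lemma ubigo_cmult: "ubigo k F \<Longrightarrow> ubigo k (\<lambda>n z. c * F n z)"
  using ubigo_mult[OF ubigo_bounded[of "\<lambda>n z. c" "norm c"]] by fastforce

lemma ubigo_uminus: "ubigo k F \<Longrightarrow> ubigo k (\<lambda>n z. - F n z)"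
  using ubigo_cmult[of k F "-1"] by simp

lemma ubigo_diff: "ubigo k F \<Longrightarrow> ubigo k G \<Longrightarrow> ubigo k (\<lambda>n z. F n z - G n z)"
  using ubigo_add[OF _ ubigo_uminus, of k F G] by simp

lemma ubigo_sum: "(\<And>i. i \<in> I \<Longrightarrow> ubigo k (F i)) \<Longrightarrow> ubigo k (\<lambda>n z. \<Sum>i\<in>I. F i n z)"
proof (induction I rule: infinite_finite_induct)
  case (insert x I)
  have "ubigo k (\<lambda>n z. F x n z + (\<Sum>i\<in>I. F i n z))"
    using insert by (intro ubigo_add) auto
  thus ?case using insert by simp
qed (simp_all add: ubigo_zero)

lemma ubigo_power: "ubigo k F \<Longrightarrow> ubigo (k * j) (\<lambda>n z. F n z ^ j)"
proof (induction j)
  case (Suc j)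
  show ?case using ubigo_mult[OF Suc.prems Suc.IH[OF Suc.prems]] by simp
qed (auto intro: ubigo_bounded[of _ 1])

lemma ubigo_weaken:
  assumes "ubigo l F" "k \<le> l"
  shows "ubigo k F"
proof -
  from assms(1) obtain C where C: "C \<ge> 0" "\<forall>\<^sub>F n in sequentially. \<forall>z. norm z = 1/2 \<longrightarrow> norm (F n z) \<le> C * s n ^ l"
    by (rule ubigoE) blast
  have le: "C * s n ^ l \<le> C * s n ^ k" for n
    using C(1) assms(2) s_nonneg s_le_1 by (intro mult_left_mono power_decreasing) auto
  from C(2) show ?thesis
    by (intro ubigoI[of _ C], eventually_elim) (use order_trans[OF _ le] in blast)
qed

lemma ubigo_Suc:
  assumes "ubigo k F"
  shows "ubigo k (\<lambda>n. F (Suc n))"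
proof -
  from assms obtain C where C: "C \<ge> 0" "\<forall>\<^sub>F n in sequentially. \<forall>z. norm z = 1/2 \<longrightarrow> norm (F n z) \<le> C * s n ^ k"
    by (rule ubigoE) blast
  have le: "C * s (Suc n) ^ k \<le> C * (4/3)^k * s n ^ k" for n
  proof -
    have "s (Suc n) ^ k \<le> (4/3 * s n) ^ k"
      using s_Suc_le[of n] s_nonneg by (intro power_mono) auto
    hence "C * s (Suc n) ^ k \<le> C * (4/3 * s n) ^ k" using C by (intro mult_left_mono)
    thus ?thesis unfolding power_mult_distrib by (simp add: mult.assoc)
  qed
  have "\<forall>\<^sub>F n in sequentially. \<forall>z. norm z = 1/2 \<longrightarrow> norm (F (Suc n) z) \<le> C * s (Suc n) ^ k"
    by (rule eventually_sequentially_Suc[THEN iffD2, OF C(2)])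
  thus ?thesis
    by (intro ubigoI[of _ "C * (4/3)^k"], eventually_elim) (use order_trans[OF _ le] in blast)
qed

lemma ubigo_small:
  assumes "ubigo k F" "k \<ge> 1" "s \<longlonglongrightarrow> 0" "\<epsilon> > 0"
  shows "\<forall>\<^sub>F n in sequentially. \<forall>z. norm z = 1/2 \<longrightarrow> norm (F n z) \<le> \<epsilon>"
proof -
  from assms(1,2) have "ubigo 1 F" by (rule ubigo_weaken)
  then obtain C where C: "C \<ge> 0" "\<forall>\<^sub>F n in sequentially. \<forall>z. norm z = 1/2 \<longrightarrow> norm (F n z) \<le> C * s n ^ 1"
    by (rule ubigoE) blast
  have "(\<lambda>n. C * s n) \<longlonglongrightarrow> C * 0" by (intro tendsto_intros assms)
  hence "\<forall>\<^sub>F n in sequentially. C * s n < \<epsilon>" using assms(4) by (intro order_tendstoD(2)) auto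
  with C(2) show ?thesis by eventually_elim force
qed

lemma half_circle_bounds:
  fixes z :: complex
  assumes "norm z = 1/2"
  shows "norm (1 / (1 - z)) \<le> 2" "norm (1 - 1 / (1 - z)) \<le> 2" "z * (1 / (1 - z)) = 1 / (1 - z) - 1" "z \<noteq> 1"
proof -
  have z1: "norm (1 - z) \<ge> 1/2" using norm_triangle_ineq2[of 1 z] assms by simp
  thus ne: "z \<noteq> 1" by auto
  have i: "1 / norm (1 - z) \<le> 2" using z1 by (simp add: divide_le_eq)
  thus "norm (1 / (1 - z)) \<le> 2" by (simp add: norm_divide)
  show eq: "z * (1 / (1 - z)) = 1 / (1 - z) - 1" using ne by (simp add: field_simps)
  have "1 - 1 / (1 - z) = - (z * (1 / (1 - z)))" unfolding eq by simp
  also have "norm \<dots> = 1/2 * (1 / norm (1 - z))" using assms by (simp only: norm_mult norm_divide norm_minus_cancel norm_one)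
  finally show "norm (1 - 1 / (1 - z)) \<le> 2" using i by simp
qed

lemma ubigo_poly:
  assumes "pclass 0 k 0 p"
  shows "ubigo k (\<lambda>n z. poly (p n) (1 / (1 - z)))"
proof -
  from assms obtain D where D: "\<And>n. degree (p n) \<le> D" by (auto simp: pclass_def)
  have "ubigo k (\<lambda>n z. \<Sum>i\<le>D. coeff (p n) i * (1 / (1 - z)) ^ i)"
  proof (intro ubigo_sum)
    fix i
    have "bigo k (\<lambda>n. coeff (p n) i)" using assms by (simp add: pclass_def smooth_0)
    hence "ubigo k (\<lambda>n z. coeff (p n) i)"
      unfolding bigo_def ubigo_def by (auto intro: always_eventually)
    moreover have "ubigo 0 (\<lambda>n z. (1 / (1 - z)) ^ i)"
      using half_circle_bounds(1) by (intro ubigo_bounded[of _ "2 ^ i"]) (auto simp only: norm_power intro!: power_mono norm_ge_zero)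
    ultimately have "ubigo (k + 0) (\<lambda>n z. coeff (p n) i * (1 / (1 - z)) ^ i)" by (rule ubigo_mult)
    thus "ubigo k (\<lambda>n z. coeff (p n) i * (1 / (1 - z)) ^ i)" by simp
  qed
  thus ?thesis by (rule ubigo_cong) (use D in \<open>simp add: poly_eq_sum_le\<close>)
qed

end

section \<open>The true iterates compared with the formal solution\<close>

locale schur_iterates = scale_sequence s for s +
  fixes m :: nat and a :: "nat \<Rightarrow> complex" and b :: "nat \<Rightarrow> complex \<Rightarrow> complex"
  assumes s_pos: "0 < s n" and m: "1 \<le> m"
    and s_summable: "summable (\<lambda>n. s n ^ (2*m+2))"
    and s_le_Suc: "3 * s n ^ (2*m+2) \<le> 4 * s (Suc n) ^ (2*m+2)"
    and a_less_1: "norm (a n) < 1" and a_smooth: "smooth 1 m a"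
    and b_le_1: "norm z \<le> 1 \<Longrightarrow> norm (b n z) \<le> 1"
    and b_rec: "norm z \<le> 1 \<Longrightarrow> b (Suc n) z * (1 - a n * z * b n z) = z * b n z - cnj (a n)"
begin

lemma s_tendsto_0: "s \<longlonglongrightarrow> 0"
proof -
  have "(\<lambda>n. root (2*m+2) (s n ^ (2*m+2))) \<longlonglongrightarrow> root (2*m+2) 0"
    by (intro tendsto_intros summable_LIMSEQ_zero s_summable)
  thus ?thesis using s_nonneg by (simp add: real_root_power_cancel del: power_Suc)
qed

definition "gam n = wkb a m n"
text \<open>One more iteration evaluates the right-hand side of the fixed-point form of the Riccati
  recursion, so this increment is exactly the residual r.\<close>

definition "rho n = wkb a (Suc m) n - wkb a m n"
definition "bet n = [:0, 1:] * gam n"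
definition "wgt n = bet n * prefl (bet n)"
text \<open>With the full geometric series in place of the finite sum, \<open>1 - xi\<close> would
  be the bracket of the determinant identity divided by 1 - w'. Cutting the series keeps a
  polynomial in u, and the error is of summable order.\<close>

definition "xi n = smult (a n) ([:-1, 1:] * gam n) + rho n * prefl (bet (Suc n)) * (\<Sum>i\<le>m. wgt (Suc n) ^ i)"
text \<open>Taylor polynomial of log (1 - xi). Degree m suffices: \<open>xi\<close> has homogeneity
  2, so the first omitted power has homogeneity 2m + 2.\<close>

definition "logp n = - (\<Sum>j=1..m. smult (1 / of_nat j) (xi n ^ j))"

lemma gam_class: "pclass 1 1 0 gam" "pclass 0 1 0 gam"
proof -
  have "pclass 1 1 1 gam" using wkb_class[OF a_smooth, of m] unfolding gam_def by simp
  thus "pclass 1 1 0 gam" by (rule pclass_weaken) auto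
  thus "pclass 0 1 0 gam" by (rule pclass_1_imp_0)
qed

lemma rho_class: "pclass 1 1 0 rho" "pclass 0 (m + 1) 0 rho"
proof -
  have "pclass 1 1 0 (wkb a m)" using gam_class(1) unfolding gam_def .
  moreover have "pclass 1 1 0 (wkb a (Suc m))" using wkb_class[OF a_smooth, of "Suc m"] by simp
  ultimately show "pclass 1 1 0 rho" unfolding rho_def by (intro pclass_diff)
  show "pclass 0 (m + 1) 0 rho" using wkb_increment_class[OF a_smooth, of m] unfolding rho_def by simp
qed

lemma bet_class: "pclass 1 0 0 bet" "pclass 0 1 0 bet"
proof -
  show "pclass 1 0 0 bet" using pclass_pCons[of 1 0 0 gam] gam_class(1) unfolding bet_def by simp
  show "pclass 0 1 0 bet" using pclass_pCons[of 0 1 0 gam] gam_class(2) unfolding bet_def by simp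
qed

lemma wgt_class: "pclass 1 0 0 wgt" "pclass 0 2 0 wgt"
  using pclass_mult[OF bet_class(1) pclass_prefl[OF bet_class(1)]]
    pclass_mult[OF bet_class(2) pclass_prefl[OF bet_class(2)]]
  unfolding wgt_def by (simp_all add: numeral_2_eq_2)

text \<open>The two gradings have different uses: e = 0 measures the size on |z| = 1/2, while e = 1
  makes the coefficients of high powers of u small.\<close>

lemma xi_class: "pclass 1 1 0 xi" "pclass 0 2 0 xi"
proof -
  have a: "smooth 1 0 a" using a_smooth by (rule smooth_weaken) auto
  have "pclass 1 1 0 (\<lambda>n. [:-1, 1:] * smult (a n) (gam n))"
    using pclass_smult[OF a gam_class(1)] by (intro pclass_X_minus_1) simp
  hence 1: "pclass 1 1 0 (\<lambda>n. smult (a n) ([:-1, 1:] * gam n))"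
    by (simp only: mult_smult_right)
  have "pclass 0 2 0 (\<lambda>n. [:-1, 1:] * smult (a n) (gam n))"
    using pclass_smult[OF a gam_class(2)] by (intro pclass_X_minus_1) (simp add: numeral_2_eq_2)
  hence 2: "pclass 0 2 0 (\<lambda>n. smult (a n) ([:-1, 1:] * gam n))"
    by (simp only: mult_smult_right)
  have w1: "pclass 1 0 0 (\<lambda>n. \<Sum>i\<le>m. wgt (Suc n) ^ i)"
    using pclass_power[OF pclass_shift[OF wgt_class(1)]] by (intro pclass_sum) simp
  have w2: "pclass 0 0 0 (\<lambda>n. \<Sum>i\<le>m. wgt (Suc n) ^ i)"
    by (rule pclass_1_imp_0[OF w1])
  have "pclass 1 (1 + 0 + 0) 0 (\<lambda>n. rho n * prefl (bet (Suc n)) * (\<Sum>i\<le>m. wgt (Suc n) ^ i))"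
    by (intro pclass_mult w1 rho_class(1) pclass_prefl pclass_shift bet_class(1))
  with 1 show "pclass 1 1 0 xi" unfolding xi_def by (intro pclass_add) auto
  have "pclass 0 (m + 1 + 1 + 0) 0 (\<lambda>n. rho n * prefl (bet (Suc n)) * (\<Sum>i\<le>m. wgt (Suc n) ^ i))"
    by (intro pclass_mult w2 rho_class(2) pclass_prefl pclass_shift bet_class(2))
  hence "pclass 0 2 0 (\<lambda>n. rho n * prefl (bet (Suc n)) * (\<Sum>i\<le>m. wgt (Suc n) ^ i))"
    by (rule pclass_weaken) auto
  with 2 show "pclass 0 2 0 xi" unfolding xi_def by (intro pclass_add)
qed

lemma logp_class: "pclass 1 1 0 logp"
  unfolding logp_def
proof (intro pclass_uminus pclass_sum pclass_cmult)
  fix j assume "j \<in> {1..m}"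
  thus "pclass 1 1 0 (\<lambda>n. xi n ^ j)"
    using pclass_weaken[OF pclass_power[OF xi_class(1), of j], of 1 0] by simp
qed


definition u :: "complex \<Rightarrow> complex" where "u z = 1 / (1 - z)"

definition "G n z = poly (gam n) (u z)"
definition "Gs n z = poly (prefl (gam n)) (u z)"
definition "R n z = poly (rho n) (u z)"
definition "Rs n z = poly (prefl (rho n)) (u z)"
definition "W n z = u z * (1 - u z) * G n z * Gs n z"
definition "Q n z = (1 - a n * (u z - 1) * G n z) * (1 - W (Suc n) z) - R n z * (1 - u z) * Gs (Suc n) z"
definition "Qs n z = (1 + cnj (a n) * u z * Gs n z) * (1 - W (Suc n) z) - Rs n z * u z * G (Suc n) z"
definition "Xi n z = poly (xi n) (u z)"
definition "Xis n z = poly (prefl (xi n)) (u z)"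

lemma poly_bet: "poly (bet n) (u z) = u z * G n z" "poly (prefl (bet n)) (u z) = (1 - u z) * Gs n z"
  by (simp_all add: bet_def G_def Gs_def poly_prefl)

lemma poly_wgt: "poly (wgt n) (u z) = W n z" "cnj (poly (wgt n) (1 - cnj (u z))) = W n z"
proof -
  show "poly (wgt n) (u z) = W n z" unfolding wgt_def poly_mult poly_bet by (simp add: W_def)
  have "cnj (poly (wgt n) (1 - cnj (u z))) = poly (prefl (bet n)) (u z) * cnj (poly (prefl (bet n)) (1 - cnj (u z)))"
    by (simp add: wgt_def poly_prefl)
  also have "cnj (poly (prefl (bet n)) (1 - cnj (u z))) = poly (bet n) (u z)"
    by (simp add: poly_prefl)
  finally show "cnj (poly (wgt n) (1 - cnj (u z))) = W n z"
    unfolding poly_bet by (simp add: W_def)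
qed

lemma R_eq: "R n z = a n * u z * (u z - 1) * G n z * G (Suc n) z - cnj (a n) - u z * (G (Suc n) z - G n z) - G n z"
  unfolding R_def rho_def wkb.simps(2) by (simp add: G_def gam_def fdiff_def algebra_simps)

lemma Rs_eq: "Rs n z = cnj (a n) * u z * (u z - 1) * Gs n z * Gs (Suc n) z - a n - (1 - u z) * (Gs (Suc n) z - Gs n z) - Gs n z"
  unfolding Rs_def rho_def wkb.simps(2) by (simp add: poly_prefl Gs_def gam_def fdiff_def algebra_simps)

lemma Xi_eq: "Xi n z = a n * (u z - 1) * G n z + R n z * (1 - u z) * Gs (Suc n) z * (\<Sum>i\<le>m. W (Suc n) z ^ i)"
  unfolding Xi_def xi_def poly_add poly_mult poly_smult poly_sum poly_power poly_wgt poly_bet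
  by (simp add: G_def R_def)

lemma Xis_eq: "Xis n z = - (cnj (a n) * u z * Gs n z) + Rs n z * u z * G (Suc n) z * (\<Sum>i\<le>m. W (Suc n) z ^ i)"
proof -
  define v where "v = 1 - cnj (u z)"
  have v: "cnj v = 1 - u z" by (simp add: v_def)
  have star: "cnj (poly p v) = poly (prefl p) (u z)" for p by (simp add: poly_prefl v_def)
  define S where "S = (\<Sum>i\<le>m. wgt (Suc n) ^ i)"
  have "cnj (poly (prefl (bet (Suc n))) v) = u z * G (Suc n) z"
    unfolding poly_bet(1)[symmetric] by (simp add: poly_prefl v_def)
  moreover have "cnj (poly S v) = (\<Sum>i\<le>m. W (Suc n) z ^ i)"
    unfolding S_def poly_sum poly_power cnj_sum complex_cnj_power v_def poly_wgt ..
  moreover have "cnj (poly (rho n) v) = Rs n z" "cnj (poly (gam n) v) = Gs n z"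
    unfolding Rs_def Gs_def by (rule star)+
  moreover have "Xis n z = cnj (poly (xi n) v)" unfolding Xis_def by (rule star[symmetric])
  moreover have "poly (xi n) v = a n * ((v - 1) * poly (gam n) v)
      + poly (rho n) v * poly (prefl (bet (Suc n))) v * poly S v"
    unfolding xi_def S_def[symmetric] by (simp add: algebra_simps)
  ultimately show ?thesis by (simp add: v)
qed

lemma truncated_quotient_identity:
  fixes w A B :: complex
  shows "(1 - (A + B * (\<Sum>i\<le>m. w ^ i))) * (1 - w) = (1 - A) * (1 - w) - B + B * w ^ Suc m"
proof -
  have "(1 - w) * (\<Sum>i\<le>m. w ^ i) = 1 - w ^ Suc m" by (rule sum_gp_basic)
  hence "B * ((1 - w) * (\<Sum>i\<le>m. w ^ i)) = B * (1 - w ^ Suc m)" by simp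
  thus ?thesis by (simp add: algebra_simps)
qed

lemma one_minus_Xi: "(1 - Xi n z) * (1 - W (Suc n) z) = Q n z + R n z * (1 - u z) * Gs (Suc n) z * W (Suc n) z ^ Suc m"
  unfolding Xi_eq truncated_quotient_identity Q_def by simp

lemma one_minus_Xis: "(1 - Xis n z) * (1 - W (Suc n) z) = Qs n z + Rs n z * u z * G (Suc n) z * W (Suc n) z ^ Suc m"
  unfolding Xis_eq truncated_quotient_identity Qs_def by simp

lemma ubigo_u: "ubigo 0 (\<lambda>n. u)" "ubigo 0 (\<lambda>n z. 1 - u z)" "ubigo 0 (\<lambda>n z. u z - 1)" "ubigo 0 (\<lambda>n z. z)"
  using half_circle_bounds(1,2) unfolding u_def
  by (auto intro!: ubigo_bounded[of _ 2] simp: norm_minus_commute[of _ 1] simp del: norm_divide)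

lemma ubigo_G: "ubigo 1 G" "ubigo 1 Gs" "ubigo (m + 1) R" "ubigo (m + 1) Rs"
  unfolding G_def[abs_def] Gs_def[abs_def] R_def[abs_def] Rs_def[abs_def] u_def
  by (intro ubigo_poly pclass_prefl gam_class rho_class)+

lemma ubigo_a: "ubigo 1 (\<lambda>n z. a n)" "ubigo 1 (\<lambda>n z. cnj (a n))"
  using smooth_imp_bigo[OF a_smooth] unfolding bigo_def ubigo_def by (auto intro: always_eventually)

lemma ubigo_W: "ubigo 2 W"
proof -
  have "ubigo (0 + 0 + 1 + 1) (\<lambda>n z. u z * (1 - u z) * G n z * Gs n z)"
    by (intro ubigo_mult ubigo_u ubigo_G)
  thus ?thesis unfolding W_def[abs_def] by (simp add: numeral_2_eq_2)
qed

lemma ubigo_b: "ubigo 0 b"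
  using b_le_1 by (intro ubigo_bounded[of _ 1]) simp

lemma ubigo_Xi: "ubigo 2 Xi" "ubigo 2 Xis"
  unfolding Xi_def[abs_def] Xis_def[abs_def] u_def by (intro ubigo_poly pclass_prefl xi_class)+

lemma ubigo_Xi_defect: "ubigo (2*m+2) (\<lambda>n z. R n z * (1 - u z) * Gs (Suc n) z * W (Suc n) z ^ Suc m)"
  "ubigo (2*m+2) (\<lambda>n z. Rs n z * u z * G (Suc n) z * W (Suc n) z ^ Suc m)"
proof -
  have W: "ubigo (2 * Suc m) (\<lambda>n z. W (Suc n) z ^ Suc m)"
    by (intro ubigo_power ubigo_Suc[of _ W] ubigo_W)
  have "ubigo (m + 1 + 0 + 1 + 2 * Suc m) (\<lambda>n z. R n z * (1 - u z) * Gs (Suc n) z * W (Suc n) z ^ Suc m)"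
    by (intro ubigo_mult W ubigo_u ubigo_G ubigo_Suc[of _ Gs])
  thus "ubigo (2*m+2) (\<lambda>n z. R n z * (1 - u z) * Gs (Suc n) z * W (Suc n) z ^ Suc m)"
    by (rule ubigo_weaken) simp
  have "ubigo (m + 1 + 0 + 1 + 2 * Suc m) (\<lambda>n z. Rs n z * u z * G (Suc n) z * W (Suc n) z ^ Suc m)"
    by (intro ubigo_mult W ubigo_u ubigo_G ubigo_Suc[of _ G])
  thus "ubigo (2*m+2) (\<lambda>n z. Rs n z * u z * G (Suc n) z * W (Suc n) z ^ Suc m)"
    by (rule ubigo_weaken) simp
qed

end

context scale_sequence
begin

lemma ubigo_one_minus: "ubigo 0 F \<Longrightarrow> ubigo 0 (\<lambda>n z. 1 - F n z)"
  using ubigo_diff[OF ubigo_bounded[of "\<lambda>n z. 1" 1]] by simp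

text \<open>One constant works for every large starting index n0, so that several such sums can be
  started at a common index.\<close>

lemma ubigo_telescoping_sum:
  assumes F: "ubigo k (\<lambda>n z. F n z - (T n z - T (Suc n) z))" and k: "summable (\<lambda>n. s n ^ k)"
    and T: "\<forall>\<^sub>F n in sequentially. \<forall>z. norm z = 1/2 \<longrightarrow> norm (T n z) \<le> B"
  shows "\<exists>C. \<forall>\<^sub>F n0 in sequentially. \<forall>N z. norm z = 1/2 \<longrightarrow> norm (\<Sum>n=n0..<N. F n z) \<le> C"
proof -
  define E where "E n z = F n z - (T n z - T (Suc n) z)" for n z
  from F obtain K where K: "K \<ge> 0" "\<forall>\<^sub>F n in sequentially. \<forall>z. norm z = 1/2 \<longrightarrow> norm (E n z) \<le> K * s n ^ k"
    unfolding E_def by (rule ubigoE) blast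
  obtain M where M: "\<And>n z. n \<ge> M \<Longrightarrow> norm z = 1/2 \<Longrightarrow> norm (E n z) \<le> K * s n ^ k"
      "\<And>n z. n \<ge> M \<Longrightarrow> norm z = 1/2 \<Longrightarrow> norm (T n z) \<le> B"
    using eventually_conj[OF K(2) T] unfolding eventually_sequentially by blast
  define S where "S = (\<Sum>n. s n ^ k)"
  have "norm (\<Sum>n=n0..<N. F n z) \<le> K * S + (\<bar>B\<bar> + \<bar>B\<bar>)" if n0: "n0 \<ge> M" and z: "norm z = 1/2" for n0 N z
  proof (cases "n0 \<le> N")
    case True
    have "(\<Sum>n=n0..<N. F n z) = (\<Sum>n=n0..<N. E n z) - (\<Sum>n=n0..<N. T (Suc n) z - T n z)"
      by (simp add: E_def sum_subtractf sum.distrib)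
    also have "(\<Sum>n=n0..<N. T (Suc n) z - T n z) = T N z - T n0 z"
      using True by (rule sum_Suc_diff')
    finally have "norm (\<Sum>n=n0..<N. F n z) \<le> norm (\<Sum>n=n0..<N. E n z) + (norm (T N z) + norm (T n0 z))"
      by (smt (verit) norm_triangle_ineq4)
    moreover have "norm (\<Sum>n=n0..<N. E n z) \<le> K * S"
    proof -
      have "norm (\<Sum>n=n0..<N. E n z) \<le> (\<Sum>n=n0..<N. K * s n ^ k)"
        using M(1) n0 z by (intro sum_norm_le) auto
      also have "\<dots> = K * (\<Sum>n=n0..<N. s n ^ k)" by (simp add: sum_distrib_left)
      also have "\<dots> \<le> K * S" unfolding S_def using K(1) k s_nonneg
        by (intro mult_left_mono sum_le_suminf) auto
      finally show ?thesis .
    qed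
    moreover have "norm (T N z) \<le> \<bar>B\<bar>" "norm (T n0 z) \<le> \<bar>B\<bar>"
      using M(2)[of N z] M(2)[of n0 z] True n0 z by auto
    ultimately show ?thesis by linarith
  next
    case False
    have "S \<ge> 0" unfolding S_def using k s_nonneg by (intro suminf_nonneg) auto
    thus ?thesis using False K by simp
  qed
  thus ?thesis unfolding eventually_sequentially by blast
qed

end

context schur_iterates
begin

text \<open>Square root of the slow variation of \<open>s\<close>, because 36/49 <= 3/4. What
  matters is 6/7 > 3/4: the power \<open>s^(m+1)\<close> decays more slowly than the contraction in
  \<open>ubigo_Del\<close>.\<close>

lemma s_power_le: "6 * s n ^ (m+1) \<le> 7 * s (Suc n) ^ (m+1)"
proof (rule power2_le_imp_le)
  have sq: "(s n ^ (m+1))^2 = s n ^ (2*m+2)" for n by (simp add: power_mult[symmetric] algebra_simps flip: power_Suc)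
  have "(6 * s n ^ (m+1))^2 = 36 * s n ^ (2*m+2)" unfolding power_mult_distrib sq by simp
  also have "\<dots> \<le> 49 * s (Suc n) ^ (2*m+2)" using s_le_Suc[of n] zero_le_power[OF s_nonneg[of "Suc n"], of "2*m+2"] by linarith
  also have "\<dots> = (7 * s (Suc n) ^ (m+1))^2" unfolding power_mult_distrib sq by simp
  finally show "(6 * s n ^ (m+1))^2 \<le> (7 * s (Suc n) ^ (m+1))^2" .
qed (use s_nonneg in auto)

definition "A n z = a n * z * b n z"
definition "Del n z = b n z - u z * G n z"

lemma ubigo_A: "ubigo 1 A" "ubigo 1 (\<lambda>n z. a n * (u z - 1) * G n z)"
proof -
  have "ubigo (1 + 0 + 0) (\<lambda>n z. a n * z * b n z)"
    by (intro ubigo_mult ubigo_u ubigo_a ubigo_b)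
  thus "ubigo 1 A" by (simp add: A_def[abs_def])
  have "ubigo (1 + 0 + 1) (\<lambda>n z. a n * (u z - 1) * G n z)"
    by (intro ubigo_mult ubigo_u ubigo_a ubigo_G)
  thus "ubigo 1 (\<lambda>n z. a n * (u z - 1) * G n z)" by (rule ubigo_weaken) simp
qed

lemma ubigo_eventually_small: "ubigo k F \<Longrightarrow> k \<ge> 1 \<Longrightarrow> \<epsilon> > 0 \<Longrightarrow> \<forall>\<^sub>F n in sequentially. \<forall>z. norm z = 1/2 \<longrightarrow> norm (F n z) \<le> \<epsilon>"
  using ubigo_small[OF _ _ s_tendsto_0] .

text \<open>Once the two factors in \<open>wkb_difference_identity\<close> are within 1/10 of 1, it
  gives |Del'| <= 3/4 |Del| + 2 |R| on |z| = 1/2. The trivial bound |b| <= 1 starts the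
  induction.\<close>

lemma ubigo_Del: "ubigo (m+1) Del"
proof -
  obtain C where C: "C \<ge> 0" "\<forall>\<^sub>F n in sequentially. \<forall>z. norm z = 1/2 \<longrightarrow> norm (R n z) \<le> C * s n ^ (m+1)"
    using ubigo_G(3) by (rule ubigoE) blast
  have uG: "ubigo 1 (\<lambda>n z. u z * G n z)" using ubigo_mult[OF ubigo_u(1) ubigo_G(1)] by simp
  obtain n0 where n0: "\<And>n z. n \<ge> n0 \<Longrightarrow> norm z = 1/2 \<Longrightarrow> norm (R n z) \<le> C * s n ^ (m+1)"
      "\<And>n z. n \<ge> n0 \<Longrightarrow> norm z = 1/2 \<Longrightarrow> norm (A n z) \<le> 1/10"
      "\<And>n z. n \<ge> n0 \<Longrightarrow> norm z = 1/2 \<Longrightarrow> norm (a n * (u z - 1) * G n z) \<le> 1/10"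
      "\<And>n z. n \<ge> n0 \<Longrightarrow> norm z = 1/2 \<Longrightarrow> norm (u z * G n z) \<le> 1"
  proof -
    have "\<forall>\<^sub>F n in sequentially. \<forall>z. norm z = 1/2 \<longrightarrow> norm (A n z) \<le> 1/10"
      by (rule ubigo_eventually_small[OF ubigo_A(1)]) auto
    moreover have "\<forall>\<^sub>F n in sequentially. \<forall>z. norm z = 1/2 \<longrightarrow> norm (a n * (u z - 1) * G n z) \<le> 1/10"
      by (rule ubigo_eventually_small[OF ubigo_A(2)]) auto
    moreover have "\<forall>\<^sub>F n in sequentially. \<forall>z. norm z = 1/2 \<longrightarrow> norm (u z * G n z) \<le> 1"
      by (rule ubigo_eventually_small[OF uG]) auto
    moreover note C(2)
    ultimately have "\<forall>\<^sub>F n in sequentially. \<forall>z. norm z = 1/2 \<longrightarrow> norm (R n z) \<le> C * s n ^ (m+1)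
        \<and> norm (A n z) \<le> 1/10 \<and> norm (a n * (u z - 1) * G n z) \<le> 1/10 \<and> norm (u z * G n z) \<le> 1"
      by eventually_elim blast
    thus ?thesis using that unfolding eventually_sequentially by blast
  qed
  \<comment> \<open>The first entry covers the start, where \<open>Del\<close> is only known to be
    at most 2. The second gives 3/4 K + 2 C <= 6/7 K, which closes the induction step.\<close>
  define K where "K = max (2 / s n0 ^ (m+1)) (20 * C)"
  have K: "K \<ge> 20 * C" "2 \<le> K * s n0 ^ (m+1)" "K \<ge> 0"
  proof -
    show "K \<ge> 20 * C" by (simp add: K_def)
    have "2 / s n0 ^ (m+1) \<le> K" by (simp add: K_def)
    thus "2 \<le> K * s n0 ^ (m+1)" using zero_less_power[OF s_pos[of n0], of "m+1"] by (simp add: divide_le_eq)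
    show "K \<ge> 0" using C(1) \<open>K \<ge> 20 * C\<close> by linarith
  qed
  have "norm (Del n z) \<le> K * s n ^ (m+1)" if "n \<ge> n0" and z: "norm z = 1/2" for n z
    using that(1)
  proof (induction n rule: dec_induct)
    case base
    have "norm (Del n0 z) \<le> norm (b n0 z) + norm (u z * G n0 z)" unfolding Del_def by (rule norm_triangle_ineq4)
    also have "\<dots> \<le> 1 + 1" using b_le_1[of z n0] n0(4)[of n0 z] z by simp
    finally show ?case using K by simp
  next
    case (step n)
    define B where "B = a n * (u z - 1) * G n z"
    have zu: "z * u z = u z - 1" unfolding u_def using half_circle_bounds(3)[OF z] .
    have eq: "Del (Suc n) z * (1 - A n z) * (1 - B) = z * (1 - a n * cnj (a n)) * Del n z + R n z * (1 - A n z)"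
      unfolding Del_def A_def B_def
      by (rule wkb_difference_identity[OF R_eq zu]) (use b_rec[of z n] z in simp)
    have An: "norm (A n z) \<le> 1/10" and Bn: "norm B \<le> 1/10"
      using n0(2)[of n z] n0(3)[of n z] step z by (auto simp: B_def)
    have ge: "norm (1 - x) \<ge> 9/10" and le: "norm (1 - x) \<le> 11/10" if "norm x \<le> 1/10" for x :: complex
      using that norm_triangle_ineq2[of 1 x] norm_triangle_ineq4[of 1 x] by auto
    have a2: "norm (1 - a n * cnj (a n)) \<le> 1"
    proof -
      have "1 - a n * cnj (a n) = of_real (1 - (norm (a n))\<^sup>2)" by (simp only: complex_norm_square of_real_diff of_real_1)
      moreover have "(norm (a n))\<^sup>2 \<le> 1" using a_less_1[of n] by (simp add: power_le_one less_imp_le)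
      ultimately show ?thesis by (simp only: norm_of_real) simp
    qed
    define x where "x = norm (Del (Suc n) z)"
    have "x * (9/10) * (9/10) \<le> x * norm (1 - A n z) * norm (1 - B)"
      using ge[OF An] ge[OF Bn] by (intro mult_mono) (auto simp: x_def)
    also have "\<dots> = norm (z * (1 - a n * cnj (a n)) * Del n z + R n z * (1 - A n z))"
      unfolding eq[symmetric] by (simp add: norm_mult x_def)
    also have "\<dots> \<le> norm z * norm (1 - a n * cnj (a n)) * norm (Del n z) + norm (R n z) * norm (1 - A n z)"
      by (intro order_trans[OF norm_triangle_ineq]) (simp add: norm_mult)
    also have "\<dots> \<le> 1/2 * 1 * norm (Del n z) + norm (R n z) * (11/10)"
      unfolding z using le[OF An] a2 by (intro add_mono mult_mono) auto
    finally have "x \<le> 3/4 * norm (Del n z) + 2 * norm (R n z)"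
      using norm_ge_zero[of "Del n z"] norm_ge_zero[of "R n z"] unfolding x_def by linarith
    also have "\<dots> \<le> 3/4 * (K * s n ^ (m+1)) + 2 * (C * s n ^ (m+1))"
      using step.IH n0(1)[of n z] step z by (intro add_mono mult_left_mono) auto
    also have "\<dots> = (3/4 * K + 2 * C) * s n ^ (m+1)" by (simp only: algebra_simps)
    also have "\<dots> \<le> (6/7 * K) * s n ^ (m+1)"
      using K C(1) s_nonneg by (intro mult_right_mono) auto
    also have "\<dots> = K * (1/7 * (6 * s n ^ (m+1)))" by simp
    also have "\<dots> \<le> K * (1/7 * (7 * s (Suc n) ^ (m+1)))"
      using s_power_le[of n] K by (intro mult_left_mono) auto
    finally show ?case by (simp add: x_def)
  qed
  thus ?thesis by (intro ubigoI[of _ K]) (auto simp: eventually_sequentially)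
qed

definition "V n z = (1 - u z) * Gs n z * b n z"
text \<open>The telescoping term of the transfer identity, where V stands for the product of b with
  the reflected \<beta>.\<close>

definition "T n z = Ln (1 - V n z) - Ln (1 - W n z)"

lemma ubigo_V: "ubigo 1 V"
  unfolding V_def[abs_def] using ubigo_mult[OF ubigo_mult[OF ubigo_u(2) ubigo_G(2)] ubigo_b] by simp

text \<open>Apart from the cut-off of the geometric series, the difference of the two products is z
  times a reflected residual times \<open>Del\<close>, each of size \<open>s^(m+1)\<close>.
  \<open>Ln_prod3_diff_bound\<close> carries the estimate over to logarithms.\<close>

lemma log_transfer: "ubigo (2*m+2) (\<lambda>n z. Ln (1 - A n z) - Ln (1 - Xi n z) - (T n z - T (Suc n) z))"
proof -
  define D where "D n z = (1 - A n z) * (1 - V (Suc n) z) * (1 - W n z) - (1 - Xi n z) * (1 - W (Suc n) z) * (1 - V n z)" for n z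
  have D_eq: "D n z = z * Rs n z * Del n z - (R n z * (1 - u z) * Gs (Suc n) z * W (Suc n) z ^ Suc m) * (1 - V n z)"
    if z: "norm z = 1/2" for n z
  proof -
    have zu: "z * u z = u z - 1" unfolding u_def using half_circle_bounds(3)[OF z] .
    have rec: "b (Suc n) z * (1 - a n * z * b n z) = z * b n z - cnj (a n)" using b_rec[of z n] z by simp
    have "(1 - A n z) * (1 - V (Suc n) z) * (1 - W n z) = Q n z * (1 - V n z) + z * Rs n z * Del n z"
      unfolding A_def V_def Del_def Q_def W_def
      by (rule wkb_transfer_identity[OF R_eq Rs_eq zu rec])
    thus ?thesis unfolding D_def one_minus_Xi by (simp add: algebra_simps)
  qed
  have "ubigo (0 + (m + 1) + (m + 1)) (\<lambda>n z. z * Rs n z * Del n z)"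
    by (intro ubigo_mult ubigo_u ubigo_G ubigo_Del)
  hence 1: "ubigo (2*m+2) (\<lambda>n z. z * Rs n z * Del n z)" by (rule ubigo_weaken) simp
  have V0: "ubigo 0 V" using ubigo_V by (rule ubigo_weaken) simp
  have "ubigo (2*m+2 + 0) (\<lambda>n z. (R n z * (1 - u z) * Gs (Suc n) z * W (Suc n) z ^ Suc m) * (1 - V n z))"
    by (intro ubigo_mult[OF ubigo_Xi_defect(1)] ubigo_one_minus V0)
  hence "ubigo (2*m+2) (\<lambda>n z. z * Rs n z * Del n z - (R n z * (1 - u z) * Gs (Suc n) z * W (Suc n) z ^ Suc m) * (1 - V n z))"
    unfolding add_0_right by (intro ubigo_diff 1)
  hence "ubigo (2*m+2) D" by (rule ubigo_cong) (rule D_eq)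
  thus ?thesis
  proof (rule ubigo_dominated)
    note sm = ubigo_eventually_small[of _ _ "1/24"]
    have "\<forall>\<^sub>F n in sequentially. \<forall>z. norm z = 1/2 \<longrightarrow> norm (A n z) \<le> 1/24" by (rule sm[OF ubigo_A(1)]) auto
    moreover have "\<forall>\<^sub>F n in sequentially. \<forall>z. norm z = 1/2 \<longrightarrow> norm (V n z) \<le> 1/24" by (rule sm[OF ubigo_V]) auto
    moreover have "\<forall>\<^sub>F n in sequentially. \<forall>z. norm z = 1/2 \<longrightarrow> norm (V (Suc n) z) \<le> 1/24"
      by (rule sm[OF ubigo_Suc[OF ubigo_V]]) auto
    moreover have "\<forall>\<^sub>F n in sequentially. \<forall>z. norm z = 1/2 \<longrightarrow> norm (W n z) \<le> 1/24" by (rule sm[OF ubigo_W]) auto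
    moreover have "\<forall>\<^sub>F n in sequentially. \<forall>z. norm z = 1/2 \<longrightarrow> norm (W (Suc n) z) \<le> 1/24"
      by (rule sm[OF ubigo_Suc[OF ubigo_W]]) auto
    moreover have "\<forall>\<^sub>F n in sequentially. \<forall>z. norm z = 1/2 \<longrightarrow> norm (Xi n z) \<le> 1/24" by (rule sm[OF ubigo_Xi(1)]) auto
    ultimately show "\<forall>\<^sub>F n in sequentially. \<forall>z. norm z = 1/2 \<longrightarrow>
      norm (Ln (1 - A n z) - Ln (1 - Xi n z) - (T n z - T (Suc n) z)) \<le> 16 * norm (D n z)"
    proof eventually_elim
      case (elim n)
      show ?case
      proof (intro allI impI)
        fix z :: complex assume z: "norm z = 1/2"
        have "norm ((Ln (1 - A n z) + Ln (1 - V (Suc n) z) + Ln (1 - W n z))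
          - (Ln (1 - Xi n z) + Ln (1 - W (Suc n) z) + Ln (1 - V n z))) \<le> 16 * norm (D n z)"
          unfolding D_def by (rule Ln_prod3_diff_bound) (use elim z in simp_all)
        thus "norm (Ln (1 - A n z) - Ln (1 - Xi n z) - (T n z - T (Suc n) z)) \<le> 16 * norm (D n z)"
          by (simp add: T_def algebra_simps)
      qed
    qed
  qed auto
qed

text \<open>The determinant identity at work: the bracket times its reflection is (1 - |a|^2) (1 -
  w) (1 - w') up to a product of two residuals. Dividing by (1 - w')^2 leaves the quotient (1 - w) /
  (1 - w'), whose logarithm telescopes.\<close>

lemma log_symmetric: "ubigo (2*m+2) (\<lambda>n z. Ln (1 - Xi n z) + Ln (1 - Xis n z) - of_real (ln (1 - (norm (a n))\<^sup>2))
    - (Ln (1 - W n z) - Ln (1 - W (Suc n) z)))"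
proof -
  define D where "D n z = (1 - Xi n z) * (1 - Xis n z) * (1 - W (Suc n) z) - (1 - a n * cnj (a n)) * (1 - W n z) * 1" for n z
  define e1 where "e1 n z = R n z * (1 - u z) * Gs (Suc n) z * W (Suc n) z ^ Suc m" for n z
  define e2 where "e2 n z = Rs n z * u z * G (Suc n) z * W (Suc n) z ^ Suc m" for n z
  have e: "ubigo (2*m+2) e1" "ubigo (2*m+2) e2"
    using ubigo_Xi_defect by (simp_all only: e1_def[abs_def] e2_def[abs_def])
  \<comment> \<open>\<open>Xi\<close> and \<open>Xis\<close> each hide a denominator 1 - W (Suc n)
    z, but \<open>D\<close> contains that factor only once; the second copy is supplied here. It is
    at least 1/2 in modulus, so removing it costs a factor 2.\<close>
  have D_eq: "D n z * (1 - W (Suc n) z) = R n z * Rs n z + e1 n z * ((1 - Xis n z) * (1 - W (Suc n) z))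
     + (((1 - Xi n z) * (1 - W (Suc n) z)) - e1 n z) * e2 n z" for n z
  proof -
    have "Q n z * Qs n z = R n z * Rs n z + (1 - a n * cnj (a n)) * (1 - W n z) * (1 - W (Suc n) z)"
      unfolding Q_def Qs_def W_def by (rule wkb_determinant_identity[OF R_eq Rs_eq])
    moreover have "(1 - Xi n z) * (1 - W (Suc n) z) = Q n z + e1 n z" "(1 - Xis n z) * (1 - W (Suc n) z) = Qs n z + e2 n z"
      unfolding e1_def e2_def by (rule one_minus_Xi one_minus_Xis)+
    ultimately show ?thesis unfolding D_def by algebra
  qed
  have W1: "ubigo 0 (\<lambda>n z. 1 - W (Suc n) z)"
    by (intro ubigo_one_minus ubigo_weaken[OF ubigo_Suc[OF ubigo_W]]) simp
  have X1: "ubigo 0 (\<lambda>n z. 1 - Xi n z)" "ubigo 0 (\<lambda>n z. 1 - Xis n z)"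
    by (intro ubigo_one_minus ubigo_weaken[OF ubigo_Xi(1)] ubigo_weaken[OF ubigo_Xi(2)]; simp)+
  have "ubigo (m + 1 + (m + 1)) (\<lambda>n z. R n z * Rs n z)" by (intro ubigo_mult ubigo_G)
  hence 1: "ubigo (2*m+2) (\<lambda>n z. R n z * Rs n z)" by (rule ubigo_weaken) simp
  have "ubigo (2*m+2 + (0 + 0)) (\<lambda>n z. e1 n z * ((1 - Xis n z) * (1 - W (Suc n) z)))"
    by (intro ubigo_mult e X1 W1)
  hence 2: "ubigo (2*m+2) (\<lambda>n z. e1 n z * ((1 - Xis n z) * (1 - W (Suc n) z)))" by simp
  have "ubigo (0 + 0) (\<lambda>n z. (1 - Xi n z) * (1 - W (Suc n) z))" by (intro ubigo_mult X1 W1)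
  hence "ubigo 0 (\<lambda>n z. ((1 - Xi n z) * (1 - W (Suc n) z)) - e1 n z)"
    using ubigo_weaken[OF e(1), of 0] by (intro ubigo_diff) auto
  from ubigo_mult[OF this e(2)]
  have 3: "ubigo (2*m+2) (\<lambda>n z. (((1 - Xi n z) * (1 - W (Suc n) z)) - e1 n z) * e2 n z)" by simp
  have "ubigo (2*m+2) (\<lambda>n z. D n z * (1 - W (Suc n) z))"
    unfolding D_eq by (intro ubigo_add 1 2 3)
  thus ?thesis
  proof (rule ubigo_dominated)
    note sm = ubigo_eventually_small[of _ _ "1/24"]
    have "ubigo (1 + 1) (\<lambda>n z. a n * cnj (a n))" by (intro ubigo_mult ubigo_a)
    hence "\<forall>\<^sub>F n in sequentially. \<forall>z::complex. norm z = 1/2 \<longrightarrow> norm (a n * cnj (a n)) \<le> 1/24"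
      by (rule sm) auto
    moreover have "\<forall>\<^sub>F n in sequentially. \<forall>z. norm z = 1/2 \<longrightarrow> norm (W n z) \<le> 1/24" by (rule sm[OF ubigo_W]) auto
    moreover have "\<forall>\<^sub>F n in sequentially. \<forall>z. norm z = 1/2 \<longrightarrow> norm (W (Suc n) z) \<le> 1/24"
      by (rule sm[OF ubigo_Suc[OF ubigo_W]]) auto
    moreover have "\<forall>\<^sub>F n in sequentially. \<forall>z. norm z = 1/2 \<longrightarrow> norm (Xi n z) \<le> 1/24" by (rule sm[OF ubigo_Xi(1)]) auto
    moreover have "\<forall>\<^sub>F n in sequentially. \<forall>z. norm z = 1/2 \<longrightarrow> norm (Xis n z) \<le> 1/24" by (rule sm[OF ubigo_Xi(2)]) auto
    ultimately show "\<forall>\<^sub>F n in sequentially. \<forall>z. norm z = 1/2 \<longrightarrow>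
      norm (Ln (1 - Xi n z) + Ln (1 - Xis n z) - of_real (ln (1 - (norm (a n))\<^sup>2))
    - (Ln (1 - W n z) - Ln (1 - W (Suc n) z))) \<le> 32 * norm (D n z * (1 - W (Suc n) z))"
    proof eventually_elim
      case (elim n)
      show ?case
      proof (intro allI impI)
        fix z :: complex assume z: "norm z = 1/2"
        have "1 - a n * cnj (a n) = of_real (1 - (norm (a n))\<^sup>2)" by (simp only: complex_norm_square of_real_diff of_real_1)
        moreover have "(norm (a n))\<^sup>2 < 1" using a_less_1[of n] by (simp add: power_less_one_iff)
        ultimately have ln: "Ln (1 - a n * cnj (a n)) = of_real (ln (1 - (norm (a n))\<^sup>2))"
          using Ln_of_real[of "1 - (norm (a n))\<^sup>2"] by simp
        have W: "norm (W (Suc n) z) \<le> 1/24" using elim z by blast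
        have acn: "norm (a n * cnj (a n)) \<le> 1/24" using elim z by blast
        have "norm ((Ln (1 - Xi n z) + Ln (1 - Xis n z) + Ln (1 - W (Suc n) z))
          - (Ln (1 - a n * cnj (a n)) + Ln (1 - W n z) + Ln 1)) \<le> 16 * norm (D n z)"
          unfolding D_def by (rule Ln_prod3_diff_bound) (use elim z acn in simp_all)
        also have "\<dots> \<le> 32 * norm (D n z * (1 - W (Suc n) z))"
        proof -
          have "norm (1 - W (Suc n) z) \<ge> 1/2" using W norm_triangle_ineq2[of 1 "W (Suc n) z"] by simp
          hence "norm (D n z) * (1/2) \<le> norm (D n z) * norm (1 - W (Suc n) z)" by (intro mult_left_mono) auto
          thus ?thesis by (simp add: norm_mult)
        qed
        finally show "norm (Ln (1 - Xi n z) + Ln (1 - Xis n z) - of_real (ln (1 - (norm (a n))\<^sup>2))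
           - (Ln (1 - W n z) - Ln (1 - W (Suc n) z))) \<le> 32 * norm (D n z * (1 - W (Suc n) z))"
          unfolding ln by (simp add: algebra_simps)
      qed
    qed
  qed auto
qed

lemma logp_approx: "ubigo (2*m+2) (\<lambda>n z. Ln (1 - Xi n z) - poly (logp n) (u z))"
  "ubigo (2*m+2) (\<lambda>n z. Ln (1 - Xis n z) - cnj (poly (logp n) (1 - cnj (u z))))"
proof -
  have p: "poly (logp n) x = - (\<Sum>j=1..m. poly (xi n) x ^ j / of_nat j)" for n x
    by (simp add: logp_def poly_sum)
  have ps: "cnj (poly (logp n) (1 - cnj (u z))) = - (\<Sum>j=1..m. Xis n z ^ j / of_nat j)" for n z
    unfolding p by (simp add: Xis_def poly_prefl)
  have key: "ubigo (2*m+2) (\<lambda>n z. Ln (1 - X n z) - (- (\<Sum>j=1..m. X n z ^ j / of_nat j)))" if X: "ubigo 2 X" for X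
  proof (rule ubigo_dominated)
    show "ubigo (2*m+2) (\<lambda>n z. X n z ^ Suc m)" using ubigo_power[OF X, of "Suc m"] by simp
    have "\<forall>\<^sub>F n in sequentially. \<forall>z. norm z = 1/2 \<longrightarrow> norm (X n z) \<le> 1/2" by (rule ubigo_eventually_small[OF X]) auto
    thus "\<forall>\<^sub>F n in sequentially. \<forall>z. norm z = 1/2 \<longrightarrow>
      norm (Ln (1 - X n z) - (- (\<Sum>j=1..m. X n z ^ j / of_nat j))) \<le> 2 * norm (X n z ^ Suc m)"
      by eventually_elim (use Ln_taylor_bound[where m = m] in \<open>simp add: norm_mult norm_power\<close>)
  qed auto
  show "ubigo (2*m+2) (\<lambda>n z. Ln (1 - Xi n z) - poly (logp n) (u z))"
    unfolding p using key[OF ubigo_Xi(1)] unfolding Xi_def .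
  show "ubigo (2*m+2) (\<lambda>n z. Ln (1 - Xis n z) - cnj (poly (logp n) (1 - cnj (u z))))"
    unfolding ps by (rule key[OF ubigo_Xi(2)])
qed

lemma sum_log_approx:
  "\<exists>C. \<forall>\<^sub>F n0 in sequentially. \<forall>N z. norm z = 1/2 \<longrightarrow>
    norm (\<Sum>n=n0..<N. Ln (1 - a n * z * b n z) - poly (logp n) (u z)) \<le> C"
proof (rule ubigo_telescoping_sum[OF _ s_summable])
  have "ubigo (2*m+2) (\<lambda>n z. (Ln (1 - A n z) - Ln (1 - Xi n z) - (T n z - T (Suc n) z)) + (Ln (1 - Xi n z) - poly (logp n) (u z)))"
    by (intro ubigo_add log_transfer logp_approx)
  thus "ubigo (2*m+2) (\<lambda>n z. Ln (1 - a n * z * b n z) - poly (logp n) (u z) - (T n z - T (Suc n) z))"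
    by (rule ubigo_cong) (simp add: A_def)
  have "\<forall>\<^sub>F n in sequentially. \<forall>z. norm z = 1/2 \<longrightarrow> norm (V n z) \<le> 1/2" by (rule ubigo_eventually_small[OF ubigo_V]) auto
  moreover have "\<forall>\<^sub>F n in sequentially. \<forall>z. norm z = 1/2 \<longrightarrow> norm (W n z) \<le> 1/2" by (rule ubigo_eventually_small[OF ubigo_W]) auto
  ultimately show "\<forall>\<^sub>F n in sequentially. \<forall>z. norm z = 1/2 \<longrightarrow> norm (T n z) \<le> 2"
  proof eventually_elim
    case (elim n)
    show ?case
    proof (intro allI impI)
      fix z :: complex assume z: "norm z = 1/2"
      have "norm (Ln (1 - V n z)) \<le> 1" "norm (Ln (1 - W n z)) \<le> 1"
        using elim z norm_Ln_le_twice[of "1 - V n z"] norm_Ln_le_twice[of "1 - W n z"] by fastforce+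
      thus "norm (T n z) \<le> 2" unfolding T_def by (smt (verit) norm_triangle_ineq4)
    qed
  qed
qed

lemma sum_logp_symmetric:
  "\<exists>C. \<forall>\<^sub>F n0 in sequentially. \<forall>N z. norm z = 1/2 \<longrightarrow>
    norm (\<Sum>n=n0..<N. poly (logp n) (u z) + cnj (poly (logp n) (1 - cnj (u z))) - of_real (ln (1 - (norm (a n))\<^sup>2))) \<le> C"
proof (rule ubigo_telescoping_sum[OF _ s_summable])
  have "ubigo (2*m+2) (\<lambda>n z. (Ln (1 - Xi n z) + Ln (1 - Xis n z) - of_real (ln (1 - (norm (a n))\<^sup>2))
    - (Ln (1 - W n z) - Ln (1 - W (Suc n) z))) - (Ln (1 - Xi n z) - poly (logp n) (u z)) - (Ln (1 - Xis n z) - cnj (poly (logp n) (1 - cnj (u z)))))"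
    by (intro ubigo_diff log_symmetric logp_approx)
  thus "ubigo (2*m+2) (\<lambda>n z. poly (logp n) (u z) + cnj (poly (logp n) (1 - cnj (u z))) - of_real (ln (1 - (norm (a n))\<^sup>2))
     - (Ln (1 - W n z) - Ln (1 - W (Suc n) z)))"
    by (rule ubigo_cong) (simp add: algebra_simps)
  have "\<forall>\<^sub>F n in sequentially. \<forall>z. norm z = 1/2 \<longrightarrow> norm (W n z) \<le> 1/2" by (rule ubigo_eventually_small[OF ubigo_W]) auto
  thus "\<forall>\<^sub>F n in sequentially. \<forall>z. norm z = 1/2 \<longrightarrow> norm (Ln (1 - W n z)) \<le> 1"
  proof eventually_elim
    case (elim n)
    thus ?case using norm_Ln_le_twice[of "1 - W n z" for z] by fastforce
  qed
qed

text \<open>With e = 1 coefficient i has homogeneity i + 1. This reaches 2m + 2 exactly where the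
  zero of the weight no longer cancels the pole of u^i.\<close>

lemma logp_coeff_summable:
  assumes "2 * m + 1 \<le> i"
  shows "summable (\<lambda>n. norm (coeff (logp n) i))"
proof -
  have "bigo (1 + 1 * i) (\<lambda>n. coeff (logp n) i)" using logp_class by (simp add: pclass_def smooth_0)
  hence "bigo (2*m+2) (\<lambda>n. coeff (logp n) i)" by (rule bigo_weaken) (use assms in simp)
  then obtain C where "\<And>n. norm (coeff (logp n) i) \<le> C * s n ^ (2*m+2)" by (auto simp: bigo_def)
  thus ?thesis by (intro summable_comparison_test'[OF summable_mult[OF s_summable, of C]]) simp
qed

lemma logp_degree_bounded: "\<exists>D. \<forall>n. degree (logp n) \<le> D"
  using logp_class by (simp add: pclass_def)

end

section \<open>The weighted functional\<close>

text \<open>Angles are measured from \<phi>, so that the zero of the weight falls on z = 1, the pole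
  of u.\<close>

definition circ :: "real \<Rightarrow> real \<Rightarrow> real \<Rightarrow> complex" where
  "circ \<phi> r t = of_real r * cis (t - \<phi>)"

lemma norm_circ: "r \<ge> 0 \<Longrightarrow> norm (circ \<phi> r t) = r"
  by (simp add: circ_def norm_mult)

lemma continuous_on_circ: "continuous_on S (circ \<phi> r)"
  unfolding circ_def[abs_def] by (intro continuous_intros)

lemma continuous_on_comp_circ:
  assumes "continuous_on (sphere 0 r) f" "r \<ge> 0"
  shows "continuous_on S (\<lambda>t. f (circ \<phi> r t))"
  using assms by (intro continuous_on_compose2[OF _ continuous_on_circ]) (auto simp: norm_circ)

text \<open>Both integrals are the same multiple of the k-th Taylor coefficient at 0 of the rotated
  function. Cauchy's formula needs only continuity on the boundary circle, so r = 1 is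
  allowed.\<close>

lemma circle_integral_radius:
  assumes cont: "continuous_on (cball 0 1) g" and holo: "g holomorphic_on ball 0 1"
    and r: "0 < r" "r \<le> 1"
  shows "integral {0..2*pi} (\<lambda>t. g (circ \<phi> r t) / circ \<phi> r t ^ k) = integral {0..2*pi} (\<lambda>t. g (circ \<phi> 1 t) / circ \<phi> 1 t ^ k)"
proof -
  define c where "c = cis (- \<phi>)"
  have c: "norm c = 1" "c \<noteq> 0" by (auto simp: c_def)
  define h where "h w = g (c * w)" for w
  have hc: "continuous_on (cball 0 1) h" unfolding h_def
    by (rule continuous_on_compose2[OF cont]) (auto intro!: continuous_intros simp: norm_mult c)
  have hh: "h holomorphic_on ball 0 1"
  proof -
    have "(g \<circ> (\<lambda>w. c * w)) holomorphic_on ball 0 1"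
      by (rule holomorphic_on_compose_gen[OF _ holo]) (auto intro!: holomorphic_intros simp: norm_mult c)
    thus ?thesis by (simp add: h_def[abs_def] o_def)
  qed
  define I where "I = (2 * pi * \<i>) / fact k * (deriv ^^ k) h 0"
  have "integral {0..2*pi} (\<lambda>t. g (circ \<phi> r t) / circ \<phi> r t ^ k) = I / (\<i> * c ^ k)" if r: "0 < r" "r \<le> 1" for r
  proof -
    have "((\<lambda>w. h w / (w - 0) ^ Suc k) has_contour_integral I) (circlepath 0 r)"
      unfolding I_def
    proof (rule Cauchy_has_contour_integral_higher_derivative_circlepath)
      show "continuous_on (cball 0 r) h" by (rule continuous_on_subset[OF hc]) (use r in auto)
      show "h holomorphic_on ball 0 r" by (rule holomorphic_on_subset[OF hh]) (use r in auto)
    qed (use r in auto)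
    hence "((\<lambda>t. h (0 + r * cis t) / ((0 + r * cis t) - 0) ^ Suc k * r * \<i> * cis t) has_integral I) {0..2*pi}"
      unfolding circlepath_def by (subst (asm) has_contour_integral_part_circlepath_iff) (auto simp: mult_ac)
    moreover have "h (0 + r * cis t) / ((0 + r * cis t) - 0) ^ Suc k * r * \<i> * cis t = (\<i> * c ^ k) * (g (circ \<phi> r t) / circ \<phi> r t ^ k)" for t
    proof -
      have "circ \<phi> r t = c * (r * cis t)" by (simp add: circ_def c_def cis_mult)
      thus ?thesis using r c by (simp add: h_def field_simps power_mult_distrib)
    qed
    ultimately have "((\<lambda>t. (\<i> * c ^ k) * (g (circ \<phi> r t) / circ \<phi> r t ^ k)) has_integral I) {0..2*pi}"
      by (simp only:)
    from has_integral_mult_right[OF this, of "1 / (\<i> * c ^ k)"]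
    have "((\<lambda>t. g (circ \<phi> r t) / circ \<phi> r t ^ k) has_integral (I / (\<i> * c ^ k))) {0..2*pi}"
      using c by simp
    thus ?thesis by (rule integral_unique)
  qed
  from this[OF r] this[of 1] show ?thesis by simp
qed

definition szego_weight :: "nat \<Rightarrow> complex \<Rightarrow> complex" where
  "szego_weight m z = ((1 - z) * (1 - 1 / z) / 2) ^ m"

lemma szego_weight_circ: "szego_weight m (circ \<phi> 1 t) = of_real ((1 - cos (t - \<phi>)) ^ m)"
proof -
  have inv: "1 / circ \<phi> 1 t = cnj (circ \<phi> 1 t)" by (simp add: circ_def cis_cnj divide_inverse)
  have "(1 - circ \<phi> 1 t) * (1 - cnj (circ \<phi> 1 t)) / 2 = of_real (1 - cos (t - \<phi>))"
  proof -
    define w where "w = circ \<phi> 1 t"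
    have "w * cnj w = 1" using norm_circ[of 1 \<phi> t] complex_norm_square[of w] by (simp add: w_def)
    hence "(1 - w) * (1 - cnj w) = 2 - (w + cnj w)" by (simp add: algebra_simps)
    also have "\<dots> = of_real (2 * (1 - cos (t - \<phi>)))"
      unfolding complex_add_cnj by (simp add: w_def circ_def)
    finally show ?thesis by (simp add: w_def)
  qed
  hence "(1 - circ \<phi> 1 t) * (1 - 1 / circ \<phi> 1 t) / 2 = of_real (1 - cos (t - \<phi>))"
    unfolding inv .
  thus ?thesis by (simp only: szego_weight_def of_real_power)
qed

lemma szego_weight_eq: "z \<noteq> 0 \<Longrightarrow> szego_weight m z = (-1/2) ^ m * (1 - z) ^ (2 * m) / z ^ m"
proof -
  assume "z \<noteq> 0"
  hence "(1 - z) * (1 - 1 / z) / 2 = (-1/2) * (1 - z) ^ 2 / z" by (simp add: field_simps power2_eq_square)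
  thus ?thesis by (simp only: szego_weight_def power_divide power_mult_distrib power_mult[symmetric] mult.commute)
qed

definition half_functional :: "nat \<Rightarrow> real \<Rightarrow> (complex \<Rightarrow> complex) \<Rightarrow> complex" where
  "half_functional m \<phi> f = integral {0..2*pi} (\<lambda>t. szego_weight m (circ \<phi> (1/2) t) * f (circ \<phi> (1/2) t))"

lemma continuous_on_half_weight:
  assumes "continuous_on (sphere 0 (1/2)) f"
  shows "continuous_on S (\<lambda>t. szego_weight m (circ \<phi> (1/2) t) * f (circ \<phi> (1/2) t))"
  unfolding szego_weight_def
  by (intro continuous_intros continuous_on_circ continuous_on_comp_circ assms) (auto simp: circ_def)

lemma half_functional_integrable:
  assumes "continuous_on (sphere 0 (1/2)) f"
  shows "(\<lambda>t. szego_weight m (circ \<phi> (1/2) t) * f (circ \<phi> (1/2) t)) integrable_on {0..2*pi}"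
  using continuous_on_half_weight[OF assms] by (rule integrable_continuous_interval)

lemma half_functional_add:
  assumes "continuous_on (sphere 0 (1/2)) f" "continuous_on (sphere 0 (1/2)) g"
  shows "half_functional m \<phi> (\<lambda>z. f z + g z) = half_functional m \<phi> f + half_functional m \<phi> g"
  unfolding half_functional_def distrib_left by (intro integral_add half_functional_integrable assms)

lemma half_functional_diff:
  assumes "continuous_on (sphere 0 (1/2)) f" "continuous_on (sphere 0 (1/2)) g"
  shows "half_functional m \<phi> (\<lambda>z. f z - g z) = half_functional m \<phi> f - half_functional m \<phi> g"
  unfolding half_functional_def right_diff_distrib by (intro integral_diff half_functional_integrable assms)

lemma half_functional_cmult: "half_functional m \<phi> (\<lambda>z. c * f z) = c * half_functional m \<phi> f"
  unfolding half_functional_def mult.left_commute[of _ c] by (rule integral_mult_right)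

lemma half_functional_sum:
  assumes "finite I" "\<And>i. i \<in> I \<Longrightarrow> continuous_on (sphere 0 (1/2)) (f i)"
  shows "half_functional m \<phi> (\<lambda>z. \<Sum>i\<in>I. f i z) = (\<Sum>i\<in>I. half_functional m \<phi> (f i))"
  unfolding half_functional_def sum_distrib_left using assms by (intro integral_sum half_functional_integrable)

lemma half_functional_bound:
  assumes f: "continuous_on (sphere 0 (1/2)) f" and B: "\<And>z. norm z = 1/2 \<Longrightarrow> norm (f z) \<le> B"
  shows "norm (half_functional m \<phi> f) \<le> (9/4) ^ m * B * (2 * pi)"
proof -
  have "norm (half_functional m \<phi> f) \<le> (9/4) ^ m * B * (2 * pi - 0)"
    unfolding half_functional_def
  proof (rule integral_bound[OF _ continuous_on_half_weight[OF f]])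
    fix t
    define z where "z = circ \<phi> (1/2) t"
    have z: "norm z = 1/2" by (simp add: z_def norm_circ)
    have "norm (1 - z) \<le> 3/2" using norm_triangle_ineq4[of 1 z] z by simp
    moreover have "norm (1 - 1 / z) \<le> 3" using norm_triangle_ineq4[of 1 "1 / z"] z by (simp add: norm_divide)
    ultimately have "norm ((1 - z) * (1 - 1 / z)) \<le> 3/2 * 3"
      unfolding norm_mult by (intro mult_mono) auto
    hence "norm ((1 - z) * (1 - 1 / z) / 2) \<le> 9/4" unfolding norm_divide by simp
    hence "norm (szego_weight m z) \<le> (9/4) ^ m"
      unfolding szego_weight_def norm_power by (intro power_mono) auto
    thus "norm (szego_weight m (circ \<phi> (1/2) t) * f (circ \<phi> (1/2) t)) \<le> (9/4) ^ m * B"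
      unfolding norm_mult z_def[symmetric] using B[OF z] by (intro mult_mono) auto
  qed auto
  thus ?thesis by simp
qed

lemma half_functional_holomorphic:
  assumes cont: "continuous_on (cball 0 1) f" and holo: "f holomorphic_on ball 0 1"
  shows "half_functional m \<phi> f = integral {0..2*pi} (\<lambda>t. of_real ((1 - cos (t - \<phi>)) ^ m) * f (circ \<phi> 1 t))"
proof -
  define g where "g z = (-1/2) ^ m * (1 - z) ^ (2 * m) * f z" for z
  have gc: "continuous_on (cball 0 1) g" unfolding g_def by (intro continuous_intros cont)
  have gh: "g holomorphic_on ball 0 1" unfolding g_def by (intro holomorphic_intros holo)
  have eq: "szego_weight m (circ \<phi> r t) * f (circ \<phi> r t) = g (circ \<phi> r t) / circ \<phi> r t ^ m" if "r > 0" for r t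
    using that by (subst szego_weight_eq) (auto simp: g_def circ_def)
  show ?thesis
    unfolding half_functional_def szego_weight_circ[symmetric] using eq circle_integral_radius[OF gc gh, of "1/2" \<phi> m] by simp
qed

text \<open>For k <= 2m the zero of the weight cancels the pole of u^k, so both integrands are
  polynomials divided by z^m and can be moved to the unit circle. There 1 - u is the conjugate of u
  and the weight is real.\<close>

lemma half_functional_powers:
  assumes k: "k \<le> 2 * m"
  shows "half_functional m \<phi> (\<lambda>z. (1 - 1 / (1 - z)) ^ k) = cnj (half_functional m \<phi> (\<lambda>z. (1 / (1 - z)) ^ k))"
proof -
  define n where "n = 2 * m - k"
  have n: "2 * m = n + k" using k by (simp add: n_def)
  \<comment> \<open>z^m times the weight times u^k, respectively times (1 - u)^k = (-z)^k u^k, after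
    cancelling powers of 1 - z.\<close>
  define g1 where "g1 z = (-1/2) ^ m * (1 - z) ^ n" for z :: complex
  define g2 where "g2 z = (-1/2) ^ m * (1 - z) ^ n * (-z) ^ k" for z :: complex
  have z: "circ \<phi> (1/2) t \<noteq> 0" "circ \<phi> (1/2) t \<noteq> 1" for t
    using norm_circ[of "1/2" \<phi> t] by (auto simp del: norm_circ)
  have "half_functional m \<phi> (\<lambda>z. (1 / (1 - z)) ^ k) = integral {0..2*pi} (\<lambda>t. g1 (circ \<phi> (1/2) t) / circ \<phi> (1/2) t ^ m)"
    unfolding half_functional_def szego_weight_eq[OF z(1)] n g1_def using z(2)
    by (simp add: power_add power_divide)
  also have "\<dots> = integral {0..2*pi} (\<lambda>t. g1 (circ \<phi> 1 t) / circ \<phi> 1 t ^ m)"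
    by (rule circle_integral_radius) (auto simp: g1_def[abs_def] intro!: continuous_intros holomorphic_intros)
  finally have 1: "half_functional m \<phi> (\<lambda>z. (1 / (1 - z)) ^ k) = integral {0..2*pi} (\<lambda>t. g1 (circ \<phi> 1 t) / circ \<phi> 1 t ^ m)" .
  have "half_functional m \<phi> (\<lambda>z. (1 - 1 / (1 - z)) ^ k) = integral {0..2*pi} (\<lambda>t. g2 (circ \<phi> (1/2) t) / circ \<phi> (1/2) t ^ m)"
  proof -
    have u: "(1 - 1 / (1 - circ \<phi> (1/2) t)) ^ k = (- circ \<phi> (1/2) t) ^ k / (1 - circ \<phi> (1/2) t) ^ k" for t
      unfolding power_divide[symmetric] using z(2)[of t] by (simp add: field_simps)
    have "(-1/2) ^ m * (1 - x) ^ (n + k) / x ^ m * ((- x) ^ k / (1 - x) ^ k) = (-1/2) ^ m * (1 - x) ^ n * (- x) ^ k / x ^ m"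
      if "x \<noteq> 1" for x :: complex
      using that by (simp only: power_add) simp
    from this[OF z(2)] show ?thesis unfolding half_functional_def szego_weight_eq[OF z(1)] n g2_def u by (simp only:)
  qed
  also have "\<dots> = integral {0..2*pi} (\<lambda>t. g2 (circ \<phi> 1 t) / circ \<phi> 1 t ^ m)"
    by (rule circle_integral_radius) (auto simp: g2_def[abs_def] intro!: continuous_intros holomorphic_intros)
  also have "\<dots> = integral {0..2*pi} (\<lambda>t. cnj (g1 (circ \<phi> 1 t) / circ \<phi> 1 t ^ m))"
  proof (rule arg_cong[where f = "integral {0..2*pi}"], rule ext)
    fix t
    define z where "z = circ \<phi> 1 t"
    have z0: "z \<noteq> 0" by (simp add: z_def circ_def)
    have zc: "cnj z = 1 / z" by (simp add: z_def circ_def cis_cnj divide_inverse)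
    have "cnj (g1 z / z ^ m) = (-1/2) ^ m * (1 - 1 / z) ^ n / (1 / z) ^ m"
      by (simp add: g1_def zc)
    also have "\<dots> = (-1/2) ^ m * (1 - 1 / z) ^ n * z ^ m"
      using z0 by (simp only: power_divide power_one divide_divide_eq_right div_by_1)
    also have "1 - 1 / z = - (1 - z) / z" using z0 by (simp add: field_simps)
    also have "(- (1 - z) / z) ^ n = (-1) ^ n * (1 - z) ^ n / z ^ n"
      by (simp only: power_divide power_minus[of "1 - z" n])
    also have "(-1/2) ^ m * ((-1) ^ n * (1 - z) ^ n / z ^ n) * z ^ m = (-1/2) ^ m * (1 - z) ^ n * ((-1) ^ n * z ^ m / z ^ n)"
      by simp
    also have "(-1) ^ n * z ^ m / z ^ n = (-z) ^ k / z ^ m"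
    proof -
      have "even n \<longleftrightarrow> even k" using n by presburger
      hence "(-1) ^ n = ((-1) ^ k :: complex)" by (simp add: minus_one_power_iff)
      moreover have "z ^ m * z ^ m = z ^ k * z ^ n" using n by (simp add: power_add[symmetric] mult_2 add.commute)
      moreover have "(-z) ^ k = (-1) ^ k * z ^ k" by (rule power_minus)
      ultimately have "(-1) ^ n * z ^ m * z ^ m = (-z) ^ k * z ^ n" by (simp add: mult.assoc)
      thus ?thesis using z0 by (subst frac_eq_eq) auto
    qed
    finally show "g2 (circ \<phi> 1 t) / circ \<phi> 1 t ^ m = cnj (g1 (circ \<phi> 1 t) / circ \<phi> 1 t ^ m)"
      by (simp add: g2_def z_def)
  qed
  also have "\<dots> = cnj (integral {0..2*pi} (\<lambda>t. g1 (circ \<phi> 1 t) / circ \<phi> 1 t ^ m))"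
    by (rule Henstock_Kurzweil_Integration.integral_cnj[symmetric])
  finally show ?thesis unfolding 1 .
qed

lemma continuous_on_poly_half: "continuous_on (sphere 0 (1/2)) (\<lambda>z. poly p (1 / (1 - z)))"
  "continuous_on (sphere 0 (1/2)) (\<lambda>z. cnj (poly p (1 - cnj (1 / (1 - z)))))"
  by (intro continuous_intros; auto)+

text \<open>Powers up to 2m cancel exactly. The majorants \<open>B\<close> make the remaining bound
  uniform over all partial sums of the polynomials \<open>logp\<close>.\<close>

lemma half_functional_star:
  assumes deg: "degree p \<le> D" and high: "\<And>i. 2 * m + 1 \<le> i \<Longrightarrow> norm (coeff p i) \<le> B i"
  shows "norm (half_functional m \<phi> (\<lambda>z. cnj (poly p (1 - cnj (1 / (1 - z))))) - cnj (half_functional m \<phi> (\<lambda>z. poly p (1 / (1 - z)))))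
    \<le> (\<Sum>i=2*m+1..D. B i * norm (half_functional m \<phi> (\<lambda>z. (1 - 1 / (1 - z)) ^ i) - cnj (half_functional m \<phi> (\<lambda>z. (1 / (1 - z)) ^ i))))"
proof -
  define X where "X i = half_functional m \<phi> (\<lambda>z. (1 - 1 / (1 - z)) ^ i) - cnj (half_functional m \<phi> (\<lambda>z. (1 / (1 - z)) ^ i))" for i
  have c: "continuous_on (sphere 0 (1/2)) (\<lambda>z::complex. 1 / (1 - z))"
    by (intro continuous_intros) auto
  have 1: "half_functional m \<phi> (\<lambda>z. poly p (1 / (1 - z))) = (\<Sum>i\<le>D. coeff p i * half_functional m \<phi> (\<lambda>z. (1 / (1 - z)) ^ i))"
    unfolding poly_eq_sum_le[OF deg]
    by (subst half_functional_sum) (auto intro!: continuous_intros c simp: half_functional_cmult)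
  have "cnj (poly p (1 - cnj (1 / (1 - z)))) = (\<Sum>i\<le>D. cnj (coeff p i) * (1 - 1 / (1 - z)) ^ i)" for z
    unfolding poly_eq_sum_le[OF deg] by simp
  hence 2: "half_functional m \<phi> (\<lambda>z. cnj (poly p (1 - cnj (1 / (1 - z))))) = (\<Sum>i\<le>D. cnj (coeff p i) * half_functional m \<phi> (\<lambda>z. (1 - 1 / (1 - z)) ^ i))"
    by (simp only:) (subst half_functional_sum, auto intro!: continuous_intros c simp: half_functional_cmult)
  have "half_functional m \<phi> (\<lambda>z. cnj (poly p (1 - cnj (1 / (1 - z))))) - cnj (half_functional m \<phi> (\<lambda>z. poly p (1 / (1 - z))))
     = (\<Sum>i\<le>D. cnj (coeff p i) * X i)"
    unfolding 1 2 by (simp add: X_def sum_subtractf right_diff_distrib)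
  also have "\<dots> = (\<Sum>i=2*m+1..D. cnj (coeff p i) * X i)"
    by (intro sum.mono_neutral_right) (auto simp: X_def half_functional_powers)
  also have "norm \<dots> \<le> (\<Sum>i=2*m+1..D. B i * norm (X i))"
    using high by (intro sum_norm_le) (auto simp: norm_mult intro!: mult_right_mono)
  finally show ?thesis unfolding X_def .
qed

text \<open>Let H be the functional on |z| = 1/2 and p the sum of the \<open>logp\<close> from n0
  on. Beyond the fixed initial factors, 2 Re H(L) is within a constant of H(p) plus its conjugate,
  this of H(p) plus H of the reflected p, and this of H applied to the sum of the ln (1 -
  |a|^2).\<close>

lemma (in schur_iterates) szego_weight_log_sum_bounded:
  fixes \<phi> :: real
  assumes b_cont: "\<And>n. continuous_on (cball 0 1) (b n)" and b_holo: "\<And>n. b n holomorphic_on ball 0 1"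
  defines "L \<equiv> \<lambda>N z. \<Sum>n<N. Ln (1 - a n * z * b n z)"
  shows "\<exists>C. \<forall>N. \<bar>2 * integral {0..2*pi} (\<lambda>t. (1 - cos (t - \<phi>)) ^ m * Re (L N (circ \<phi> 1 t)))
    - integral {0..2*pi} (\<lambda>t. (1 - cos (t - \<phi>)) ^ m) * (\<Sum>n<N. ln (1 - (norm (a n))\<^sup>2))\<bar> \<le> C"
proof -
  let ?H = "half_functional m \<phi>"
  have pos: "1 - a n * z * b n z \<notin> \<real>\<^sub>\<le>\<^sub>0" if "norm z \<le> 1" for n z
  proof -
    have "norm (a n * z * b n z) \<le> norm (a n) * 1 * 1"
      unfolding norm_mult using b_le_1[OF that] that by (intro mult_mono) auto
    hence "norm (a n * z * b n z) < 1" using a_less_1[of n] by simp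
    hence "Re (a n * z * b n z) < 1" using complex_Re_le_cmod order_le_less_trans by blast
    thus ?thesis by (auto simp: complex_nonpos_Reals_iff)
  qed
  have Lc: "continuous_on (cball 0 1) (\<lambda>z. Ln (1 - a n * z * b n z))" for n
    using pos by (intro continuous_intros b_cont continuous_on_Ln') auto
  have Lh: "(\<lambda>z. Ln (1 - a n * z * b n z)) holomorphic_on ball 0 1" for n
    using pos by (intro holomorphic_intros b_holo) auto
  have Lc2: "continuous_on (sphere 0 (1/2)) (\<lambda>z. Ln (1 - a n * z * b n z))" for n
    by (rule continuous_on_subset[OF Lc]) auto
  have LNc: "continuous_on (cball 0 1) (L N)" and LNh: "L N holomorphic_on ball 0 1" for N
    unfolding L_def by (intro continuous_intros Lc holomorphic_intros Lh)+
  have LNc2: "continuous_on (sphere 0 (1/2)) (L N)" for N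
    by (rule continuous_on_subset[OF LNc]) auto
  define P where "P M N = (\<Sum>n=M..<N. logp n)" for M N
  define w0 where "w0 = integral {0..2*pi} (\<lambda>t. (1 - cos (t - \<phi>)) ^ m)"
  have w0: "?H (\<lambda>z. 1) = of_real w0"
  proof -
    have "?H (\<lambda>z. 1) = integral {0..2*pi} (\<lambda>t. of_real ((1 - cos (t - \<phi>)) ^ m))"
      by (subst half_functional_holomorphic) (auto intro: holomorphic_intros)
    also have "\<dots> = of_real w0" unfolding w0_def
      by (rule integral_linear[of "\<lambda>t. (1 - cos (t - \<phi>)) ^ m" "{0..2*pi}" complex_of_real, unfolded o_def])
        (auto intro!: integrable_continuous_interval continuous_intros bounded_linear_of_real)
    finally show ?thesis .
  qed
  define l where "l n = ln (1 - (norm (a n))\<^sup>2)" for n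
  obtain C1 C2 n0 where
    C1: "\<And>N z. norm z = 1/2 \<Longrightarrow> norm (\<Sum>n=n0..<N. Ln (1 - a n * z * b n z) - poly (logp n) (u z)) \<le> C1" and
    C2: "\<And>N z. norm z = 1/2 \<Longrightarrow> norm (\<Sum>n=n0..<N. poly (logp n) (u z) + cnj (poly (logp n) (1 - cnj (u z))) - of_real (l n)) \<le> C2"
  proof -
    from sum_log_approx sum_logp_symmetric obtain C1 C2 where
      "\<forall>\<^sub>F n0 in sequentially. \<forall>N z. norm z = 1/2 \<longrightarrow> norm (\<Sum>n=n0..<N. Ln (1 - a n * z * b n z) - poly (logp n) (u z)) \<le> C1"
      "\<forall>\<^sub>F n0 in sequentially. \<forall>N z. norm z = 1/2 \<longrightarrow> norm (\<Sum>n=n0..<N. poly (logp n) (u z) + cnj (poly (logp n) (1 - cnj (u z))) - of_real (l n)) \<le> C2"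
      unfolding l_def by blast
    from eventually_conj[OF this] show ?thesis using that unfolding eventually_sequentially by blast
  qed
  obtain D where D: "\<And>n. degree (logp n) \<le> D" using logp_degree_bounded by blast
  define c where "c i = norm (?H (\<lambda>z. (1 - 1 / (1 - z)) ^ i) - cnj (?H (\<lambda>z. (1 / (1 - z)) ^ i)))" for i
  define C3 where "C3 = (\<Sum>i=2*m+1..D. (\<Sum>n. norm (coeff (logp n) i)) * c i)"
  define K where "K = (9/4) ^ m * (2 * pi)"
  define Lp where "Lp N z = (\<Sum>n=n0..<N. Ln (1 - a n * z * b n z))" for N z
  have Lpc: "continuous_on (sphere 0 (1/2)) (Lp N)" for N unfolding Lp_def by (intro continuous_intros Lc2)
  have poly_u: "poly (P n0 N) (1 / (1 - z)) = (\<Sum>n=n0..<N. poly (logp n) (u z))" for N z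
    by (simp add: P_def poly_sum u_def)
  have poly_us: "cnj (poly (P n0 N) (1 - cnj (1 / (1 - z)))) = (\<Sum>n=n0..<N. cnj (poly (logp n) (1 - cnj (u z))))" for N z
    by (simp add: P_def poly_sum u_def)
  have main: "norm (?H (Lp N) + cnj (?H (Lp N)) - of_real (w0 * (\<Sum>n=n0..<N. l n))) \<le> 2 * (K * C1) + K * C2 + C3" for N
  proof -
    let ?p = "\<lambda>z. poly (P n0 N) (1 / (1 - z))" and ?ps = "\<lambda>z. cnj (poly (P n0 N) (1 - cnj (1 / (1 - z))))"
    have 1: "norm (?H (Lp N) - ?H ?p) \<le> K * C1"
    proof -
      have "norm (?H (\<lambda>z. Lp N z - ?p z)) \<le> (9/4) ^ m * C1 * (2 * pi)"
        by (intro half_functional_bound continuous_on_diff Lpc continuous_on_poly_half)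
          (use C1[of _ N] in \<open>simp add: poly_u Lp_def sum_subtractf\<close>)
      thus ?thesis by (subst (asm) half_functional_diff[OF Lpc continuous_on_poly_half(1)]) (simp add: K_def mult_ac)
    qed
    have 2: "norm (?H ?p + ?H ?ps - of_real (w0 * (\<Sum>n=n0..<N. l n))) \<le> K * C2"
    proof -
      have eq: "?p z + ?ps z - of_real (\<Sum>n=n0..<N. l n) =
        (\<Sum>n=n0..<N. poly (logp n) (u z) + cnj (poly (logp n) (1 - cnj (u z))) - of_real (l n))" for z
        unfolding poly_u poly_us by (simp add: sum_subtractf sum.distrib)
      have "norm (?H (\<lambda>z. ?p z + ?ps z - of_real (\<Sum>n=n0..<N. l n))) \<le> (9/4) ^ m * C2 * (2 * pi)"
        by (intro half_functional_bound continuous_on_diff continuous_on_add continuous_on_const continuous_on_poly_half)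
          (rule eq[THEN ord_eq_le_trans[OF arg_cong[where f = norm]], OF C2])
      moreover have "?H (\<lambda>z. ?p z + ?ps z - of_real (\<Sum>n=n0..<N. l n)) = ?H (\<lambda>z. ?p z + ?ps z) - ?H (\<lambda>z. of_real (\<Sum>n=n0..<N. l n))"
        by (intro half_functional_diff continuous_on_add continuous_on_const continuous_on_poly_half)
      moreover have "?H (\<lambda>z. ?p z + ?ps z) = ?H ?p + ?H ?ps"
        by (intro half_functional_add continuous_on_poly_half)
      moreover have "?H (\<lambda>z. of_real (\<Sum>n=n0..<N. l n)) = of_real (w0 * (\<Sum>n=n0..<N. l n))"
        using half_functional_cmult[of m \<phi> "of_real (\<Sum>n=n0..<N. l n)" "\<lambda>z. 1"] unfolding w0 by (simp add: mult.commute)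
      ultimately show ?thesis by (simp add: K_def mult_ac)
    qed
    have 3: "norm (?H ?ps - cnj (?H ?p)) \<le> C3" unfolding C3_def c_def
    proof (rule half_functional_star)
      show "degree (P n0 N) \<le> D" unfolding P_def using D by (intro degree_sum_le) auto
      fix i assume i: "2 * m + 1 \<le> i"
      have "norm (coeff (P n0 N) i) \<le> (\<Sum>n=n0..<N. norm (coeff (logp n) i))"
        unfolding P_def coeff_sum by (rule norm_sum)
      also have "\<dots> \<le> (\<Sum>n. norm (coeff (logp n) i))"
        using logp_coeff_summable[OF i] by (intro sum_le_suminf) auto
      finally show "norm (coeff (P n0 N) i) \<le> (\<Sum>n. norm (coeff (logp n) i))" .
    qed
    have split: "norm (x + cnj x - w) \<le> norm (x - p) + norm (x - p) + norm (p + q - w) + norm (q - cnj p)" for x p q w :: complex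
    proof -
      have "x + cnj x - w = (x - p) + cnj (x - p) + (p + q - w) - (q - cnj p)" by simp
      also have "norm \<dots> \<le> norm (x - p) + norm (cnj (x - p)) + norm (p + q - w) + norm (q - cnj p)"
        by (meson add_mono norm_triangle_ineq norm_triangle_ineq4 order_refl order_trans)
      finally show ?thesis unfolding complex_mod_cnj .
    qed
    have "norm (?H (Lp N) + cnj (?H (Lp N)) - of_real (w0 * (\<Sum>n=n0..<N. l n))) \<le> K * C1 + K * C1 + K * C2 + C3"
      by (rule order_trans[OF split add_mono[OF add_mono[OF add_mono[OF 1 1] 2] 3]])
    thus ?thesis by (simp only: mult_2)
  qed
  define X where "X N = 2 * integral {0..2*pi} (\<lambda>t. (1 - cos (t - \<phi>)) ^ m * Re (L N (circ \<phi> 1 t))) - w0 * (\<Sum>n<N. l n)" for N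
  have H_L: "2 * integral {0..2*pi} (\<lambda>t. (1 - cos (t - \<phi>)) ^ m * Re (L N (circ \<phi> 1 t))) = 2 * Re (?H (L N))" for N
  proof -
    have "continuous_on {0..2*pi} (\<lambda>t. of_real ((1 - cos (t - \<phi>)) ^ m) * L N (circ \<phi> 1 t))"
      by (intro continuous_intros continuous_on_comp_circ continuous_on_subset[OF LNc]) auto
    hence int: "(\<lambda>t. of_real ((1 - cos (t - \<phi>)) ^ m) * L N (circ \<phi> 1 t)) integrable_on {0..2*pi}"
      by (rule integrable_continuous_interval)
    have "Re (?H (L N)) = integral {0..2*pi} (\<lambda>t. Re (of_real ((1 - cos (t - \<phi>)) ^ m) * L N (circ \<phi> 1 t)))"
      unfolding half_functional_holomorphic[OF LNc LNh]
      using integral_linear[OF int bounded_linear_Re] by (simp add: o_def)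
    thus ?thesis by simp
  qed
  define E where "E = 2 * Re (?H (L n0)) - w0 * (\<Sum>n<n0. l n)"
  have XN: "\<bar>X N\<bar> \<le> \<bar>E\<bar> + (2 * (K * C1) + K * C2 + C3)" if "n0 \<le> N" for N
  proof -
    have split: "(\<Sum>n<N. f n) = (\<Sum>n<n0. f n) + (\<Sum>n=n0..<N. f n)" for f :: "nat \<Rightarrow> 'x::comm_monoid_add"
      using that by (metis atLeast0LessThan le0 sum.atLeastLessThan_concat)
    have "L N = (\<lambda>z. L n0 z + Lp N z)" unfolding L_def Lp_def by (rule ext) (rule split)
    hence "?H (L N) = ?H (L n0) + ?H (Lp N)"
      using half_functional_add[OF LNc2 Lpc] by simp
    hence "X N = E + Re (?H (Lp N) + cnj (?H (Lp N)) - of_real (w0 * (\<Sum>n=n0..<N. l n)))"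
      unfolding X_def H_L E_def split[of l] by (simp add: algebra_simps)
    thus ?thesis using main[of N] abs_Re_le_cmod[of "?H (Lp N) + cnj (?H (Lp N)) - of_real (w0 * (\<Sum>n=n0..<N. l n))"]
      by linarith
  qed
  \<comment> \<open>The finitely many N below n0 are covered by adding their values to the
    bound.\<close>
  have "\<bar>X N\<bar> \<le> (\<Sum>n<n0. \<bar>X n\<bar>) + \<bar>\<bar>E\<bar> + (2 * (K * C1) + K * C2 + C3)\<bar>" for N
  proof (cases "n0 \<le> N")
    case True
    have "(\<Sum>n<n0. \<bar>X n\<bar>) \<ge> 0" by (intro sum_nonneg) auto
    thus ?thesis using XN[OF True] by linarith
  next
    case False
    hence "\<bar>X N\<bar> \<le> (\<Sum>n<n0. \<bar>X n\<bar>)" by (intro member_le_sum) auto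
    thus ?thesis by linarith
  qed
  thus ?thesis unfolding X_def w0_def l_def by blast
qed

text \<open>For \<beta> = 1 these are the quotients of the monic polynomials of the Szego recursion
  by their reverses (\<open>szego_rev_schur\<close>). Other starting values are needed because
  rotating the circle multiplies the start by a phase.\<close>

primrec schur_iter :: "complex \<Rightarrow> (nat \<Rightarrow> complex) \<Rightarrow> nat \<Rightarrow> complex \<Rightarrow> complex" where
  "schur_iter \<beta> a 0 z = \<beta>"
| "schur_iter \<beta> a (Suc n) z = (z * schur_iter \<beta> a n z - cnj (a n)) / (1 - a n * z * schur_iter \<beta> a n z)"

text \<open>Follows from |1 - a w|^2 - |w - cnj a|^2 = (1 - |a|^2) (1 - |w|^2).\<close>

lemma mobius_disc_le:
  fixes a w :: complex
  assumes "norm a \<le> 1" "norm w \<le> 1"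
  shows "norm (w - cnj a) \<le> norm (1 - a * w)"
proof (rule power2_le_imp_le)
  have "of_real ((norm (1 - a * w))\<^sup>2 - (norm (w - cnj a))\<^sup>2) = (of_real ((1 - (norm a)\<^sup>2) * (1 - (norm w)\<^sup>2)) :: complex)"
    unfolding of_real_diff of_real_mult complex_norm_square of_real_1 by (simp add: algebra_simps)
  hence "(norm (1 - a * w))\<^sup>2 - (norm (w - cnj a))\<^sup>2 = (1 - (norm a)\<^sup>2) * (1 - (norm w)\<^sup>2)"
    by (simp only: of_real_eq_iff)
  moreover have "(1 - (norm a)\<^sup>2) * (1 - (norm w)\<^sup>2) \<ge> 0"
    using assms by (intro mult_nonneg_nonneg) (auto simp: power_le_one)
  ultimately show "(norm (w - cnj a))\<^sup>2 \<le> (norm (1 - a * w))\<^sup>2" by linarith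
qed auto

lemma schur_iter_le_1:
  assumes a: "\<And>n. norm (a n) < 1" and "norm \<beta> \<le> 1" and z: "norm z \<le> 1"
  shows "norm (schur_iter \<beta> a n z) \<le> 1"
proof (induction n)
  case (Suc n)
  define w where "w = z * schur_iter \<beta> a n z"
  have w: "norm w \<le> 1" using Suc z by (simp add: w_def norm_mult mult_le_one)
  have "norm (schur_iter \<beta> a (Suc n) z) = norm (w - cnj (a n)) / norm (1 - a n * w)"
    by (simp add: w_def norm_divide mult.assoc)
  also have "\<dots> \<le> 1" using mobius_disc_le[of "a n" w] a[of n] w by (auto simp: divide_le_eq_1)
  finally show ?case .
qed (use assms in simp)

lemma schur_iter_less_1:
  assumes a: "\<And>n. norm (a n) < 1" and "norm \<beta> \<le> 1" and z: "norm z \<le> 1"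
  shows "norm (a n * z * schur_iter \<beta> a n z) < 1"
proof -
  have "norm (a n * z * schur_iter \<beta> a n z) \<le> norm (a n) * 1 * 1"
    unfolding norm_mult using schur_iter_le_1[where a=a, OF assms] z by (intro mult_mono) auto
  thus ?thesis using a[of n] by simp
qed

lemma schur_iter_denom:
  assumes "\<And>n. norm (a n) < 1" and "norm \<beta> \<le> 1" and "norm z \<le> 1"
  shows "1 - a n * z * schur_iter \<beta> a n z \<noteq> 0"
  using schur_iter_less_1[where a=a, OF assms, of n] by auto

lemma continuous_on_schur_iter:
  assumes "\<And>n. norm (a n) < 1" and "norm \<beta> \<le> 1"
  shows "continuous_on (cball 0 1) (schur_iter \<beta> a n)"
proof (induction n)
  case (Suc n)
  show ?case unfolding schur_iter.simps
    by (intro continuous_intros Suc) (use schur_iter_denom[where a=a, OF assms] in auto)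
qed auto

lemma holomorphic_on_schur_iter:
  assumes "\<And>n. norm (a n) < 1" and "norm \<beta> \<le> 1"
  shows "schur_iter \<beta> a n holomorphic_on ball 0 1"
proof (induction n)
  case (Suc n)
  show ?case unfolding schur_iter.simps
    by (intro holomorphic_intros Suc) (use schur_iter_denom[where a=a, OF assms] in auto)
qed auto

lemma weighted_log_sum_bounded:
  fixes a :: "nat \<Rightarrow> complex" and m :: nat and \<phi> :: real
  assumes a: "\<And>n. norm (a n) < 1" and \<beta>: "norm \<beta> \<le> 1" and m: "1 \<le> m"
    and lp: "summable (\<lambda>n. norm (a n) ^ (2*m+2))"
    and l2: "summable (\<lambda>n. norm ((fdiff ^^ m) a n) ^ 2)"
  shows "\<exists>C. \<forall>N. \<bar>2 * integral {0..2*pi} (\<lambda>t. (1 - cos (t - \<phi>)) ^ m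
        * Re (\<Sum>n<N. Ln (1 - a n * circ \<phi> 1 t * schur_iter \<beta> a n (circ \<phi> 1 t))))
    - integral {0..2*pi} (\<lambda>t. (1 - cos (t - \<phi>)) ^ m) * (\<Sum>n<N. ln (1 - (norm (a n))\<^sup>2))\<bar> \<le> C"
proof -
  obtain s C where s: "\<And>n. 0 < s n" "\<And>n. s n \<le> 1" "summable (\<lambda>n. s n ^ (2*m+2))"
    "\<And>n. 3 * s n ^ (2*m+2) \<le> 4 * s (Suc n) ^ (2*m+2)"
    "\<And>n. 3 * s (Suc n) ^ (2*m+2) \<le> 4 * s n ^ (2*m+2)"
    "\<And>n j. j \<le> m \<Longrightarrow> norm ((fdiff ^^ j) a n) \<le> C * s n ^ (j+1)"
    using scale_sequence_exists[where a=a and m=m, OF less_imp_le[OF a] lp l2] by metis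
  interpret scale_sequence s
  proof
    fix n
    show "0 \<le> s n" "s n \<le> 1" using s(1,2)[of n] by auto
    \<comment> \<open>Slow variation was obtained for the power 2m + 2. It passes to
      \<open>s\<close> itself because (4/3)^(2m+2) >= 4/3.\<close>
    show "3 * s (Suc n) \<le> 4 * s n"
    proof (rule ccontr)
      assume "\<not> 3 * s (Suc n) \<le> 4 * s n"
      hence "4/3 * s n < s (Suc n)" by simp
      hence "(4/3 * s n) ^ (2*m+2) < s (Suc n) ^ (2*m+2)" using s(1)[of n] by (intro power_strict_mono) auto
      moreover have "(4/3 * s n) ^ (2*m+2) \<ge> 4/3 * s n ^ (2*m+2)"
      proof -
        have "(4/3 :: real) ^ 1 \<le> (4/3) ^ (2*m+2)" by (intro power_increasing) auto
        thus ?thesis unfolding power_mult_distrib using s(1)[of n] by (intro mult_right_mono) auto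
      qed
      ultimately show False using s(5)[of n] by linarith
    qed
  qed
  interpret schur_iterates s m a "schur_iter \<beta> a"
  proof
    show "smooth 1 m a" unfolding smooth_def bigo_def
      using s(6) by (auto simp: add.commute intro!: exI[of _ C])
    show "schur_iter \<beta> a (Suc n) z * (1 - a n * z * schur_iter \<beta> a n z) = z * schur_iter \<beta> a n z - cnj (a n)"
      if "norm z \<le> 1" for n z
      using schur_iter_denom[where a=a, OF a \<beta> that, of n] by simp
  qed (use s m a schur_iter_le_1[where a=a, OF a \<beta>] in auto)
  show ?thesis
    by (rule szego_weight_log_sum_bounded[OF continuous_on_schur_iter[where a=a, OF a \<beta>] holomorphic_on_schur_iter[where a=a, OF a \<beta>]])
qed

section \<open>Szego recursion and Bernstein--Szego measures\<close>

text \<open>The reversed polynomial is carried as a second component with its own recursion;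
  \<open>szego_rev_on_circle\<close> shows that it really is the reversal.\<close>

primrec szego_pair :: "(nat \<Rightarrow> complex) \<Rightarrow> nat \<Rightarrow> complex poly \<times> complex poly" where
  "szego_pair \<alpha> 0 = (1, 1)"
| "szego_pair \<alpha> (Suc n) =
    (pCons 0 (fst (szego_pair \<alpha> n)) - smult (cnj (\<alpha> n)) (snd (szego_pair \<alpha> n)),
     snd (szego_pair \<alpha> n) - smult (\<alpha> n) (pCons 0 (fst (szego_pair \<alpha> n))))"

definition szego_poly :: "(nat \<Rightarrow> complex) \<Rightarrow> nat \<Rightarrow> complex poly" where
  "szego_poly \<alpha> n = fst (szego_pair \<alpha> n)"

definition szego_rev :: "(nat \<Rightarrow> complex) \<Rightarrow> nat \<Rightarrow> complex poly" where
  "szego_rev \<alpha> n = snd (szego_pair \<alpha> n)"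

lemma szego_0: "szego_poly \<alpha> 0 = 1" "szego_rev \<alpha> 0 = 1"
  by (simp_all add: szego_poly_def szego_rev_def)

lemma szego_Suc:
  "szego_poly \<alpha> (Suc n) = pCons 0 (szego_poly \<alpha> n) - smult (cnj (\<alpha> n)) (szego_rev \<alpha> n)"
  "szego_rev \<alpha> (Suc n) = szego_rev \<alpha> n - smult (\<alpha> n) (pCons 0 (szego_poly \<alpha> n))"
  by (simp_all add: szego_poly_def szego_rev_def)

lemma szego_degrees:
  "degree (szego_poly \<alpha> n) = n \<and> coeff (szego_poly \<alpha> n) n = 1 \<and> degree (szego_rev \<alpha> n) \<le> n"
proof (induction n)
  case (Suc n)
  let ?P = "szego_poly \<alpha> n" and ?Q = "szego_rev \<alpha> n"
  have P0: "?P \<noteq> 0" using Suc by auto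
  have "degree (pCons 0 ?P) = Suc n" using Suc P0 by simp
  moreover have "degree (smult (cnj (\<alpha> n)) ?Q) \<le> n"
    using Suc degree_smult_le[of "cnj (\<alpha> n)" ?Q] by linarith
  ultimately have "degree (szego_poly \<alpha> (Suc n)) = Suc n"
    unfolding szego_Suc diff_conv_add_uminus by (subst degree_add_eq_left) auto
  moreover have "coeff (szego_poly \<alpha> (Suc n)) (Suc n) = 1"
    unfolding szego_Suc using Suc by (simp add: coeff_eq_0)
  moreover have "degree (szego_rev \<alpha> (Suc n)) \<le> Suc n"
    unfolding szego_Suc using Suc P0
    by (intro degree_diff_le order_trans[OF degree_smult_le]) auto
  ultimately show ?case by blast
qed (simp add: szego_0)

lemma szego_rev_at_0: "poly (szego_rev \<alpha> n) 0 = 1"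
  by (induction n) (simp_all add: szego_0 szego_Suc)

lemma szego_rev_on_circle:
  assumes z: "norm z = 1"
  shows "poly (szego_rev \<alpha> n) z = z ^ n * cnj (poly (szego_poly \<alpha> n) z)"
proof (induction n)
  case (Suc n)
  have zz: "z * cnj z = 1" using z complex_norm_square[of z] by simp
  hence zn: "z ^ n * cnj z ^ n = 1" by (simp add: power_mult_distrib[symmetric])
  let ?p = "poly (szego_poly \<alpha> n) z"
  have "poly (szego_rev \<alpha> (Suc n)) z = z ^ n * cnj ?p - \<alpha> n * (z * ?p)"
    by (simp add: szego_Suc Suc)
  also have "\<dots> = z ^ n * cnj ?p * (z * cnj z) - \<alpha> n * (z * ?p) * (z ^ n * cnj z ^ n)"
    by (simp add: zz zn)
  also have "\<dots> = z ^ Suc n * cnj (poly (szego_poly \<alpha> (Suc n)) z)"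
    by (simp add: szego_Suc Suc algebra_simps)
  finally show ?case .
qed (simp add: szego_0)

text \<open>The claims are proved together: the quotient form exposes the new factor of the reverse,
  and this factor does not vanish because the iterates stay in the closed unit disc.\<close>

lemma szego_rev_schur:
  assumes \<alpha>: "\<And>n. norm (\<alpha> n) < 1" and z: "norm z \<le> 1"
  shows "poly (szego_rev \<alpha> n) z \<noteq> 0" (is ?A)
    and "poly (szego_poly \<alpha> n) z = schur_iter 1 \<alpha> n z * poly (szego_rev \<alpha> n) z" (is ?B)
    and "poly (szego_rev \<alpha> n) z = (\<Prod>k<n. 1 - \<alpha> k * z * schur_iter 1 \<alpha> k z)" (is ?C)
proof -
  have "?A \<and> ?B \<and> ?C"
  proof (induction n)
    case (Suc n)
    let ?b = "schur_iter 1 \<alpha> n z"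
    have d: "1 - \<alpha> n * z * ?b \<noteq> 0" by (rule schur_iter_denom[where a=\<alpha>, OF \<alpha> _ z]) simp
    have 1: "poly (szego_rev \<alpha> (Suc n)) z = poly (szego_rev \<alpha> n) z * (1 - \<alpha> n * z * ?b)"
      using Suc by (simp add: szego_Suc algebra_simps)
    have "poly (szego_poly \<alpha> (Suc n)) z = poly (szego_rev \<alpha> n) z * (z * ?b - cnj (\<alpha> n))"
      using Suc by (simp add: szego_Suc algebra_simps)
    also have "\<dots> = schur_iter 1 \<alpha> (Suc n) z * poly (szego_rev \<alpha> (Suc n)) z"
      unfolding 1 using d by simp
    finally have 2: "poly (szego_poly \<alpha> (Suc n)) z = schur_iter 1 \<alpha> (Suc n) z * poly (szego_rev \<alpha> (Suc n)) z" .
    have "poly (szego_rev \<alpha> (Suc n)) z \<noteq> 0" unfolding 1 mult_eq_0_iff using Suc d by blast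
    moreover have "poly (szego_rev \<alpha> (Suc n)) z = (\<Prod>k<Suc n. 1 - \<alpha> k * z * schur_iter 1 \<alpha> k z)"
      unfolding 1 prod.lessThan_Suc using Suc by simp
    ultimately show ?case using 2 by blast
  qed (simp add: szego_0)
  thus ?A ?B ?C by auto
qed

lemma circle_mean_value:
  fixes h :: "complex \<Rightarrow> complex"
  assumes cont: "continuous_on (cball 0 1) h" and holo: "h holomorphic_on ball 0 1"
  shows "((\<lambda>t. h (cis t)) has_integral (2 * pi * h 0)) {0..2*pi}"
proof -
  have "((\<lambda>w. h w / (w - 0) ^ Suc 0) has_contour_integral ((2 * pi * \<i>) / fact 0 * (deriv ^^ 0) h 0)) (circlepath 0 1)"
    by (rule Cauchy_has_contour_integral_higher_derivative_circlepath[OF cont holo]) auto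
  hence "((\<lambda>t. h (cis t) / cis t * \<i> * cis t) has_integral (2 * pi * \<i> * h 0)) {0..2*pi}"
    unfolding circlepath_def by (subst (asm) has_contour_integral_part_circlepath_iff) (auto simp: mult_ac)
  hence "((\<lambda>t. \<i> * h (cis t)) has_integral (\<i> * (2 * pi * h 0))) {0..2*pi}"
    by (simp add: mult_ac)
  from has_integral_mult_right[OF this, of "-\<i>"] show ?thesis by (simp add: mult.assoc[symmetric])
qed

text \<open>On the unit circle this is 1 / |\<phi>_N|^2, the density of the Bernstein--Szego measure
  with respect to dt / (2 \<pi>): the numerator is the squared norming constant of the monic
  polynomial, and the reverse has the same modulus there.\<close>

definition bernstein_szego :: "(nat \<Rightarrow> complex) \<Rightarrow> nat \<Rightarrow> complex \<Rightarrow> real" where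
  "bernstein_szego \<alpha> N z = (\<Prod>n<N. 1 - (norm (\<alpha> n))\<^sup>2) / (norm (poly (szego_rev \<alpha> N) z))\<^sup>2"

definition bs_moment :: "(nat \<Rightarrow> complex) \<Rightarrow> nat \<Rightarrow> nat \<Rightarrow> complex" where
  "bs_moment \<alpha> N k = integral {0..2*pi} (\<lambda>t. of_real (bernstein_szego \<alpha> N (cis t)) * cis t ^ k)"

context
  fixes \<alpha> :: "nat \<Rightarrow> complex"
  assumes \<alpha>: "\<And>n. norm (\<alpha> n) < 1"
begin

lemma szego_factor_pos: "0 < 1 - (norm (\<alpha> n))\<^sup>2"
  using \<alpha>[of n] by (simp add: power_less_one_iff)

lemma bernstein_szego_pos: "norm z \<le> 1 \<Longrightarrow> 0 < bernstein_szego \<alpha> N z"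
  unfolding bernstein_szego_def using szego_factor_pos szego_rev_schur(1)[where \<alpha>=\<alpha>, OF \<alpha>]
  by (intro divide_pos_pos prod_pos) auto

lemma continuous_on_bernstein_szego: "continuous_on S (\<lambda>t. bernstein_szego \<alpha> N (cis t))"
  unfolding bernstein_szego_def using szego_rev_schur(1)[where \<alpha>=\<alpha>, OF \<alpha>]
  by (intro continuous_intros) auto

text \<open>The step from N to N + 1 multiplies the density by (1 - |\<omega>|^2) / |1 - \<omega>|^2
  = 1 + 2 Re (\<omega> / (1 - \<omega>)), where \<omega> = \<alpha>_N z b_N. The term so added to
  the density is, on the circle, twice the real part of a function analytic in the disc that
  vanishes at 0 to order at least N + 1; moments up to order N do not see it.\<close>

lemma bs_moment_Suc:
  assumes k: "k \<le> N"
  shows "bs_moment \<alpha> (Suc N) k = bs_moment \<alpha> N k"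
proof -
  define \<kappa> where "\<kappa> = (\<Prod>n<N. 1 - (norm (\<alpha> n))\<^sup>2)"
  define Q where "Q = poly (szego_rev \<alpha> N)"
  define Q' where "Q' = poly (szego_rev \<alpha> (Suc N))"
  \<comment> \<open>If F denotes that analytic function, \<open>h (2 * k)\<close> is F z^k and
    \<open>h 0\<close> is F z^(-k). Since k <= N, the exponent Suc N - k is positive and both vanish
    at 0.\<close>
  define h :: "nat \<Rightarrow> complex \<Rightarrow> complex" where "h j z = \<kappa> * \<alpha> N * z ^ (Suc N - k + j) / (Q z * Q' z)" for j z
  have Q0: "Q z \<noteq> 0" "Q' z \<noteq> 0" if "norm z \<le> 1" for z
    unfolding Q_def Q'_def using szego_rev_schur(1)[where \<alpha>=\<alpha>, OF \<alpha> that] by auto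
  have hc: "continuous_on (cball 0 1) (h j)" for j
    unfolding h_def using Q0 by (intro continuous_intros) (auto simp: Q_def Q'_def intro!: continuous_intros)
  have hh: "h j holomorphic_on ball 0 1" for j
    unfolding h_def using Q0 by (intro holomorphic_intros) (auto simp: Q_def Q'_def intro!: holomorphic_intros)
  have h0: "h j 0 = 0" for j using k by (simp add: h_def)
  have I1: "((\<lambda>t. h (2 * k) (cis t)) has_integral 0) {0..2*pi}"
    using circle_mean_value[OF hc hh, of "2 * k"] by (simp add: h0)
  have "((\<lambda>t. h 0 (cis t)) has_integral 0) {0..2*pi}"
    using circle_mean_value[OF hc hh, of 0] by (simp add: h0)
  hence I2: "((\<lambda>t. cnj (h 0 (cis t))) has_integral 0) {0..2*pi}"
    using has_integral_cnj[of "\<lambda>t. h 0 (cis t)" 0] by (simp add: o_def)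
  have eq: "of_real (bernstein_szego \<alpha> (Suc N) z) * z ^ k = of_real (bernstein_szego \<alpha> N z) * z ^ k + (h (2 * k) z + cnj (h 0 z))"
    if z: "norm z = 1" for z
  proof -
    define b where "b = schur_iter 1 \<alpha> N z"
    define \<omega> where "\<omega> = \<alpha> N * z * b"
    define q where "q = Q z"
    define p where "p = poly (szego_poly \<alpha> N) z"
    have z1: "norm z \<le> 1" using z by simp
    have zc: "z * cnj z = 1" using z complex_norm_square[of z] by simp
    have q0: "q \<noteq> 0" using Q0(1)[OF z1] by (simp add: q_def)
    have qp: "q = z ^ N * cnj p" unfolding q_def Q_def p_def by (rule szego_rev_on_circle[OF z])
    hence p0: "p \<noteq> 0" using q0 by auto
    have pb: "p = b * q" unfolding p_def b_def q_def Q_def by (rule szego_rev_schur(2)[where \<alpha>=\<alpha>, OF \<alpha> z1])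
    have bb: "b * cnj b = 1"
    proof -
      have "norm q = norm p" unfolding qp by (simp add: norm_mult norm_power z)
      hence "norm b = 1" using pb q0 by (simp add: norm_mult)
      thus ?thesis using complex_norm_square[of b] by simp
    qed
    have w1: "1 - \<omega> \<noteq> 0" unfolding \<omega>_def b_def by (rule schur_iter_denom[where a=\<alpha>, OF \<alpha> _ z1]) simp
    hence w2: "1 - cnj \<omega> \<noteq> 0" by (metis complex_cnj_cancel_iff complex_cnj_diff complex_cnj_one complex_cnj_zero)
    have Q': "Q' z = q * (1 - \<omega>)"
      unfolding Q'_def szego_Suc using pb by (simp add: p_def q_def Q_def \<omega>_def algebra_simps)
    have ww: "\<omega> * cnj \<omega> = \<alpha> N * cnj (\<alpha> N)"
      unfolding \<omega>_def using zc bb by (simp add: mult_ac) (metis (no_types, lifting) mult.assoc mult.commute mult.right_neutral)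
    have BN: "of_real (bernstein_szego \<alpha> N z) = \<kappa> / (q * cnj q)"
      by (simp only: bernstein_szego_def \<kappa>_def q_def Q_def of_real_divide complex_norm_square)
    have "of_real (bernstein_szego \<alpha> (Suc N) z) = \<kappa> * (1 - \<alpha> N * cnj (\<alpha> N)) / (Q' z * cnj (Q' z))"
      by (simp only: bernstein_szego_def \<kappa>_def Q'_def of_real_divide complex_norm_square prod.lessThan_Suc of_real_mult of_real_diff of_real_1)
    also have "\<dots> = \<kappa> / (q * cnj q) * ((1 - \<omega> * cnj \<omega>) / ((1 - \<omega>) * (1 - cnj \<omega>)))"
      unfolding Q' ww by simp
    also have "(1 - \<omega> * cnj \<omega>) / ((1 - \<omega>) * (1 - cnj \<omega>)) = 1 + (\<omega> / (1 - \<omega>) + cnj (\<omega> / (1 - \<omega>)))"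
      using w1 w2 by (simp add: divide_simps) (simp add: algebra_simps)
    finally have BS: "of_real (bernstein_szego \<alpha> (Suc N) z) = \<kappa> / (q * cnj q) + (\<kappa> / (q * cnj q) * (\<omega> / (1 - \<omega>)) + \<kappa> / (q * cnj q) * cnj (\<omega> / (1 - \<omega>)))"
      by (simp add: algebra_simps)
    define F where "F = \<kappa> / (q * cnj q) * (\<omega> / (1 - \<omega>))"
    have F: "F = \<kappa> * \<alpha> N * z ^ Suc N / (q * Q' z)"
    proof -
      have cq: "cnj q * z ^ N = p"
      proof -
        have "cnj q * z ^ N = (z * cnj z) ^ N * p" unfolding qp by (simp add: power_mult_distrib mult_ac)
        thus ?thesis by (simp add: zc)
      qed
      have cq0: "cnj q \<noteq> 0" using q0 by simp
      have "\<omega> * q = \<alpha> N * z * p" by (simp add: \<omega>_def pb)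
      also have "\<dots> = \<alpha> N * z ^ Suc N * cnj q" by (simp add: cq[symmetric])
      finally have wq: "\<omega> * q = \<alpha> N * z ^ Suc N * cnj q" .
      have "F = \<kappa> * (\<omega> * q) / (q * cnj q * (q * (1 - \<omega>)))"
        using q0 by (simp add: F_def)
      thus ?thesis unfolding wq Q' using cq0 by simp
    qed
    have Fc: "cnj F = \<kappa> / (q * cnj q) * cnj (\<omega> / (1 - \<omega>))"
      by (simp add: F_def mult.commute)
    have hk: "h (2 * k) z = F * z ^ k"
    proof -
      have "Suc N - k + 2 * k = Suc N + k" using k by simp
      thus ?thesis unfolding h_def F q_def by (simp add: power_add)
    qed
    have h0: "cnj (h 0 z) = cnj F * z ^ k"
    proof -
      have "z ^ Suc N * cnj z ^ k = z ^ (Suc N - k) * (z * cnj z) ^ k"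
        using k by (simp add: power_mult_distrib mult.assoc[symmetric] power_add[symmetric])
      hence e: "z ^ (Suc N - k + 0) = z ^ Suc N * cnj z ^ k" by (simp only: zc power_one mult_1_right add_0_right)
      have "h 0 z = F * cnj z ^ k" unfolding h_def F q_def e by simp
      thus ?thesis by simp
    qed
    show ?thesis unfolding hk h0 BS BN Fc[symmetric] F_def[symmetric] by (simp add: algebra_simps)
  qed
  have c1: "(\<lambda>t. of_real (bernstein_szego \<alpha> N (cis t)) * cis t ^ k) integrable_on {0..2*pi}"
    by (intro integrable_continuous_interval continuous_intros continuous_on_bernstein_szego)
  have "((\<lambda>t. of_real (bernstein_szego \<alpha> N (cis t)) * cis t ^ k + (h (2 * k) (cis t) + cnj (h 0 (cis t)))) has_integral
     (bs_moment \<alpha> N k + (0 + 0))) {0..2*pi}"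
    unfolding bs_moment_def by (intro has_integral_add I1 I2 integrable_integral c1)
  hence "((\<lambda>t. of_real (bernstein_szego \<alpha> (Suc N) (cis t)) * cis t ^ k) has_integral bs_moment \<alpha> N k) {0..2*pi}"
    by (simp add: eq)
  thus ?thesis unfolding bs_moment_def[of \<alpha> "Suc N"] by (rule integral_unique)
qed

lemma bs_moment_stable:
  assumes "k \<le> N"
  shows "bs_moment \<alpha> N k = bs_moment \<alpha> k k"
  using assms by (induction N rule: dec_induct) (simp_all add: bs_moment_Suc)

text \<open>On the circle the monic polynomial times the density equals a constant times z^N divided
  by the reversed polynomial, which is analytic and vanishes at 0. As the polynomial is monic, the
  relation determines the N-th moment from the lower ones.\<close>

lemma bs_moment_szego:
  assumes N: "1 \<le> N"
  shows "(\<Sum>j\<le>N. coeff (szego_poly \<alpha> N) j * bs_moment \<alpha> N j) = 0"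
proof -
  define \<kappa> where "\<kappa> = (\<Prod>n<N. 1 - (norm (\<alpha> n))\<^sup>2)"
  define Q where "Q = poly (szego_rev \<alpha> N)"
  define h :: "complex \<Rightarrow> complex" where "h z = of_real \<kappa> * z ^ N / Q z" for z
  have Q0: "Q z \<noteq> 0" if "norm z \<le> 1" for z
    unfolding Q_def using szego_rev_schur(1)[where \<alpha>=\<alpha>, OF \<alpha> that] by auto
  have hc: "continuous_on (cball 0 1) h"
    unfolding h_def using Q0 by (intro continuous_intros) (auto simp: Q_def intro!: continuous_intros)
  have hh: "h holomorphic_on ball 0 1"
    unfolding h_def using Q0 by (intro holomorphic_intros) (auto simp: Q_def intro!: holomorphic_intros)
  have h0: "h 0 = 0" using N by (simp add: h_def)
  have I: "((\<lambda>t. h (cis t)) has_integral 0) {0..2*pi}"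
    using circle_mean_value[OF hc hh] by (simp add: h0)
  have eq: "(\<Sum>j\<le>N. coeff (szego_poly \<alpha> N) j * (of_real (bernstein_szego \<alpha> N z) * z ^ j)) = h z" if z: "norm z = 1" for z
  proof -
    define p where "p = poly (szego_poly \<alpha> N) z"
    have z1: "norm z \<le> 1" using z by simp
    have zc: "z * cnj z = 1" using z complex_norm_square[of z] by simp
    have qp: "Q z = z ^ N * cnj p" unfolding Q_def p_def by (rule szego_rev_on_circle[OF z])
    have p0: "p \<noteq> 0" using qp Q0[OF z1] by auto
    have cq: "cnj (Q z) * z ^ N = p"
    proof -
      have "cnj (Q z) * z ^ N = (z * cnj z) ^ N * p" unfolding qp by (simp add: power_mult_distrib mult_ac)
      thus ?thesis by (simp add: zc)
    qed
    have BN: "of_real (bernstein_szego \<alpha> N z) = \<kappa> / (Q z * cnj (Q z))"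
      by (simp only: bernstein_szego_def \<kappa>_def Q_def of_real_divide complex_norm_square)
    have "(\<Sum>j\<le>N. coeff (szego_poly \<alpha> N) j * (of_real (bernstein_szego \<alpha> N z) * z ^ j)) = of_real (bernstein_szego \<alpha> N z) * p"
      unfolding p_def using szego_degrees[of \<alpha> N] by (simp add: poly_eq_sum_le[of _ N] sum_distrib_left mult_ac)
    also have "\<dots> = \<kappa> * (cnj (Q z) * z ^ N) / (Q z * cnj (Q z))" unfolding BN cq by simp
    also have "\<dots> = h z" unfolding h_def using Q0[OF z1] by simp
    finally show ?thesis .
  qed
  have "((\<lambda>t. \<Sum>j\<le>N. coeff (szego_poly \<alpha> N) j * (of_real (bernstein_szego \<alpha> N (cis t)) * cis t ^ j)) has_integral
     (\<Sum>j\<le>N. coeff (szego_poly \<alpha> N) j * bs_moment \<alpha> N j)) {0..2*pi}"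
    unfolding bs_moment_def
    by (intro has_integral_sum has_integral_mult_right integrable_integral integrable_continuous_interval continuous_intros
        continuous_on_bernstein_szego) auto
  hence "((\<lambda>t. h (cis t)) has_integral (\<Sum>j\<le>N. coeff (szego_poly \<alpha> N) j * bs_moment \<alpha> N j)) {0..2*pi}"
    by (simp add: eq)
  from has_integral_unique[OF this I] show ?thesis .
qed

lemma ln_bernstein_szego:
  assumes z: "norm z \<le> 1"
  shows "- ln (bernstein_szego \<alpha> N z) = 2 * Re (\<Sum>n<N. Ln (1 - \<alpha> n * z * schur_iter 1 \<alpha> n z)) - (\<Sum>n<N. ln (1 - (norm (\<alpha> n))\<^sup>2))"
proof -
  have d: "1 - \<alpha> n * z * schur_iter 1 \<alpha> n z \<noteq> 0" for n
    by (rule schur_iter_denom[where a=\<alpha>, OF \<alpha> _ z]) simp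
  have "ln (norm (poly (szego_rev \<alpha> N) z)) = Re (\<Sum>n<N. Ln (1 - \<alpha> n * z * schur_iter 1 \<alpha> n z))"
    unfolding szego_rev_schur(3)[where \<alpha>=\<alpha>, OF \<alpha> z] prod_norm[symmetric]
    using d by (subst ln_prod) (auto simp: Re_Ln)
  moreover have "ln (\<Prod>n<N. 1 - (norm (\<alpha> n))\<^sup>2) = (\<Sum>n<N. ln (1 - (norm (\<alpha> n))\<^sup>2))"
    using szego_factor_pos by (subst ln_prod) (auto simp: less_imp_neq[THEN not_sym])
  moreover have "ln (bernstein_szego \<alpha> N z) = ln (\<Prod>n<N. 1 - (norm (\<alpha> n))\<^sup>2) - 2 * ln (norm (poly (szego_rev \<alpha> N) z))"
  proof -
    have "(\<Prod>n<N. 1 - (norm (\<alpha> n))\<^sup>2) > 0" using szego_factor_pos by (intro prod_pos) auto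
    moreover have "norm (poly (szego_rev \<alpha> N) z) > 0" using szego_rev_schur(1)[where \<alpha>=\<alpha>, OF \<alpha> z, of N] by simp
    moreover have "ln (x / y\<^sup>2) = ln x - 2 * ln y" if "x > 0" "y > 0" for x y :: real
      using that by (simp add: ln_div ln_realpow)
    ultimately show ?thesis unfolding bernstein_szego_def by blast
  qed
  ultimately show ?thesis by simp
qed

end

section \<open>Orthogonal polynomials and moments of the given measure\<close>

locale nontrivial_circle_measure =
  fixes \<mu> :: "complex measure"
  assumes nontrivial: "nontrivial_circle_prob \<mu>"
begin

lemma prob_space_mu: "prob_space \<mu>" and sets_mu: "sets \<mu> = sets borel"
  and off_circle: "emeasure \<mu> (UNIV - sphere 0 1) = 0" and infinite_support: "infinite (msupport \<mu>)"
  using nontrivial by (auto simp: nontrivial_circle_prob_def circle_prob_def)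

sublocale prob_space \<mu> by (rule prob_space_mu)

lemma AE_circle: "AE z in \<mu>. norm z = 1"
proof (rule AE_I)
  show "{z \<in> space \<mu>. norm z \<noteq> 1} \<subseteq> UNIV - sphere 0 1" by auto
  show "UNIV - sphere 0 1 \<in> sets \<mu>" by (simp add: sets_mu)
qed (rule off_circle)

lemma measurable_continuous: "continuous_on UNIV f \<Longrightarrow> f \<in> borel_measurable \<mu>"
  unfolding measurable_cong_sets[OF sets_mu refl] by (rule borel_measurable_continuous_onI)

lemma integrable_continuous:
  fixes f :: "complex \<Rightarrow> 'b::{banach, second_countable_topology}"
  assumes "continuous_on UNIV f"
  shows "integrable \<mu> f"
proof -
  have "compact (f ` sphere 0 1)"
    by (intro compact_continuous_image continuous_on_subset[OF assms]) auto
  hence "bounded (f ` sphere 0 1)" by (rule compact_imp_bounded)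
  then obtain B where "\<forall>x\<in>f ` sphere 0 1. norm x \<le> B" unfolding bounded_iff by blast
  hence B: "norm (f z) \<le> B" if "norm z = 1" for z using that by simp
  have "AE z in \<mu>. norm (f z) \<le> B" using AE_circle by eventually_elim (rule B)
  thus ?thesis by (rule integrable_const_bound) (rule measurable_continuous[OF assms])
qed

lemma integral_circle_cong:
  fixes f :: "complex \<Rightarrow> 'b::{banach, second_countable_topology}"
  assumes "continuous_on UNIV f" "continuous_on UNIV g" "\<And>z. norm z = 1 \<Longrightarrow> f z = g z"
  shows "(\<integral>z. f z \<partial>\<mu>) = (\<integral>z. g z \<partial>\<mu>)"
proof (rule integral_cong_AE)
  show "AE z in \<mu>. f z = g z" using AE_circle by eventually_elim (use assms in auto)
qed (intro measurable_continuous assms)+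

definition ip :: "complex poly \<Rightarrow> complex poly \<Rightarrow> complex" where
  "ip p q = (\<integral>z. poly p z * cnj (poly q z) \<partial>\<mu>)"

lemma integrable_ip: "integrable \<mu> (\<lambda>z. poly p z * cnj (poly q z))"
  by (intro integrable_continuous continuous_intros)

lemma ip_add: "ip (p + p') q = ip p q + ip p' q" "ip p (q + q') = ip p q + ip p q'"
  unfolding ip_def poly_add complex_cnj_add distrib_right distrib_left
  by (rule Bochner_Integration.integral_add[OF integrable_ip integrable_ip])+

lemma ip_diff: "ip (p - p') q = ip p q - ip p' q" "ip p (q - q') = ip p q - ip p q'"
  unfolding ip_def poly_diff complex_cnj_diff left_diff_distrib right_diff_distrib
  by (rule Bochner_Integration.integral_diff[OF integrable_ip integrable_ip])+

lemma ip_smult: "ip (smult c p) q = c * ip p q" "ip p (smult c q) = cnj c * ip p q"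
proof -
  show "ip (smult c p) q = c * ip p q"
    unfolding ip_def poly_smult mult.assoc by (rule integral_mult_right_zero)
  have "poly p z * cnj (poly (smult c q) z) = cnj c * (poly p z * cnj (poly q z))" for z by simp
  thus "ip p (smult c q) = cnj c * ip p q"
    unfolding ip_def by (simp only: integral_mult_right_zero)
qed

lemma ip_cnj: "ip q p = cnj (ip p q)"
  unfolding ip_def Bochner_Integration.integral_cnj[symmetric] by (simp add: mult.commute)

lemma ip_zero: "ip p 0 = 0"
  by (simp add: ip_def)

lemma ip_pCons: "ip (pCons 0 p) (pCons 0 q) = ip p q"
  unfolding ip_def
proof (rule integral_circle_cong)
  fix z :: complex assume "norm z = 1"
  hence "z * cnj z = 1" using complex_norm_square[of z] by simp
  moreover have "poly (pCons 0 p) z * cnj (poly (pCons 0 q) z) = (z * cnj z) * (poly p z * cnj (poly q z))"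
    by (simp add: mult_ac)
  ultimately show "poly (pCons 0 p) z * cnj (poly (pCons 0 q) z) = poly p z * cnj (poly q z)"
    by simp
qed (intro continuous_intros)+

lemma ip_sum_right: "ip p (\<Sum>i\<in>I. f i) = (\<Sum>i\<in>I. ip p (f i))"
  by (induction I rule: infinite_finite_induct) (simp_all add: ip_zero ip_add)

text \<open>Strict positivity is where the infinite support enters: a polynomial vanishing almost
  everywhere would confine the support to its finitely many roots.\<close>

lemma ip_pos:
  assumes "p \<noteq> 0"
  shows "ip p p = of_real (\<integral>z. (norm (poly p z))\<^sup>2 \<partial>\<mu>)" "(\<integral>z. (norm (poly p z))\<^sup>2 \<partial>\<mu>) > 0"
proof -
  show "ip p p = of_real (\<integral>z. (norm (poly p z))\<^sup>2 \<partial>\<mu>)"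
    unfolding ip_def complex_norm_square[symmetric] by (rule integral_complex_of_real)
  have int: "integrable \<mu> (\<lambda>z. (norm (poly p z))\<^sup>2)"
    by (intro integrable_continuous continuous_intros)
  have "(\<integral>z. (norm (poly p z))\<^sup>2 \<partial>\<mu>) \<noteq> 0"
  proof
    assume "(\<integral>z. (norm (poly p z))\<^sup>2 \<partial>\<mu>) = 0"
    hence "AE z in \<mu>. (norm (poly p z))\<^sup>2 = 0"
      using integral_nonneg_eq_0_iff_AE[OF int] by simp
    hence AE: "AE z in \<mu>. poly p z = 0" by simp
    define Z where "Z = {z. poly p z = 0}"
    have fin: "finite Z" unfolding Z_def by (rule poly_roots_finite[OF assms])
    hence cl: "closed Z" by (rule finite_imp_closed)
    have Zs: "- Z \<in> sets \<mu>" using cl by (simp add: sets_mu borel_open open_Compl)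
    have null: "emeasure \<mu> (- Z) = 0"
      using AE Zs by (subst (asm) AE_iff_measurable[OF _ refl]) (auto simp: Z_def sets_mu sets_eq_imp_space_eq[OF sets_mu] Compl_eq)
    have "msupport \<mu> \<subseteq> Z"
    proof
      fix z assume z: "z \<in> msupport \<mu>"
      show "z \<in> Z"
      proof (rule ccontr)
        assume "z \<notin> Z"
        hence "z \<in> - Z" "open (- Z)" using cl by (auto simp: open_Compl)
        then obtain e where e: "e > 0" "ball z e \<subseteq> - Z" by (meson openE)
        have "emeasure \<mu> (ball z e) \<le> emeasure \<mu> (- Z)" by (rule emeasure_mono[OF e(2) Zs])
        thus False using z e null by (auto simp: msupport_def)
      qed
    qed
    thus False using fin infinite_support finite_subset by blast
  qed
  moreover have "(\<integral>z. (norm (poly p z))\<^sup>2 \<partial>\<mu>) \<ge> 0" by (rule integral_nonneg_AE) simp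
  ultimately show "(\<integral>z. (norm (poly p z))\<^sup>2 \<partial>\<mu>) > 0" by linarith
qed

lemma ip_self_eq_0: "ip p p = 0 \<Longrightarrow> p = 0"
  using ip_pos[of p] by auto

lemma is_monic_OP_ip: "is_monic_OP \<mu> n p \<longleftrightarrow> degree p = n \<and> lead_coeff p = 1 \<and> (\<forall>k<n. ip p (monom 1 k) = 0)"
  by (simp add: is_monic_OP_def ip_def poly_monom)

lemma OP_orthogonal:
  assumes p: "is_monic_OP \<mu> n p" and q: "q = 0 \<or> degree q < n"
  shows "ip p q = 0"
proof -
  have "ip p (monom c k) = 0" if "k < n" for c k
    using p that ip_smult(2)[of p c "monom 1 k"] by (simp add: is_monic_OP_ip smult_monom)
  hence "ip p (monom (coeff q i) i) = 0" if "i \<le> degree q" for i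
    using q that by (cases "q = 0") (auto simp: ip_zero)
  hence "ip p (\<Sum>i\<le>degree q. monom (coeff q i) i) = 0" unfolding ip_sum_right by simp
  thus ?thesis by (simp add: poly_as_sum_of_monoms)
qed

lemma monic_diff_degree:
  fixes p q :: "complex poly"
  assumes "degree p = n" "lead_coeff p = 1" "degree q = n" "lead_coeff q = 1"
  shows "p - q = 0 \<or> degree (p - q) < n"
proof (rule ccontr)
  assume "\<not> ?thesis"
  hence ne: "p - q \<noteq> 0" and "degree (p - q) \<ge> n" by auto
  moreover have "degree (p - q) \<le> n" using assms by (intro degree_diff_le) auto
  ultimately have "degree (p - q) = n" by simp
  hence "lead_coeff (p - q) = 0" using assms by simp
  thus False using ne leading_coeff_neq_0 by blast
qed

lemma OP_unique:
  assumes "is_monic_OP \<mu> n p" "is_monic_OP \<mu> n q"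
  shows "p = q"
proof -
  have "p - q = 0 \<or> degree (p - q) < n"
    using assms by (intro monic_diff_degree) (auto simp: is_monic_OP_def)
  hence "ip p (p - q) = 0" "ip q (p - q) = 0" using assms by (auto intro: OP_orthogonal)
  hence "ip (p - q) (p - q) = 0" by (simp add: ip_diff(1))
  thus ?thesis using ip_self_eq_0[of "p - q"] by simp
qed

lemma monic_OP_eq: "is_monic_OP \<mu> n p \<Longrightarrow> monic_OP \<mu> n = p"
  unfolding monic_OP_def using OP_unique by (intro the_equality) auto

abbreviation "\<alpha> \<equiv> verblunsky \<mu>"
abbreviation "\<Phi> \<equiv> szego_poly \<alpha>"
abbreviation "\<Phi>r \<equiv> szego_rev \<alpha>"

lemma ip_rev:
  assumes "k \<le> n"
  shows "ip (\<Phi>r n) (monom 1 k) = cnj (ip (\<Phi> n) (monom 1 (n - k)))"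
  unfolding ip_def Bochner_Integration.integral_cnj[symmetric]
proof (rule integral_circle_cong)
  fix z :: complex assume z: "norm z = 1"
  have zc: "z * cnj z = 1" using z complex_norm_square[of z] by simp
  have "z ^ n * cnj z ^ k = z ^ (n - k) * (z * cnj z) ^ k"
    using assms by (simp add: power_mult_distrib mult.assoc[symmetric] power_add[symmetric])
  hence "z ^ n * cnj z ^ k = z ^ (n - k)" by (simp add: zc)
  thus "poly (\<Phi>r n) z * cnj (poly (monom 1 k) z) = cnj (poly (\<Phi> n) z * cnj (poly (monom 1 (n - k)) z))"
    unfolding szego_rev_on_circle[OF z] by (simp add: poly_monom mult_ac)
qed (intro continuous_intros)+

lemma ip_rev_rev: "ip (\<Phi>r n) (\<Phi>r n) = ip (\<Phi> n) (\<Phi> n)"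
  unfolding ip_def
proof (rule integral_circle_cong)
  fix z :: complex assume z: "norm z = 1"
  have "(norm (poly (\<Phi>r n) z))\<^sup>2 = (norm (poly (\<Phi> n) z))\<^sup>2"
    unfolding szego_rev_on_circle[OF z] by (simp add: norm_mult norm_power z)
  thus "poly (\<Phi>r n) z * cnj (poly (\<Phi>r n) z) = poly (\<Phi> n) z * cnj (poly (\<Phi> n) z)"
    by (simp only: complex_norm_square[symmetric])
qed (intro continuous_intros)+

text \<open>Both z \<Phi>_n and the reversed polynomial are orthogonal to z, ..., z^n, so one
  constant c suffices to restore orthogonality to 1. By uniqueness the result is the monic
  orthogonal polynomial, and its value -c at 0 identifies c with the conjugate of
  \<alpha>_n.\<close>

lemma szego_OP_step:
  assumes OP: "is_monic_OP \<mu> n (\<Phi> n)"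
  shows "is_monic_OP \<mu> (Suc n) (\<Phi> (Suc n))"
proof -
  let ?P = "\<Phi> n" and ?Q = "\<Phi>r n"
  have deg: "degree ?P = n" "coeff ?P n = 1" "degree ?Q \<le> n" using szego_degrees by auto
  have P0: "?P \<noteq> 0" using deg by auto
  have "?P - monom 1 n = 0 \<or> degree (?P - monom 1 n) < n"
    using deg by (intro monic_diff_degree) (auto simp: degree_monom_eq)
  hence "ip ?P (?P - monom 1 n) = 0" using OP by (rule OP_orthogonal[rotated])
  hence Pn: "ip ?P (monom 1 n) = ip ?P ?P" by (simp add: ip_diff)
  have "ip ?Q (monom 1 0) = cnj (ip ?P ?P)" using ip_rev[of 0 n] by (simp add: Pn)
  hence Q1: "ip ?Q (monom 1 0) = ip ?P ?P" using ip_cnj[of ?P ?P] by simp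
  have nz: "ip ?P ?P \<noteq> 0" using P0 ip_self_eq_0 by blast
  define c where "c = ip (pCons 0 ?P) (monom 1 0) / ip ?P ?P"
  define P' where "P' = pCons 0 ?P - smult c ?Q"
  have "is_monic_OP \<mu> (Suc n) P'"
    unfolding is_monic_OP_ip
  proof (intro conjI allI impI)
    have dP: "degree (pCons 0 ?P) = Suc n" using deg P0 by simp
    have dQ: "degree (smult c ?Q) \<le> n" using deg degree_smult_le[of c ?Q] by linarith
    show d: "degree P' = Suc n"
      unfolding P'_def diff_conv_add_uminus using dP dQ by (subst degree_add_eq_left) auto
    show "lead_coeff P' = 1" unfolding d unfolding P'_def using deg by (simp add: coeff_eq_0)
    fix k assume k: "k < Suc n"
    show "ip P' (monom 1 k) = 0"
    proof (cases k)
      case 0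
      thus ?thesis using nz unfolding P'_def ip_diff ip_smult 0 Q1 by (simp add: c_def)
    next
      case (Suc j)
      have "ip (pCons 0 ?P) (monom 1 k) = ip ?P (monom 1 j)"
        using ip_pCons[of ?P "monom 1 j"] by (simp add: Suc monom_Suc)
      also have "\<dots> = 0" using OP k Suc by (auto simp: is_monic_OP_ip)
      finally have 1: "ip (pCons 0 ?P) (monom 1 k) = 0" .
      have "ip ?Q (monom 1 k) = cnj (ip ?P (monom 1 (n - k)))" using k by (intro ip_rev) auto
      also have "\<dots> = 0" using OP k Suc by (auto simp: is_monic_OP_ip)
      finally show ?thesis unfolding P'_def ip_diff ip_smult by (simp add: 1)
    qed
  qed
  moreover from monic_OP_eq[OF this] have "\<alpha> n = cnj c"
    unfolding verblunsky_def by (simp add: P'_def szego_rev_at_0)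
  hence "\<Phi> (Suc n) = P'" by (simp add: szego_Suc P'_def)
  ultimately show ?thesis by simp
qed

lemma szego_OP: "is_monic_OP \<mu> n (\<Phi> n)"
proof (induction n)
  case 0
  show ?case by (simp add: is_monic_OP_def szego_0)
qed (rule szego_OP_step)

text \<open>Orthogonality of \<Phi>_(n+1) to the reverse of \<Phi>_n makes 1 - |\<alpha>_n|^2 the
  ratio of the squared norms of \<Phi>_(n+1) and \<Phi>_n, both of which are positive.\<close>

lemma verblunsky_less_1: "norm (\<alpha> n) < 1"
proof -
  let ?P = "\<Phi> n" and ?Q = "\<Phi>r n" and ?P' = "\<Phi> (Suc n)"
  have deg: "degree ?P = n" "coeff ?P n = 1" "degree ?Q \<le> n" using szego_degrees by auto
  have P0: "?P \<noteq> 0" "?P' \<noteq> 0" using deg szego_degrees[of \<alpha> "Suc n"] by auto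
  have zP: "pCons 0 ?P = ?P' + smult (cnj (\<alpha> n)) ?Q" by (simp add: szego_Suc)
  have P'Q: "ip ?P' ?Q = 0" using deg by (intro OP_orthogonal[OF szego_OP]) auto
  have "ip ?Q (pCons 0 ?P) = cnj (ip (pCons 0 ?P) ?Q)" by (rule ip_cnj)
  also have "\<dots> = \<alpha> n * cnj (ip ?Q ?Q)" unfolding zP ip_add ip_smult by (simp add: P'Q)
  also have "cnj (ip ?Q ?Q) = ip ?P ?P" using ip_cnj[of ?Q ?Q] ip_rev_rev[of n] by simp
  finally have QzP: "ip ?Q (pCons 0 ?P) = \<alpha> n * ip ?P ?P" .
  have "ip ?P' ?P' = ip ?P' (pCons 0 ?P)" unfolding zP ip_add ip_smult by (simp add: P'Q)
  also have "\<dots> = ip (pCons 0 ?P) (pCons 0 ?P) - cnj (\<alpha> n) * ip ?Q (pCons 0 ?P)"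
    by (simp only: szego_Suc(1) ip_diff ip_smult)
  also have "\<dots> = (1 - \<alpha> n * cnj (\<alpha> n)) * ip ?P ?P" unfolding QzP ip_pCons by (simp add: algebra_simps)
  finally have N': "ip ?P' ?P' = (1 - \<alpha> n * cnj (\<alpha> n)) * ip ?P ?P" .
  define x where "x = (\<integral>z. (norm (poly ?P z))\<^sup>2 \<partial>\<mu>)"
  define y where "y = (\<integral>z. (norm (poly ?P' z))\<^sup>2 \<partial>\<mu>)"
  have xy: "x > 0" "y > 0" unfolding x_def y_def using ip_pos(2) P0 by auto
  have "of_real y = (of_real ((1 - (norm (\<alpha> n))\<^sup>2) * x) :: complex)"
    using N' unfolding ip_pos(1)[OF P0(1)] ip_pos(1)[OF P0(2)] x_def[symmetric] y_def[symmetric]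
    by (simp only: complex_norm_square of_real_mult of_real_diff of_real_1)
  hence "y = (1 - (norm (\<alpha> n))\<^sup>2) * x" by (simp only: of_real_eq_iff)
  hence "1 - (norm (\<alpha> n))\<^sup>2 > 0" using xy by (simp add: zero_less_mult_iff)
  thus ?thesis by (simp add: power_less_one_iff)
qed

text \<open>Both moment sequences obey the same recursion: orthogonality of the monic \<Phi>_k to 1
  expresses the k-th moment through the earlier ones.\<close>

lemma moment_eq_bs_moment: "k \<le> N \<Longrightarrow> 2 * pi * (\<integral>z. z ^ k \<partial>\<mu>) = bs_moment \<alpha> N k"
proof (induction k arbitrary: N rule: less_induct)
  case (less k)
  have "2 * pi * (\<integral>z. z ^ k \<partial>\<mu>) = bs_moment \<alpha> k k"
  proof (cases "k = 0")
    case True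
    thus ?thesis by (simp add: bs_moment_def bernstein_szego_def szego_0 prob_space scaleR_conv_of_real)
  next
    case False
    define c where "c = coeff (\<Phi> k)"
    have ck: "c k = 1" using szego_degrees[of \<alpha> k] by (simp add: c_def)
    have "0 = ip (\<Phi> k) (monom 1 0)" using szego_OP[of k] False by (auto simp: is_monic_OP_ip)
    also have "\<dots> = (\<integral>z. (\<Sum>j\<le>k. c j * z ^ j) \<partial>\<mu>)"
      using szego_degrees[of \<alpha> k] by (simp add: ip_def poly_monom poly_eq_sum_le[of _ k] c_def)
    also have "\<dots> = (\<Sum>j\<le>k. c j * (\<integral>z. z ^ j \<partial>\<mu>))"
      by (subst Bochner_Integration.integral_sum) (auto intro!: integrable_continuous continuous_intros)
    finally have "2 * pi * (\<Sum>j\<le>k. c j * (\<integral>z. z ^ j \<partial>\<mu>)) = 0" by simp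
    hence 1: "(\<Sum>j\<le>k. c j * (2 * pi * (\<integral>z. z ^ j \<partial>\<mu>))) = 0"
      unfolding sum_distrib_left by (simp only: mult.left_commute)
    have 2: "(\<Sum>j\<le>k. c j * bs_moment \<alpha> k j) = 0"
      unfolding c_def using False by (intro bs_moment_szego verblunsky_less_1) auto
    have "(\<Sum>j<k. c j * (2 * pi * (\<integral>z. z ^ j \<partial>\<mu>))) = (\<Sum>j<k. c j * bs_moment \<alpha> k j)"
      using less.IH by (intro sum.cong) auto
    thus ?thesis using 1 2 ck unfolding lessThan_Suc_atMost[symmetric] sum.lessThan_Suc by (simp add: add_eq_0_iff)
  qed
  also have "\<dots> = bs_moment \<alpha> N k" using bs_moment_stable[OF verblunsky_less_1 less.prems] by simp
  finally show ?case .
qed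

end

section \<open>Entropy semicontinuity\<close>

lemma real_polynomial_on_circle:
  assumes "real_polynomial_function p"
  shows "\<exists>P d. \<forall>z. norm z = 1 \<longrightarrow> complex_of_real (p z) = cnj z ^ d * poly P z"
  using assms
proof (induction p)
  case (linear f)
  hence lin: "linear f" by (rule bounded_linear.linear)
  \<comment> \<open>Represents the real-linear form as f z = Re (cnj c z), that is (c cnj z + cnj c
    z) / 2.\<close>
  define c where "c = Complex (f 1) (f \<i>)"
  have f: "f z = Re z * f 1 + Im z * f \<i>" for z
  proof -
    have "z = Re z *\<^sub>R 1 + Im z *\<^sub>R \<i>" by (simp add: complex_eq_iff)
    hence "f z = f (Re z *\<^sub>R 1 + Im z *\<^sub>R \<i>)" by (rule arg_cong)
    thus ?thesis unfolding linear_add[OF lin] linear_scale[OF lin] real_scaleR_def .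
  qed
  have "complex_of_real (f z) = cnj z ^ 1 * poly [:c / 2, 0, cnj c / 2:] z" if z: "norm z = 1" for z
  proof -
    have zz: "cnj z * z = 1" using z complex_norm_square[of z] by (simp add: mult.commute)
    have "cnj z ^ 1 * poly [:c / 2, 0, cnj c / 2:] z = (cnj z * c + cnj c * z * (cnj z * z)) / 2"
      by (simp add: algebra_simps add_divide_distrib)
    also have "\<dots> = (cnj z * c + cnj c * z) / 2" by (simp add: zz)
    also have "\<dots> = complex_of_real (Re z * f 1 + Im z * f \<i>)" by (simp add: complex_eq_iff c_def algebra_simps)
    also have "\<dots> = complex_of_real (f z)" by (simp only: f[of z])
    finally show ?thesis by simp
  qed
  thus ?case by blast
next
  case (const c)
  have "complex_of_real c = cnj z ^ 0 * poly [:of_real c:] z" for z by simp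
  thus ?case by blast
next
  case (add f g)
  then obtain P d Q e where P: "\<And>z. norm z = 1 \<Longrightarrow> complex_of_real (f z) = cnj z ^ d * poly P z"
    and Q: "\<And>z. norm z = 1 \<Longrightarrow> complex_of_real (g z) = cnj z ^ e * poly Q z" by blast
  have "complex_of_real (f z + g z) = cnj z ^ (d + e) * poly (monom 1 e * P + monom 1 d * Q) z" if z: "norm z = 1" for z
  proof -
    have zz: "(cnj z * z) ^ k = 1" for k using z complex_norm_square[of z] by (simp add: mult.commute)
    have "cnj z ^ (d + e) * poly (monom 1 e * P + monom 1 d * Q) z
      = cnj z ^ d * poly P z * (cnj z * z) ^ e + cnj z ^ e * poly Q z * (cnj z * z) ^ d"
      unfolding poly_add poly_mult poly_monom power_add power_mult_distrib distrib_left
      by (simp only: mult_ac mult_1_left)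
    thus ?thesis unfolding zz using P[OF z] Q[OF z] by simp
  qed
  thus ?case by blast
next
  case (mult f g)
  then obtain P d Q e where P: "\<And>z. norm z = 1 \<Longrightarrow> complex_of_real (f z) = cnj z ^ d * poly P z"
    and Q: "\<And>z. norm z = 1 \<Longrightarrow> complex_of_real (g z) = cnj z ^ e * poly Q z" by blast
  have "complex_of_real (f z * g z) = cnj z ^ (d + e) * poly (P * Q) z" if z: "norm z = 1" for z
    using P[OF z] Q[OF z] by (simp add: power_add)
  thus ?case by blast
qed

context nontrivial_circle_measure
begin

lemma trig_monomial_integral:
  assumes "d \<le> N" "j \<le> N"
  shows "2 * pi * (\<integral>z. cnj z ^ d * z ^ j \<partial>\<mu>) = integral {0..2*pi} (\<lambda>t. of_real (bernstein_szego \<alpha> N (cis t)) * (cnj (cis t) ^ d * cis t ^ j))"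
proof (cases "d \<le> j")
  case True
  have eq: "cnj z ^ d * z ^ j = z ^ (j - d)" if z: "norm z = 1" for z :: complex
  proof -
    have zz: "(cnj z * z) ^ d = 1" using z complex_norm_square[of z] by (simp add: mult.commute)
    have "cnj z ^ d * z ^ j = (cnj z * z) ^ d * z ^ (j - d)"
      using True by (simp add: power_mult_distrib mult.assoc power_add[symmetric])
    thus ?thesis by (simp add: zz)
  qed
  have "(\<integral>z. cnj z ^ d * z ^ j \<partial>\<mu>) = (\<integral>z. z ^ (j - d) \<partial>\<mu>)"
    by (rule integral_circle_cong) (auto intro!: continuous_intros eq)
  also have "2 * pi * \<dots> = bs_moment \<alpha> N (j - d)" by (rule moment_eq_bs_moment) (use assms in simp)
  finally show ?thesis unfolding bs_moment_def eq[OF norm_cis] .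
next
  case False
  have eq: "cnj z ^ d * z ^ j = cnj (z ^ (d - j))" if z: "norm z = 1" for z :: complex
  proof -
    have zz: "(cnj z * z) ^ j = 1" using z complex_norm_square[of z] by (simp add: mult.commute)
    have "cnj z ^ d * z ^ j = (cnj z * z) ^ j * cnj z ^ (d - j)"
      using False by (simp add: power_mult_distrib mult_ac power_add[symmetric])
    thus ?thesis by (simp add: zz)
  qed
  have "(\<integral>z. cnj z ^ d * z ^ j \<partial>\<mu>) = (\<integral>z. cnj (z ^ (d - j)) \<partial>\<mu>)"
  proof (rule integral_circle_cong)
    show "cnj z ^ d * z ^ j = cnj (z ^ (d - j))" if "norm z = 1" for z using that by (rule eq)
  qed (intro continuous_intros)+
  also have "\<dots> = cnj (\<integral>z. z ^ (d - j) \<partial>\<mu>)" by (rule Bochner_Integration.integral_cnj)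
  finally have "2 * pi * (\<integral>z. cnj z ^ d * z ^ j \<partial>\<mu>) = cnj (2 * pi * (\<integral>z. z ^ (d - j) \<partial>\<mu>))"
    by (simp only: complex_cnj_mult complex_cnj_complex_of_real)
  also have "2 * pi * (\<integral>z. z ^ (d - j) \<partial>\<mu>) = bs_moment \<alpha> N (d - j)"
    by (rule moment_eq_bs_moment) (use assms in simp)
  also have "cnj (bs_moment \<alpha> N (d - j)) = integral {0..2*pi} (\<lambda>t. cnj (of_real (bernstein_szego \<alpha> N (cis t)) * cis t ^ (d - j)))"
    unfolding bs_moment_def by (rule Henstock_Kurzweil_Integration.integral_cnj)
  also have "\<dots> = integral {0..2*pi} (\<lambda>t. of_real (bernstein_szego \<alpha> N (cis t)) * (cnj (cis t) ^ d * cis t ^ j))"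
    unfolding eq[OF norm_cis] complex_cnj_mult complex_cnj_complex_of_real ..
  finally show ?thesis .
qed

text \<open>Equality holds already for a single N, as soon as N exceeds the trigonometric degree; no
  limit in N has to be taken.\<close>

lemma real_polynomial_integral:
  assumes p: "real_polynomial_function p"
  shows "\<exists>N. 2 * pi * (\<integral>z. p z \<partial>\<mu>) = integral {0..2*pi} (\<lambda>t. bernstein_szego \<alpha> N (cis t) * p (cis t))"
proof -
  obtain P d where P: "\<And>z. norm z = 1 \<Longrightarrow> complex_of_real (p z) = cnj z ^ d * poly P z"
    using real_polynomial_on_circle[OF assms] by blast
  define N where "N = d + degree P"
  have pc: "continuous_on S p" for S by (rule continuous_on_polymonial_function) (use p in \<open>simp add: real_polynomial_function_eq\<close>)
  have Pd: "cnj z ^ d * poly P z = (\<Sum>j\<le>N. coeff P j * (cnj z ^ d * z ^ j))" for z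
    by (simp add: poly_eq_sum_le[of P N] N_def sum_distrib_left mult_ac)
  have int: "(\<lambda>t. of_real (bernstein_szego \<alpha> N (cis t)) * (cnj (cis t) ^ d * cis t ^ j)) integrable_on {0..2*pi}" for j
    by (intro integrable_continuous_interval continuous_intros continuous_on_bernstein_szego verblunsky_less_1)
  have "complex_of_real (2 * pi * (\<integral>z. p z \<partial>\<mu>)) = 2 * pi * (\<integral>z. complex_of_real (p z) \<partial>\<mu>)"
    unfolding integral_complex_of_real by simp
  also have "(\<integral>z. complex_of_real (p z) \<partial>\<mu>) = (\<integral>z. (\<Sum>j\<le>N. coeff P j * (cnj z ^ d * z ^ j)) \<partial>\<mu>)"
    by (rule integral_circle_cong) (intro continuous_intros pc, intro continuous_intros, simp only: P Pd)
  also have "\<dots> = (\<Sum>j\<le>N. \<integral>z. coeff P j * (cnj z ^ d * z ^ j) \<partial>\<mu>)"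
    by (rule Bochner_Integration.integral_sum) (intro integrable_continuous continuous_intros)
  also have "\<dots> = (\<Sum>j\<le>N. coeff P j * (\<integral>z. cnj z ^ d * z ^ j \<partial>\<mu>))"
    by (simp only: integral_mult_right_zero)
  also have "2 * pi * \<dots> = (\<Sum>j\<le>N. coeff P j * (2 * pi * (\<integral>z. cnj z ^ d * z ^ j \<partial>\<mu>)))"
    unfolding sum_distrib_left by (simp only: mult.left_commute)
  also have "\<dots> = (\<Sum>j\<le>N. coeff P j * integral {0..2*pi} (\<lambda>t. of_real (bernstein_szego \<alpha> N (cis t)) * (cnj (cis t) ^ d * cis t ^ j)))"
    by (intro sum.cong refl arg_cong2[where f = "(*)"] trig_monomial_integral) (auto simp: N_def)
  also have "\<dots> = integral {0..2*pi} (\<lambda>t. \<Sum>j\<le>N. coeff P j * (of_real (bernstein_szego \<alpha> N (cis t)) * (cnj (cis t) ^ d * cis t ^ j)))"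
    unfolding Henstock_Kurzweil_Integration.integral_mult_right[symmetric]
    by (rule Henstock_Kurzweil_Integration.integral_sum[symmetric]) (simp, rule integrable_on_mult_right[OF int])
  also have "\<dots> = integral {0..2*pi} (\<lambda>t. complex_of_real (bernstein_szego \<alpha> N (cis t) * p (cis t)))"
  proof (rule arg_cong[where f = "integral {0..2*pi}"], rule ext)
    fix t
    have "(\<Sum>j\<le>N. coeff P j * (of_real (bernstein_szego \<alpha> N (cis t)) * (cnj (cis t) ^ d * cis t ^ j)))
      = of_real (bernstein_szego \<alpha> N (cis t)) * (\<Sum>j\<le>N. coeff P j * (cnj (cis t) ^ d * cis t ^ j))"
      unfolding sum_distrib_left by (simp only: mult.left_commute)
    also have "\<dots> = of_real (bernstein_szego \<alpha> N (cis t)) * of_real (p (cis t))"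
      unfolding Pd[symmetric] by (subst P) auto
    finally show "(\<Sum>j\<le>N. coeff P j * (of_real (bernstein_szego \<alpha> N (cis t)) * (cnj (cis t) ^ d * cis t ^ j)))
      = complex_of_real (bernstein_szego \<alpha> N (cis t) * p (cis t))" by simp
  qed
  also have "\<dots> = of_real (integral {0..2*pi} (\<lambda>t. bernstein_szego \<alpha> N (cis t) * p (cis t)))"
  proof (rule integral_linear[of "\<lambda>t. bernstein_szego \<alpha> N (cis t) * p (cis t)" "{0..2*pi}" complex_of_real, unfolded o_def])
    have "continuous_on {0..2*pi} (\<lambda>t. p (cis t))"
      by (rule continuous_on_compose2[OF pc[of UNIV]]) (auto intro: continuous_intros)
    thus "(\<lambda>t. bernstein_szego \<alpha> N (cis t) * p (cis t)) integrable_on {0..2*pi}"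
      by (intro integrable_continuous_interval continuous_on_mult continuous_on_bernstein_szego verblunsky_less_1)
  qed (rule bounded_linear_of_real)
  finally show ?thesis unfolding of_real_eq_iff by blast
qed

text \<open>The pointwise input is \<open>\<omega> ln y \<le> y\<close> for \<open>0 \<le> \<omega> \<le> 1\<close>.\<close>

lemma entropy_bound_continuous:
  fixes \<omega> :: "real \<Rightarrow> real"
  assumes \<omega>: "continuous_on {0..2*pi} \<omega>" "\<And>t. 0 \<le> \<omega> t" "\<And>t. \<omega> t \<le> 1"
    and C: "\<And>N. integral {0..2*pi} (\<lambda>t. \<omega> t * (- ln (bernstein_szego \<alpha> N (cis t)))) \<le> C"
    and f: "continuous_on UNIV f" "\<And>z. norm z = 1 \<Longrightarrow> 1 \<le> f z"
  shows "integral {0..2*pi} (\<lambda>t. \<omega> t * ln (f (cis t))) \<le> 4 * pi * (\<integral>z. f z \<partial>\<mu>) + (C + 2 * pi * ln 2)"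
proof -
  \<comment> \<open>Precision 1/2 is enough: since f >= 1 on the circle, f and g differ by a factor
    of at most 2. This costs only the factor 4 \<pi> in place of 2 \<pi> and the constant 2 \<pi> ln
    2.\<close>
  obtain g where g: "real_polynomial_function g" "\<And>z. z \<in> sphere 0 1 \<Longrightarrow> \<bar>f z - g z\<bar> < 1/2"
    using Stone_Weierstrass_real_polynomial_function[of "sphere 0 1" f "1/2"] continuous_on_subset[OF f(1)] by auto
  obtain N where N: "2 * pi * (\<integral>z. g z \<partial>\<mu>) = integral {0..2*pi} (\<lambda>t. bernstein_szego \<alpha> N (cis t) * g (cis t))"
    using real_polynomial_integral[OF g(1)] by blast
  define B where "B t = bernstein_szego \<alpha> N (cis t)" for t
  have gc: "continuous_on S g" for S by (rule continuous_on_polymonial_function) (use g(1) in \<open>simp add: real_polynomial_function_eq\<close>)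
  have gcis: "continuous_on {0..2*pi} (\<lambda>t. g (cis t))"
    by (rule continuous_on_compose2[OF gc[of UNIV]]) (auto intro: continuous_intros)
  have fcis: "continuous_on {0..2*pi} (\<lambda>t. f (cis t))"
    by (rule continuous_on_compose2[OF f(1)]) (auto intro: continuous_intros)
  have Bc: "continuous_on {0..2*pi} B" unfolding B_def
    by (intro continuous_on_bernstein_szego verblunsky_less_1)
  have Bpos: "B t > 0" for t unfolding B_def by (intro bernstein_szego_pos verblunsky_less_1) simp
  have fg: "f z \<le> 2 * g z" "g z \<le> 2 * f z" "g z > 0" if "norm z = 1" for z
  proof -
    have "\<bar>f z - g z\<bar> < 1/2" using g(2)[of z] that by simp
    thus "f z \<le> 2 * g z" "g z \<le> 2 * f z" "g z > 0" using f(2)[OF that] by linarith+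
  qed
  have fpos: "f (cis t) \<noteq> 0" for t using f(2)[of "cis t"] by simp
  have key: "\<omega> t * ln y \<le> y" if "y > 0" for t y
  proof (cases "ln y \<ge> 0")
    case True
    hence "\<omega> t * ln y \<le> 1 * ln y" using \<omega>(3) by (intro mult_right_mono) auto
    also have "\<dots> \<le> y" using ln_le_minus_one[OF that] by simp
    finally show ?thesis .
  next
    case False
    hence "\<omega> t * ln y \<le> 0" using \<omega>(2)[of t] by (simp add: mult_nonneg_nonpos)
    thus ?thesis using that by linarith
  qed
  have pt: "\<omega> t * ln (f (cis t)) \<le> B t * g (cis t) + \<omega> t * (- ln (B t)) + ln 2" for t
  proof -
    have gp: "g (cis t) > 0" using fg by simp
    have "ln (f (cis t)) \<le> ln (2 * g (cis t))"
      using fg(1)[of "cis t"] f(2)[of "cis t"] gp by (subst ln_le_cancel_iff) auto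
    also have "\<dots> = ln 2 + ln (g (cis t))" using gp by (simp add: ln_mult)
    also have "ln (g (cis t)) = ln (B t * g (cis t)) - ln (B t)" using gp Bpos[of t] by (simp add: ln_mult)
    finally have "\<omega> t * ln (f (cis t)) \<le> \<omega> t * (ln 2 + (ln (B t * g (cis t)) - ln (B t)))"
      using \<omega>(2) by (intro mult_left_mono) auto
    also have "\<dots> = \<omega> t * ln 2 + \<omega> t * ln (B t * g (cis t)) + \<omega> t * (- ln (B t))" by (simp add: algebra_simps)
    also have "\<omega> t * ln 2 \<le> ln 2" using \<omega>(3)[of t] by (intro mult_left_le_one_le) (auto simp: \<omega>)
    also have "\<omega> t * ln (B t * g (cis t)) \<le> B t * g (cis t)" using key gp Bpos by simp
    finally show ?thesis by simp
  qed
  have c1: "(\<lambda>t. B t * g (cis t)) integrable_on {0..2*pi}"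
    by (intro integrable_continuous_interval continuous_on_mult Bc gcis)
  have c2: "(\<lambda>t. \<omega> t * (- ln (B t))) integrable_on {0..2*pi}"
    using Bpos by (intro integrable_continuous_interval continuous_intros \<omega> Bc) (auto simp: less_imp_neq[THEN not_sym])
  have c3: "(\<lambda>t. \<omega> t * ln (f (cis t))) integrable_on {0..2*pi}"
    using fpos by (intro integrable_continuous_interval continuous_intros \<omega> fcis) auto
  have "integral {0..2*pi} (\<lambda>t. \<omega> t * ln (f (cis t))) \<le> integral {0..2*pi} (\<lambda>t. B t * g (cis t) + \<omega> t * (- ln (B t)) + ln 2)"
    by (intro integral_le c3 Henstock_Kurzweil_Integration.integrable_add c1 c2) (use pt in auto)
  also have "\<dots> = integral {0..2*pi} (\<lambda>t. B t * g (cis t)) + integral {0..2*pi} (\<lambda>t. \<omega> t * (- ln (B t))) + (2 * pi - 0) *\<^sub>R ln 2"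
    by (rule integral_unique) (intro has_integral_add integrable_integral c1 c2, use has_integral_const_real[of "ln 2 :: real" 0 "2*pi"] in simp)
  also have "\<dots> = 2 * pi * (\<integral>z. g z \<partial>\<mu>) + integral {0..2*pi} (\<lambda>t. \<omega> t * (- ln (B t))) + 2 * pi * ln 2"
    unfolding N B_def by simp
  also have "\<dots> \<le> 2 * pi * (2 * (\<integral>z. f z \<partial>\<mu>)) + C + 2 * pi * ln 2"
  proof -
    have "(\<integral>z. g z \<partial>\<mu>) \<le> (\<integral>z. 2 * f z \<partial>\<mu>)"
    proof (rule integral_mono_AE)
      show "AE z in \<mu>. g z \<le> 2 * f z" using AE_circle by eventually_elim (rule fg)
    qed (intro integrable_continuous gc continuous_intros f)+
    hence "(\<integral>z. g z \<partial>\<mu>) \<le> 2 * (\<integral>z. f z \<partial>\<mu>)" by simp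
    thus ?thesis using C[of N] unfolding B_def by (intro add_mono mult_left_mono) auto
  qed
  finally show ?thesis by (simp add: mult.assoc)
qed

end

section \<open>Simultaneous L1 approximation by bounded continuous functions\<close>

definition cont_approx :: "'a::metric_space measure set \<Rightarrow> ('a \<Rightarrow> real) \<Rightarrow> bool" where
  "cont_approx \<M> F \<longleftrightarrow> (\<forall>\<epsilon>>0. \<exists>f. continuous_on UNIV f \<and> bounded (range f) \<and> (\<forall>M\<in>\<M>. (\<integral>z. \<bar>F z - f z\<bar> \<partial>M) < \<epsilon>))"

text \<open>The entropy bound involves the given measure and arc length at once, and neither need
  dominate the other. So one continuous function must approximate in both.\<close>

locale finite_borel_measures =
  fixes \<M> :: "'a::metric_space measure set"
  assumes finite_family: "finite \<M>" and finite_measures: "M \<in> \<M> \<Longrightarrow> finite_measure M"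
    and borel_measures: "M \<in> \<M> \<Longrightarrow> sets M = sets borel"
begin

lemma integrable_bounded:
  fixes f :: "'a \<Rightarrow> real"
  assumes "M \<in> \<M>" "f \<in> borel_measurable borel" "\<And>z. \<bar>f z\<bar> \<le> B"
  shows "integrable M f"
proof -
  interpret finite_measure M by (rule finite_measures[OF assms(1)])
  have "f \<in> borel_measurable M" using assms(2) unfolding measurable_cong_sets[OF borel_measures[OF assms(1)] refl] .
  thus ?thesis by (intro integrable_const_bound[of _ B]) (use assms(3) in auto)
qed

lemma integrable_abs_diff:
  fixes F f :: "'a \<Rightarrow> real"
  assumes M: "M \<in> \<M>" and m: "F \<in> borel_measurable borel" "f \<in> borel_measurable borel"
    and B: "\<And>z. \<bar>F z\<bar> \<le> B" "\<And>z. \<bar>f z\<bar> \<le> b"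
  shows "integrable M (\<lambda>z. \<bar>F z - f z\<bar>)"
proof (rule integrable_bounded[OF M])
  show "(\<lambda>z. \<bar>F z - f z\<bar>) \<in> borel_measurable borel" using m by measurable
  show "\<bar>\<bar>F z - f z\<bar>\<bar> \<le> B + b" for z using B(1)[of z] B(2)[of z] by linarith
qed

lemma bounded_range_abs:
  fixes f :: "'a \<Rightarrow> real"
  assumes "bounded (range f)"
  obtains B where "\<And>z. \<bar>f z\<bar> \<le> B"
  using assms unfolding bounded_iff by auto

lemma cont_approx_continuous:
  assumes "continuous_on UNIV f" "bounded (range f)"
  shows "cont_approx \<M> f"
  unfolding cont_approx_def using assms by (intro allI impI exI[of _ f]) auto

lemma cont_approx_add:
  assumes F: "cont_approx \<M> F" "F \<in> borel_measurable borel" "\<And>z. \<bar>F z\<bar> \<le> B"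
    and G: "cont_approx \<M> G" "G \<in> borel_measurable borel" "\<And>z. \<bar>G z\<bar> \<le> B'"
  shows "cont_approx \<M> (\<lambda>z. F z + G z)"
  unfolding cont_approx_def
proof (intro allI impI)
  fix \<epsilon> :: real assume e: "\<epsilon> > 0"
  obtain f where f: "continuous_on UNIV f" "bounded (range f)" "\<And>M. M \<in> \<M> \<Longrightarrow> (\<integral>z. \<bar>F z - f z\<bar> \<partial>M) < \<epsilon> / 2"
    using F(1) e unfolding cont_approx_def by (meson half_gt_zero)
  obtain g where g: "continuous_on UNIV g" "bounded (range g)" "\<And>M. M \<in> \<M> \<Longrightarrow> (\<integral>z. \<bar>G z - g z\<bar> \<partial>M) < \<epsilon> / 2"
    using G(1) e unfolding cont_approx_def by (meson half_gt_zero)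
  obtain b where b: "\<And>z. \<bar>f z\<bar> \<le> b" using bounded_range_abs[OF f(2)] by blast
  obtain b' where b': "\<And>z. \<bar>g z\<bar> \<le> b'" using bounded_range_abs[OF g(2)] by blast
  have fm: "f \<in> borel_measurable borel" "g \<in> borel_measurable borel"
    using f(1) g(1) by (auto intro: borel_measurable_continuous_onI)
  have "(\<integral>z. \<bar>(F z + G z) - (f z + g z)\<bar> \<partial>M) < \<epsilon>" if M: "M \<in> \<M>" for M
  proof -
    have i1: "integrable M (\<lambda>z. \<bar>F z - f z\<bar>)"
      by (rule integrable_abs_diff[OF M F(2) fm(1) F(3) b])
    have i2: "integrable M (\<lambda>z. \<bar>G z - g z\<bar>)"
      by (rule integrable_abs_diff[OF M G(2) fm(2) G(3) b'])
    have i3: "integrable M (\<lambda>z. \<bar>(F z + G z) - (f z + g z)\<bar>)"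
    proof (rule integrable_abs_diff[OF M])
      show "\<bar>F z + G z\<bar> \<le> B + B'" for z using F(3)[of z] G(3)[of z] by linarith
      show "\<bar>f z + g z\<bar> \<le> b + b'" for z using b[of z] b'[of z] by linarith
    qed (use F(2) G(2) fm in measurable)
    have "(\<integral>z. \<bar>(F z + G z) - (f z + g z)\<bar> \<partial>M) \<le> (\<integral>z. \<bar>F z - f z\<bar> + \<bar>G z - g z\<bar> \<partial>M)"
      by (intro integral_mono i3 Bochner_Integration.integrable_add i1 i2) linarith
    also have "\<dots> = (\<integral>z. \<bar>F z - f z\<bar> \<partial>M) + (\<integral>z. \<bar>G z - g z\<bar> \<partial>M)"
      by (rule Bochner_Integration.integral_add[OF i1 i2])
    finally show ?thesis using f(3)[OF M] g(3)[OF M] by linarith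
  qed
  moreover have "bounded (range (\<lambda>z. f z + g z))"
    unfolding bounded_iff
  proof (intro exI[of _ "b + b'"] ballI)
    fix x assume "x \<in> range (\<lambda>z. f z + g z)"
    then obtain z where "x = f z + g z" by auto
    thus "norm x \<le> b + b'" using b[of z] b'[of z] by simp
  qed
  ultimately show "\<exists>h. continuous_on UNIV h \<and> bounded (range h) \<and> (\<forall>M\<in>\<M>. (\<integral>z. \<bar>(F z + G z) - h z\<bar> \<partial>M) < \<epsilon>)"
    using f(1) g(1) by (intro exI[of _ "\<lambda>z. f z + g z"]) (auto intro: continuous_on_add)
qed

lemma cont_approx_cmult:
  assumes F: "cont_approx \<M> F"
  shows "cont_approx \<M> (\<lambda>z. c * F z)"
  unfolding cont_approx_def
proof (intro allI impI)
  fix \<epsilon> :: real assume e: "\<epsilon> > 0"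
  have "\<epsilon> / (\<bar>c\<bar> + 1) > 0" using e by (simp add: add_nonneg_pos)
  then obtain f where f: "continuous_on UNIV f" "bounded (range f)" "\<And>M. M \<in> \<M> \<Longrightarrow> (\<integral>z. \<bar>F z - f z\<bar> \<partial>M) < \<epsilon> / (\<bar>c\<bar> + 1)"
    using F unfolding cont_approx_def by meson
  have "(\<integral>z. \<bar>c * F z - c * f z\<bar> \<partial>M) < \<epsilon>" if M: "M \<in> \<M>" for M
  proof -
    have "(\<integral>z. \<bar>c * F z - c * f z\<bar> \<partial>M) = \<bar>c\<bar> * (\<integral>z. \<bar>F z - f z\<bar> \<partial>M)"
      by (simp add: abs_mult right_diff_distrib[symmetric])
    also have "\<dots> \<le> (\<bar>c\<bar> + 1) * (\<integral>z. \<bar>F z - f z\<bar> \<partial>M)"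
      by (intro mult_right_mono Bochner_Integration.integral_nonneg) auto
    also have "\<dots> < (\<bar>c\<bar> + 1) * (\<epsilon> / (\<bar>c\<bar> + 1))"
      using f(3)[OF M] by (intro mult_strict_left_mono) auto
    finally show ?thesis by simp
  qed
  moreover have "bounded (range (\<lambda>z. c * f z))"
    using bounded_scaling[OF f(2), of c] by (simp add: image_image)
  ultimately show "\<exists>h. continuous_on UNIV h \<and> bounded (range h) \<and> (\<forall>M\<in>\<M>. (\<integral>z. \<bar>c * F z - h z\<bar> \<partial>M) < \<epsilon>)"
    using f(1) by (intro exI[of _ "\<lambda>z. c * f z"]) (auto intro: continuous_on_mult_left)
qed

text \<open>Dominated convergence for each measure; finiteness of the family yields one k that
  serves all of them.\<close>

lemma cont_approx_limit:
  assumes Fk: "\<And>k. cont_approx \<M> (Fk k)" "\<And>k. Fk k \<in> borel_measurable borel" "\<And>k z. \<bar>Fk k z\<bar> \<le> B"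
    and lim: "\<And>z. (\<lambda>k. Fk k z) \<longlonglongrightarrow> F z"
  shows "cont_approx \<M> F"
  unfolding cont_approx_def
proof (intro allI impI)
  fix \<epsilon> :: real assume e: "\<epsilon> > 0"
  have Fm: "F \<in> borel_measurable borel" by (rule borel_measurable_LIMSEQ_metric[OF Fk(2) lim])
  have FB: "\<bar>F z\<bar> \<le> B" for z
    by (rule LIMSEQ_le_const2[OF tendsto_rabs[OF lim]]) (use Fk(3) in auto)
  have conv: "(\<lambda>k. \<integral>z. \<bar>F z - Fk k z\<bar> \<partial>M) \<longlonglongrightarrow> (\<integral>z. 0 \<partial>M)" if M: "M \<in> \<M>" for M
  proof (rule integral_dominated_convergence)
    interpret finite_measure M by (rule finite_measures[OF M])
    show "integrable M (\<lambda>z. 2 * B)" by simp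
    note [measurable_cong] = borel_measures[OF M]
    show "(\<lambda>z. \<bar>F z - Fk k z\<bar>) \<in> borel_measurable M" for k using Fm Fk(2) by measurable
    show "AE z in M. (\<lambda>k. \<bar>F z - Fk k z\<bar>) \<longlonglongrightarrow> 0"
    proof (intro AE_I2)
      fix z
      have "(\<lambda>k. \<bar>F z - Fk k z\<bar>) \<longlonglongrightarrow> \<bar>F z - F z\<bar>" by (intro tendsto_intros lim)
      thus "(\<lambda>k. \<bar>F z - Fk k z\<bar>) \<longlonglongrightarrow> 0" by simp
    qed
    show "AE z in M. norm \<bar>F z - Fk k z\<bar> \<le> 2 * B" for k
    proof (intro AE_I2)
      fix z show "norm \<bar>F z - Fk k z\<bar> \<le> 2 * B" using FB[of z] Fk(3)[of k z] by simp
    qed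
  qed auto
  have "\<forall>M\<in>\<M>. \<forall>\<^sub>F k in sequentially. (\<integral>z. \<bar>F z - Fk k z\<bar> \<partial>M) < \<epsilon> / 2"
    using e by (intro ballI order_tendstoD(2)[OF conv]) auto
  hence "\<forall>\<^sub>F k in sequentially. \<forall>M\<in>\<M>. (\<integral>z. \<bar>F z - Fk k z\<bar> \<partial>M) < \<epsilon> / 2"
    by (intro eventually_ball_finite finite_family)
  then obtain k where k: "\<And>M. M \<in> \<M> \<Longrightarrow> (\<integral>z. \<bar>F z - Fk k z\<bar> \<partial>M) < \<epsilon> / 2"
    unfolding eventually_sequentially by blast
  obtain f where f: "continuous_on UNIV f" "bounded (range f)" "\<And>M. M \<in> \<M> \<Longrightarrow> (\<integral>z. \<bar>Fk k z - f z\<bar> \<partial>M) < \<epsilon> / 2"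
    using Fk(1) e unfolding cont_approx_def by (meson half_gt_zero)
  obtain b where b: "\<And>z. \<bar>f z\<bar> \<le> b" using bounded_range_abs[OF f(2)] by blast
  have fm: "f \<in> borel_measurable borel" using f(1) by (rule borel_measurable_continuous_onI)
  have "(\<integral>z. \<bar>F z - f z\<bar> \<partial>M) < \<epsilon>" if M: "M \<in> \<M>" for M
  proof -
    have i1: "integrable M (\<lambda>z. \<bar>F z - Fk k z\<bar>)"
      by (rule integrable_abs_diff[OF M Fm Fk(2) FB Fk(3)])
    have i2: "integrable M (\<lambda>z. \<bar>Fk k z - f z\<bar>)"
      by (rule integrable_abs_diff[OF M Fk(2) fm Fk(3) b])
    have i3: "integrable M (\<lambda>z. \<bar>F z - f z\<bar>)"
      by (rule integrable_abs_diff[OF M Fm fm FB b])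
    have "(\<integral>z. \<bar>F z - f z\<bar> \<partial>M) \<le> (\<integral>z. \<bar>F z - Fk k z\<bar> + \<bar>Fk k z - f z\<bar> \<partial>M)"
      by (intro integral_mono i3 Bochner_Integration.integrable_add i1 i2) linarith
    also have "\<dots> = (\<integral>z. \<bar>F z - Fk k z\<bar> \<partial>M) + (\<integral>z. \<bar>Fk k z - f z\<bar> \<partial>M)"
      by (rule Bochner_Integration.integral_add[OF i1 i2])
    finally show ?thesis using f(3)[OF M] k[OF M] by linarith
  qed
  with f show "\<exists>f. continuous_on UNIV f \<and> bounded (range f) \<and> (\<forall>M\<in>\<M>. (\<integral>z. \<bar>F z - f z\<bar> \<partial>M) < \<epsilon>)" by blast
qed

lemma cont_approx_open:
  assumes "open U"
  shows "cont_approx \<M> (indicator U)"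
proof (cases "U = UNIV")
  case True
  have "cont_approx \<M> (\<lambda>z. 1)" by (rule cont_approx_continuous) auto
  thus ?thesis unfolding True by (simp add: indicator_def[abs_def])
next
  case False
  define g where "g k z = min 1 (real k * infdist z (- U))" for k z
  have g: "0 \<le> g k z" "g k z \<le> 1" for k z by (auto simp: g_def infdist_nonneg)
  have gc: "continuous_on UNIV (g k)" for k unfolding g_def[abs_def]
    by (intro continuous_intros)
  show ?thesis
  proof (rule cont_approx_limit[of g 1])
    show "cont_approx \<M> (g k)" for k
      using g by (intro cont_approx_continuous gc) (auto simp: bounded_iff intro!: exI[of _ 1])
    show "g k \<in> borel_measurable borel" for k by (rule borel_measurable_continuous_onI[OF gc])
    show "\<bar>g k z\<bar> \<le> 1" for k z using g[of k z] by simp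
    fix z
    show "(\<lambda>k. g k z) \<longlonglongrightarrow> indicator U z"
    proof (cases "z \<in> U")
      case True
      hence pos: "infdist z (- U) > 0"
        using assms False infdist_pos_not_in_closed[of "- U" z] by (auto simp: closed_Compl)
      obtain k0 :: nat where k0: "1 / infdist z (- U) < real k0" using reals_Archimedean2 by blast
      have "g k z = 1" if "k \<ge> k0" for k
      proof -
        have "1 / infdist z (- U) \<le> real k" using k0 that by linarith
        hence "1 \<le> real k * infdist z (- U)" using pos by (simp add: divide_le_eq)
        thus ?thesis by (simp add: g_def)
      qed
      hence "\<forall>\<^sub>F k in sequentially. g k z = indicator U z"
        using True unfolding eventually_sequentially by auto
      thus ?thesis by (rule tendsto_eventually)
    next
      case z: False
      thus ?thesis by (simp add: g_def)
    qed
  qed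
qed

text \<open>Dynkin's argument: open sets are an intersection-stable generator, and approximability
  passes to complements and to countable disjoint unions.\<close>

lemma cont_approx_indicator:
  assumes "A \<in> sets borel"
  shows "cont_approx \<M> (indicator A)"
proof -
  have "Int_stable {S :: 'a set. open S}" "{S :: 'a set. open S} \<subseteq> Pow UNIV" "A \<in> sigma_sets UNIV {S. open S}"
    using assms by (auto simp: Int_stable_def borel_def)
  thus ?thesis
  proof (induction rule: sigma_sets_induct_disjoint[consumes 3, case_names basic empty compl union])
    case (basic A)
    thus ?case using cont_approx_open by simp
  next
    case empty
    show ?case by (rule cont_approx_open[OF open_empty])
  next
    case (compl A)
    have m: "A \<in> sets borel" using compl by (simp add: borel_def)
    have "cont_approx \<M> (\<lambda>z. 1 + (-1) * indicator A z)"
      using m by (intro cont_approx_add[of _ 1 _ 1] cont_approx_cmult compl cont_approx_continuous)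
        (auto simp: indicator_def)
    moreover have "(\<lambda>z. 1 + (-1) * indicator A z) = (indicator (UNIV - A) :: _ \<Rightarrow> real)"
      by (auto simp: indicator_def)
    ultimately show ?case by simp
  next
    case (union A)
    have m: "A i \<in> sets borel" for i using union by (auto simp: borel_def)
    define g :: "nat \<Rightarrow> 'a \<Rightarrow> real" where "g k z = (\<Sum>i<k. indicator (A i) z)" for k z
    have g: "g k = indicator (\<Union>i<k. A i)" for k
      using union(1) unfolding g_def by (auto simp: indicator_UN_disjoint disjoint_family_on_def)
    have gm: "g k \<in> borel_measurable borel" for k
      unfolding g_def using m by (intro borel_measurable_sum borel_measurable_indicator)
    have ib: "\<bar>indicat_real S z\<bar> \<le> 1" for S and z :: 'a by (simp add: indicator_def)
    have gb: "\<bar>g k z\<bar> \<le> 1" for k z unfolding g by (rule ib)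
    have ga: "cont_approx \<M> (g k)" for k
    proof (induction k)
      case 0
      have e: "g 0 = indicator {}" by (rule ext) (simp add: g_def)
      show ?case unfolding e by (rule cont_approx_open[OF open_empty])
    next
      case (Suc k)
      have "cont_approx \<M> (\<lambda>z. g k z + indicator (A k) z)"
        by (rule cont_approx_add[OF Suc.IH gm gb union.IH borel_measurable_indicator[OF m] ib])
      moreover have "g (Suc k) = (\<lambda>z. g k z + indicator (A k) z)" by (rule ext) (simp add: g_def)
      ultimately show ?case by simp
    qed
    have "(\<lambda>k. g k z) \<longlonglongrightarrow> indicator (\<Union>i. A i) z" for z
      unfolding g by (rule LIMSEQ_indicator_UN)
    thus ?case by (rule cont_approx_limit[OF ga gm gb])
  qed
qed

lemma cont_approx_bounded_borel:
  assumes F: "F \<in> borel_measurable borel" "\<And>z. 0 \<le> F z" "\<And>z. F z \<le> B"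
  shows "cont_approx \<M> F"
proof -
  \<comment> \<open>Boundedness is put into the induction statement because the induction runs over
    all nonnegative Borel functions; every constituent of a bounded function is again
    bounded.\<close>
  have "(\<exists>B. \<forall>z. F z \<le> B) \<longrightarrow> cont_approx \<M> F"
    using F(1,2)
  proof (induction F rule: borel_measurable_induct_real)
    case (set A)
    thus ?case using cont_approx_indicator by simp
  next
    case (mult u c)
    show ?case
    proof (intro impI)
      assume "\<exists>B. \<forall>z. c * u z \<le> B"
      then obtain B where B: "\<And>z. c * u z \<le> B" by blast
      show "cont_approx \<M> (\<lambda>z. c * u z)"
      proof (cases "c = 0")
        case True
        thus ?thesis using cont_approx_continuous[of "\<lambda>z. 0"] by auto
      next
        case False
        hence "u z \<le> B / c" for z using B[of z] mult(1) by (simp add: le_divide_eq mult.commute)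
        thus ?thesis using mult by (intro cont_approx_cmult) blast
      qed
    qed
  next
    case (add u v)
    show ?case
    proof (intro impI)
      assume "\<exists>B. \<forall>z. v z + u z \<le> B"
      then obtain B where B: "\<And>z. v z + u z \<le> B" by blast
      have b: "u z \<le> B" "v z \<le> B" for z using B[of z] add.hyps(2,4)[of z] by linarith+
      hence "cont_approx \<M> u" "cont_approx \<M> v" using add by blast+
      thus "cont_approx \<M> (\<lambda>z. v z + u z)"
        using add b by (intro cont_approx_add[of _ B _ B]) auto
    qed
  next
    case (seq U)
    show ?case
    proof (intro impI)
      assume "\<exists>B. \<forall>z. F z \<le> B"
      then obtain B where B: "\<And>z. F z \<le> B" by blast
      have UF: "U i z \<le> F z" for i z
      proof (rule LIMSEQ_le_const)
        show "(\<lambda>i. U i z) \<longlonglongrightarrow> F z" using seq by simp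
        show "\<exists>N. \<forall>n\<ge>N. U i z \<le> U n z"
          using \<open>incseq U\<close> by (intro exI[of _ i]) (auto simp: incseq_def le_fun_def)
      qed
      have UB: "U i z \<le> B" for i z using UF[of i z] B[of z] by linarith
      show "cont_approx \<M> F"
      proof (rule cont_approx_limit[of U B])
        show "cont_approx \<M> (U i)" for i using seq.IH[of i] UB by blast
        show "U i \<in> borel_measurable borel" for i by (rule seq.hyps(1))
        show "\<bar>U i z\<bar> \<le> B" for i z using UB[of i z] seq.hyps(2)[of i z] by simp
        show "(\<lambda>i. U i z) \<longlonglongrightarrow> F z" for z by (rule seq.hyps(4)) simp
      qed
    qed
  qed
  thus ?thesis using F(3) by blast
qed

end

text \<open>Multiplication by the phases cnj c^n conjugates S - c into the forward difference up to
  a phase, so the iterates of both have equal moduli.\<close>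

lemma fdiff_rotated:
  assumes c: "c * cnj c = 1"
  shows "(fdiff ^^ j) (\<lambda>n. cnj c ^ n * \<alpha> n) n = cnj c ^ (n + j) * (shift_minus c ^^ j) \<alpha> n"
proof (induction j arbitrary: n)
  case (Suc j)
  have c': "cnj c ^ (n + j) = cnj c ^ Suc (n + j) * c" using c by (simp add: mult_ac)
  have "(fdiff ^^ Suc j) (\<lambda>n. cnj c ^ n * \<alpha> n) n =
    cnj c ^ Suc (n + j) * (shift_minus c ^^ j) \<alpha> (Suc n) - cnj c ^ (n + j) * (shift_minus c ^^ j) \<alpha> n"
    by (simp add: fdiff_def Suc)
  also have "\<dots> = cnj c ^ Suc (n + j) * (shift_minus c ((shift_minus c ^^ j) \<alpha>) n)"
    unfolding c' by (simp only: shift_minus_def right_diff_distrib mult.assoc)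
  finally show ?case by simp
qed simp

text \<open>Rotating the argument by c compensates the phases of the coefficients, provided the
  start becomes cnj c. Consequently the products \<alpha>_n z b_n, and with them the factors of the
  reversed polynomials, do not change.\<close>

lemma schur_iter_rotated:
  assumes c: "c * cnj c = 1"
  shows "schur_iter (cnj c) (\<lambda>n. cnj c ^ n * \<alpha> n) n (c * z) = c ^ n * cnj c * schur_iter 1 \<alpha> n z"
proof (induction n)
  case (Suc n)
  define b where "b = schur_iter 1 \<alpha> n z"
  have cn: "cnj c ^ n * c ^ n = 1" using c by (simp add: power_mult_distrib[symmetric] mult.commute)
  have 1: "c * z * (c ^ n * cnj c * b) = c ^ n * (z * b)"
    using c by (simp add: mult_ac)
  have "cnj c ^ n * \<alpha> n * (c * z) * (c ^ n * cnj c * b) = (cnj c ^ n * c ^ n) * (\<alpha> n * (c * cnj c) * z * b)"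
    by (simp only: mult_ac)
  also have "\<dots> = \<alpha> n * z * b" by (simp add: cn c)
  finally have 2: "cnj c ^ n * \<alpha> n * (c * z) * (c ^ n * cnj c * b) = \<alpha> n * z * b" .
  have 3: "c ^ Suc n * cnj c = c ^ n" using c by (simp add: mult.assoc mult.left_commute)
  show ?case
    unfolding schur_iter.simps Suc b_def[symmetric] 1 2 3 by (simp add: right_diff_distrib)
qed simp

context nontrivial_circle_measure
begin

text \<open>Halving 1 - cos brings the weight into [0, 1], the range in which the entropy inequality
  is available.\<close>

lemma bernstein_szego_entropy_bounded:
  fixes \<theta> :: real and m :: nat
  assumes m: "1 \<le> m"
    and l2: "in_lp 2 ((shift_minus (cis (-\<theta>)) ^^ m) \<alpha>)" and lp: "in_lp (2 * m + 2) \<alpha>"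
  shows "\<exists>C. \<forall>N. integral {0..2*pi} (\<lambda>t. ((1 - cos (t - \<theta>)) / 2) ^ m * (- ln (bernstein_szego \<alpha> N (cis t)))) \<le> C"
proof -
  define c where "c = cis (-\<theta>)"
  have c: "c * cnj c = 1" "norm c = 1" by (simp_all add: c_def cis_cnj cis_mult)
  define a where "a = (\<lambda>n. cnj c ^ n * \<alpha> n)"
  have na: "norm (a n) = norm (\<alpha> n)" for n by (simp add: a_def norm_mult norm_power c)
  have "norm ((fdiff ^^ m) a n) = norm ((shift_minus c ^^ m) \<alpha> n)" for n
    unfolding a_def fdiff_rotated[OF c(1)] by (simp add: norm_mult norm_power c)
  hence s2: "summable (\<lambda>n. norm ((fdiff ^^ m) a n) ^ 2)" using l2 by (simp add: in_lp_def c_def)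
  have sp: "summable (\<lambda>n. norm (a n) ^ (2*m+2))" using lp by (simp only: in_lp_def na)
  have a1: "norm (a n) < 1" for n unfolding na by (rule verblunsky_less_1)
  have b1: "norm (cnj c) \<le> 1" using c by simp
  define L where "L N t = Re (\<Sum>n<N. Ln (1 - \<alpha> n * cis t * schur_iter 1 \<alpha> n (cis t)))" for N t
  define l where "l N = (\<Sum>n<N. ln (1 - (norm (\<alpha> n))\<^sup>2))" for N
  have L: "Re (\<Sum>n<N. Ln (1 - a n * circ \<theta> 1 t * schur_iter (cnj c) a n (circ \<theta> 1 t))) = L N t" for N t
  proof -
    have ct: "circ \<theta> 1 t = c * cis t" by (simp add: circ_def c_def cis_mult)
    have "a n * circ \<theta> 1 t * schur_iter (cnj c) a n (circ \<theta> 1 t) = \<alpha> n * cis t * schur_iter 1 \<alpha> n (cis t)" for n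
    proof -
      have cn: "cnj c ^ n * c ^ n = 1" using c(1) by (simp add: power_mult_distrib[symmetric] mult.commute)
      have "a n * circ \<theta> 1 t * schur_iter (cnj c) a n (circ \<theta> 1 t)
        = (cnj c ^ n * c ^ n) * (c * cnj c) * (\<alpha> n * cis t * schur_iter 1 \<alpha> n (cis t))"
        unfolding ct a_def schur_iter_rotated[OF c(1)] by (simp only: mult_ac)
      thus ?thesis by (simp only: cn c mult_1_left)
    qed
    thus ?thesis by (simp only: L_def)
  qed
  obtain C where C: "\<And>N. \<bar>2 * integral {0..2*pi} (\<lambda>t. (1 - cos (t - \<theta>)) ^ m * L N t)
      - integral {0..2*pi} (\<lambda>t. (1 - cos (t - \<theta>)) ^ m) * l N\<bar> \<le> C"
    using weighted_log_sum_bounded[where a=a and m=m and \<phi>=\<theta>, OF a1 b1 m sp s2] unfolding L na l_def by blast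
  have "integral {0..2*pi} (\<lambda>t. ((1 - cos (t - \<theta>)) / 2) ^ m * (- ln (bernstein_szego \<alpha> N (cis t)))) \<le> C / 2 ^ m" for N
  proof -
    have ln: "- ln (bernstein_szego \<alpha> N (cis t)) = 2 * L N t - l N" for t
      unfolding L_def l_def by (rule ln_bernstein_szego[OF verblunsky_less_1]) simp
    have ne: "bernstein_szego \<alpha> N (cis t) \<noteq> 0" for t
      using bernstein_szego_pos[where \<alpha>=\<alpha>, OF verblunsky_less_1, of "cis t" N] by simp
    have Lc: "continuous_on {0..2*pi} (L N)"
    proof -
      have "L N = (\<lambda>t. (- ln (bernstein_szego \<alpha> N (cis t)) + l N) / 2)" by (rule ext) (simp add: ln)
      thus ?thesis using ne
        by (simp only:) (intro continuous_intros continuous_on_bernstein_szego verblunsky_less_1; simp)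
    qed
    have i1: "(\<lambda>t. (1 - cos (t - \<theta>)) ^ m * L N t) integrable_on {0..2*pi}"
      by (intro integrable_continuous_interval continuous_intros Lc)
    have i2: "(\<lambda>t. (1 - cos (t - \<theta>)) ^ m) integrable_on {0..2*pi}"
      by (intro integrable_continuous_interval continuous_intros)
    have "((\<lambda>t. (2 * ((1 - cos (t - \<theta>)) ^ m * L N t) - (1 - cos (t - \<theta>)) ^ m * l N) * (1 / 2 ^ m)) has_integral
      (2 * integral {0..2*pi} (\<lambda>t. (1 - cos (t - \<theta>)) ^ m * L N t) - integral {0..2*pi} (\<lambda>t. (1 - cos (t - \<theta>)) ^ m) * l N) * (1 / 2 ^ m)) {0..2*pi}"
      by (intro has_integral_mult_left has_integral_diff has_integral_mult_right integrable_integral i1 i2)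
    moreover have "(2 * ((1 - cos (t - \<theta>)) ^ m * L N t) - (1 - cos (t - \<theta>)) ^ m * l N) * (1 / 2 ^ m)
       = ((1 - cos (t - \<theta>)) / 2) ^ m * (- ln (bernstein_szego \<alpha> N (cis t)))" for t
      unfolding ln power_divide by (simp add: field_simps)
    ultimately have "integral {0..2*pi} (\<lambda>t. ((1 - cos (t - \<theta>)) / 2) ^ m * (- ln (bernstein_szego \<alpha> N (cis t))))
      = (2 * integral {0..2*pi} (\<lambda>t. (1 - cos (t - \<theta>)) ^ m * L N t) - integral {0..2*pi} (\<lambda>t. (1 - cos (t - \<theta>)) ^ m) * l N) * (1 / 2 ^ m)"
      by (simp only: integral_unique)
    also have "\<dots> \<le> C * (1 / 2 ^ m)" using C[of N] by (intro mult_right_mono) auto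
    finally show ?thesis by simp
  qed
  thus ?thesis by blast
qed

end

section \<open>Arc length on the circle, and the entropy bound for bounded Borel functions\<close>

definition circle_lborel :: "complex measure" where
  "circle_lborel = distr (density lborel (\<lambda>t. indicator {0..2*pi} t)) borel cis"

lemma cis_borel: "cis \<in> borel_measurable borel"
  by (intro borel_measurable_continuous_onI continuous_intros)

lemma nn_integral_circle_lborel:
  assumes "f \<in> borel_measurable borel"
  shows "(\<integral>\<^sup>+z. f z \<partial>circle_lborel) = (\<integral>\<^sup>+t. indicator {0..2*pi} t * f (cis t) \<partial>lborel)"
  unfolding circle_lborel_def using assms cis_borel
  by (subst nn_integral_distr) (auto simp: nn_integral_density)

lemma integral_circle_lborel:
  fixes f :: "complex \<Rightarrow> real"
  assumes f: "f \<in> borel_measurable borel"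
  shows "(\<integral>z. f z \<partial>circle_lborel) = (LINT t:{0..2*pi}|lborel. f (cis t))"
proof -
  have fc: "(\<lambda>t. f (cis t)) \<in> borel_measurable borel" using f cis_borel by measurable
  have "(\<integral>z. f z \<partial>circle_lborel) = (\<integral>t. f (cis t) \<partial>density lborel (\<lambda>t. ennreal (indicator {0..2*pi} t)))"
    unfolding circle_lborel_def using f cis_borel by (subst integral_distr) (auto simp: ennreal_indicator)
  also have "\<dots> = (LINT t:{0..2*pi}|lborel. f (cis t))"
    unfolding set_lebesgue_integral_def using fc by (subst integral_density) auto
  finally show ?thesis .
qed

lemma finite_circle_lborel: "finite_measure circle_lborel"
proof
  have "emeasure circle_lborel (space circle_lborel) = (\<integral>\<^sup>+z. 1 \<partial>circle_lborel)" by simp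
  also have "\<dots> = (\<integral>\<^sup>+t. indicator {0..2*pi} t \<partial>lborel)" by (subst nn_integral_circle_lborel) auto
  also have "\<dots> = emeasure lborel {0..2*pi}" by (intro nn_integral_indicator) auto
  also have "\<dots> < \<infinity>" by simp
  finally show "emeasure circle_lborel (space circle_lborel) \<noteq> \<infinity>" by simp
qed

lemma set_integrable_bounded_interval:
  fixes h :: "real \<Rightarrow> real"
  assumes "h \<in> borel_measurable borel" "\<And>t. \<bar>h t\<bar> \<le> B"
  shows "set_integrable lborel {a..b} h"
  unfolding set_integrable_def
  by (rule integrableI_bounded_set_indicator[of _ _ _ B]) (use assms in \<open>auto simp: emeasure_lborel_Icc_eq\<close>)

context nontrivial_circle_measure
begin

lemma finite_borel_measures_circle: "finite_borel_measures {\<mu>, circle_lborel}"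
proof (rule finite_borel_measures.intro)
  fix M assume "M \<in> {\<mu>, circle_lborel}"
  hence M: "M = \<mu> \<or> M = circle_lborel" by blast
  have "finite_measure \<mu>" by unfold_locales
  thus "finite_measure M" using M finite_circle_lborel by blast
  have "sets circle_lborel = sets borel" by (simp add: circle_lborel_def)
  thus "sets M = sets borel" using M sets_mu by blast
qed simp

text \<open>The density w is merely measurable, so continuous test functions do not suffice. On
  [1, B] the logarithm is 1-Lipschitz; hence approximation in L1 of arc length controls the left
  side and approximation in L1 of \<mu> the right side.\<close>

lemma entropy_bound_borel:
  fixes \<omega> :: "real \<Rightarrow> real"
  assumes \<omega>: "continuous_on UNIV \<omega>" "\<And>t. 0 \<le> \<omega> t" "\<And>t. \<omega> t \<le> 1"
    and C: "\<And>N. integral {0..2*pi} (\<lambda>t. \<omega> t * (- ln (bernstein_szego \<alpha> N (cis t)))) \<le> C"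
    and F: "F \<in> borel_measurable borel" "\<And>z. 1 \<le> F z" "\<And>z. F z \<le> B"
  shows "(LINT t:{0..2*pi}|lborel. \<omega> t * ln (F (cis t))) \<le> 4 * pi * (\<integral>z. F z \<partial>\<mu>) + (C + 2 * pi * ln 2)"
proof (rule field_le_epsilon)
  fix e :: real assume e: "e > 0"
  \<comment> \<open>4 \<pi> \<epsilon> is lost in the integral against \<mu>, and \<epsilon> in the
    integral over the angle.\<close>
  define \<epsilon> where "\<epsilon> = e / (4 * pi + 1)"
  have K: "4 * pi + 1 > 0" by (simp add: add_pos_pos)
  have "(4 * pi + 1) * \<epsilon> = e" unfolding \<epsilon>_def times_divide_eq_right
    by (rule nonzero_mult_div_cancel_left) (use K in linarith)
  hence \<epsilon>2: "4 * pi * \<epsilon> + \<epsilon> = e" by (simp only: distrib_right mult_1_left)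
  have \<epsilon>: "\<epsilon> > 0" unfolding \<epsilon>_def using e K by (rule divide_pos_pos)
  interpret fb: finite_borel_measures "{\<mu>, circle_lborel}"
    by (rule finite_borel_measures_circle)
  have "cont_approx {\<mu>, circle_lborel} F"
    by (rule fb.cont_approx_bounded_borel[OF F(1) _ F(3)]) (use F(2) in \<open>smt (verit)\<close>)
  then obtain g where g: "continuous_on UNIV g" "bounded (range g)"
    "(\<integral>z. \<bar>F z - g z\<bar> \<partial>\<mu>) < \<epsilon>" "(\<integral>z. \<bar>F z - g z\<bar> \<partial>circle_lborel) < \<epsilon>"
    using \<epsilon> unfolding cont_approx_def by auto
  obtain b where b: "\<And>z. \<bar>g z\<bar> \<le> b" using fb.bounded_range_abs[OF g(2)] by blast
  \<comment> \<open>Clamping g to [1, B], where F takes its values, cannot increase the distance to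
    F.\<close>
  define f where "f z = max 1 (min B (g z))" for z
  have B1: "1 \<le> B" using F(2,3)[of 0] by linarith
  have f: "continuous_on UNIV f" "\<And>z. 1 \<le> f z" "\<And>z. f z \<le> B" "\<And>z. \<bar>F z - f z\<bar> \<le> \<bar>F z - g z\<bar>"
  proof -
    show "continuous_on UNIV f" unfolding f_def[abs_def] by (intro continuous_intros g)
    show "1 \<le> f z" "f z \<le> B" for z using B1 by (auto simp: f_def)
    show "\<bar>F z - f z\<bar> \<le> \<bar>F z - g z\<bar>" for z using F(2,3)[of z] by (auto simp: f_def max_def min_def)
  qed
  have m: "f \<in> borel_measurable borel" "g \<in> borel_measurable borel" "\<omega> \<in> borel_measurable borel"
    using f(1) g(1) \<omega>(1) by (auto intro: borel_measurable_continuous_onI)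
  have FB: "\<bar>F z\<bar> \<le> B" "\<bar>f z\<bar> \<le> B" for z using F(2,3)[of z] f(2,3)[of z] by auto
  have small: "(\<integral>z. \<bar>F z - f z\<bar> \<partial>M) < \<epsilon>" if "M \<in> {\<mu>, circle_lborel}" for M
  proof -
    have "(\<integral>z. \<bar>F z - f z\<bar> \<partial>M) \<le> (\<integral>z. \<bar>F z - g z\<bar> \<partial>M)"
      by (intro integral_mono fb.integrable_abs_diff[OF that F(1) m(1) FB] fb.integrable_abs_diff[OF that F(1) m(2) FB(1) b] f)
    thus ?thesis using g(3,4) that by auto
  qed
  have bd: "\<bar>\<omega> t * ln x\<bar> \<le> ln B" if "1 \<le> x" "x \<le> B" for t x
  proof -
    have "\<bar>ln x\<bar> \<le> ln B" using that by simp
    hence "\<bar>\<omega> t * ln x\<bar> \<le> 1 * ln B"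
      unfolding abs_mult using \<omega>(2,3)[of t] by (intro mult_mono) auto
    thus ?thesis by simp
  qed
  have iF: "set_integrable lborel {0..2*pi} (\<lambda>t. \<omega> t * ln (F (cis t)))"
  proof (rule set_integrable_bounded_interval)
    show "(\<lambda>t. \<omega> t * ln (F (cis t))) \<in> borel_measurable borel" using m F(1) cis_borel by measurable
  qed (rule bd[OF F(2,3)])
  have if': "set_integrable lborel {0..2*pi} (\<lambda>t. \<omega> t * ln (f (cis t)))"
  proof (rule set_integrable_bounded_interval)
    show "(\<lambda>t. \<omega> t * ln (f (cis t))) \<in> borel_measurable borel" using m cis_borel by measurable
  qed (rule bd[OF f(2,3)])
  have id: "set_integrable lborel {0..2*pi} (\<lambda>t. \<bar>F (cis t) - f (cis t)\<bar>)"
  proof (rule set_integrable_bounded_interval)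
    show "(\<lambda>t. \<bar>F (cis t) - f (cis t)\<bar>) \<in> borel_measurable borel" using m F(1) cis_borel by measurable
    show "\<bar>\<bar>F (cis t) - f (cis t)\<bar>\<bar> \<le> B + B" for t using FB[of "cis t"] by linarith
  qed
  have pt: "\<omega> t * ln (F z) \<le> \<omega> t * ln (f z) + \<bar>F z - f z\<bar>" for t z
  proof -
    have fz: "f z \<ge> 1" "F z \<ge> 1" using f(2) F(2) by auto
    have "ln (F z) - ln (f z) = ln (F z / f z)" using fz by (simp add: ln_div)
    also have "\<dots> \<le> F z / f z - 1" using fz by (intro ln_le_minus_one) auto
    also have "\<dots> = (F z - f z) / f z" using fz by (simp add: field_simps)
    also have "\<dots> \<le> \<bar>F z - f z\<bar> / f z" using fz by (intro divide_right_mono) auto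
    also have "\<dots> \<le> \<bar>F z - f z\<bar> / 1" using fz by (intro divide_left_mono) auto
    finally have "\<omega> t * (ln (F z) - ln (f z)) \<le> \<omega> t * \<bar>F z - f z\<bar>" using \<omega>(2) by (intro mult_left_mono) auto
    also have "\<dots> \<le> 1 * \<bar>F z - f z\<bar>" using \<omega>(3) by (intro mult_right_mono) auto
    finally show ?thesis by (simp add: right_diff_distrib)
  qed
  define IF where "IF = (\<integral>z. F z \<partial>\<mu>)"
  define If where "If = (\<integral>z. f z \<partial>\<mu>)"
  define JF where "JF = (LINT t:{0..2*pi}|lborel. \<omega> t * ln (F (cis t)))"
  define Jf where "Jf = (LINT t:{0..2*pi}|lborel. \<omega> t * ln (f (cis t)))"
  define D where "D = (LINT t:{0..2*pi}|lborel. \<bar>F (cis t) - f (cis t)\<bar>)"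
  have "JF \<le> (LINT t:{0..2*pi}|lborel. \<omega> t * ln (f (cis t)) + \<bar>F (cis t) - f (cis t)\<bar>)"
    unfolding JF_def by (intro set_integral_mono iF set_integral_add if' id pt)
  hence 1: "JF \<le> Jf + D" unfolding Jf_def D_def set_integral_add(2)[OF if' id] .
  have "(\<lambda>z. \<bar>F z - f z\<bar>) \<in> borel_measurable borel" using F(1) m by measurable
  from integral_circle_lborel[OF this] small[of circle_lborel] have 2: "D < \<epsilon>" by (simp add: D_def)
  have "integral {0..2*pi} (\<lambda>t. \<omega> t * ln (f (cis t))) \<le> 4 * pi * If + (C + 2 * pi * ln 2)"
    unfolding If_def
    by (rule entropy_bound_continuous[OF continuous_on_subset[OF \<omega>(1) subset_UNIV] \<omega>(2,3) C f(1,2)])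
  hence 3: "Jf \<le> 4 * pi * If + (C + 2 * pi * ln 2)"
    unfolding Jf_def set_borel_integral_eq_integral(2)[OF if'] .
  have mu: "\<mu> \<in> {\<mu>, circle_lborel}" by simp
  have iFm: "integrable \<mu> F" by (rule fb.integrable_bounded[OF mu F(1) FB(1)])
  have ifm: "integrable \<mu> f" by (rule fb.integrable_bounded[OF mu m(1) FB(2)])
  have idm: "integrable \<mu> (\<lambda>z. \<bar>F z - f z\<bar>)" by (rule fb.integrable_abs_diff[OF mu F(1) m(1) FB])
  have "If \<le> (\<integral>z. F z + \<bar>F z - f z\<bar> \<partial>\<mu>)" unfolding If_def
    by (intro integral_mono ifm Bochner_Integration.integrable_add iFm idm) linarith
  also have "\<dots> = IF + (\<integral>z. \<bar>F z - f z\<bar> \<partial>\<mu>)" unfolding IF_def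
    by (rule Bochner_Integration.integral_add[OF iFm idm])
  finally have "If \<le> IF + \<epsilon>" using small[OF mu] by linarith
  hence "4 * pi * If \<le> 4 * pi * (IF + \<epsilon>)" by (intro mult_left_mono) auto
  hence "4 * pi * If \<le> 4 * pi * IF + 4 * pi * \<epsilon>" by (simp only: distrib_left)
  hence "JF \<le> 4 * pi * IF + (C + 2 * pi * ln 2) + e" using 1 2 3 \<epsilon>2 by linarith
  thus "(LINT t:{0..2*pi}|lborel. \<omega> t * ln (F (cis t))) \<le> 4 * pi * (\<integral>z. F z \<partial>\<mu>) + (C + 2 * pi * ln 2) + e"
    unfolding JF_def IF_def .
qed

end

section \<open>From the circle back to the density w\<close>

lemma Arg2pi_borel_measurable: "Arg2pi \<in> borel_measurable borel"
proof -
  have "(\<lambda>z. if z \<in> \<real>\<^sub>\<ge>\<^sub>0 then 0 else Arg2pi z) \<in> borel_measurable borel"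
  proof (rule borel_measurable_continuous_on_if)
    show "\<real>\<^sub>\<ge>\<^sub>0 \<in> sets (borel :: complex measure)" by (intro borel_closed closed_nonneg_Reals_complex)
    show "continuous_on (- \<real>\<^sub>\<ge>\<^sub>0) Arg2pi"
      by (intro continuous_at_imp_continuous_on ballI continuous_at_Arg2pi) auto
  qed auto
  moreover have "(\<lambda>z. if z \<in> \<real>\<^sub>\<ge>\<^sub>0 then 0 else Arg2pi z) = Arg2pi"
    by (auto simp: fun_eq_iff Arg2pi_eq_0 complex_nonneg_Reals_iff complex_is_Real_iff)
  ultimately show ?thesis by simp
qed

lemma Arg2pi_cis: "0 \<le> t \<Longrightarrow> t < 2 * pi \<Longrightarrow> Arg2pi (cis t) = t"
  by (rule Arg2pi_unique[of 1]) (auto simp: cis_conv_exp)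

text \<open>N carries the singular part and F is at most 1 there, while off N only the density
  contributes. The constant 3 is 1 for the total mass of \<mu> plus 2 from integrating (1 + w) / (2
  \<pi>) over a period.\<close>

lemma lebesgue_decomp_nn_integral_le:
  assumes dec: "lebesgue_decomp \<mu> w \<mu>s" and \<mu>: "sets \<mu> = sets borel" "emeasure \<mu> UNIV = 1"
    and N: "N \<in> sets borel" "emeasure \<mu>s (UNIV - N) = 0"
    and F: "F \<in> borel_measurable borel" "\<And>z. 0 \<le> F z" "\<And>z. z \<in> N \<Longrightarrow> F z \<le> 1"
      "\<And>t. 0 \<le> t \<Longrightarrow> t < 2*pi \<Longrightarrow> cis t \<notin> N \<Longrightarrow> w t * F (cis t) \<le> 1 + w t"
  shows "(\<integral>\<^sup>+z. ennreal (F z) \<partial>\<mu>) \<le> 3" "(\<integral>\<^sup>+t. indicator {0..<2*pi} t * ennreal (w t) \<partial>lborel) \<le> ennreal (2 * pi)"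
proof -
  have w: "w \<in> borel_measurable borel" "\<And>t. 0 \<le> w t" and s: "sets \<mu>s = sets borel"
    and em: "\<And>A. A \<in> sets borel \<Longrightarrow> emeasure \<mu> A =
      (\<integral>\<^sup>+t. ennreal (w t / (2 * pi)) * indicator {0..<2*pi} t * indicator A (cis t) \<partial>lborel) + emeasure \<mu>s A"
    using dec by (auto simp: lebesgue_decomp_def)
  define h where "h t = ennreal (w t / (2 * pi)) * indicator {0..<2*pi} t" for t
  have hm: "h \<in> borel_measurable lborel" unfolding h_def using w by measurable
  define \<kappa> where "\<kappa> = distr (density lborel h) borel cis"
  have \<kappa>: "(\<integral>\<^sup>+z. f z \<partial>\<kappa>) = (\<integral>\<^sup>+t. h t * f (cis t) \<partial>lborel)" if f: "f \<in> borel_measurable borel" for f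
    unfolding \<kappa>_def using f cis_borel hm by (subst nn_integral_distr) (auto simp: nn_integral_density)
  have em\<kappa>: "emeasure \<mu> A = emeasure \<kappa> A + emeasure \<mu>s A" if A: "A \<in> sets borel" for A
  proof -
    have "emeasure \<kappa> A = (\<integral>\<^sup>+z. indicator A z \<partial>\<kappa>)" using A by (simp add: \<kappa>_def)
    also have "\<dots> = (\<integral>\<^sup>+t. h t * indicator A (cis t) \<partial>lborel)" using A by (intro \<kappa>) auto
    finally show ?thesis unfolding em[OF A] h_def by simp
  qed
  have "emeasure \<kappa> UNIV \<le> emeasure \<mu> UNIV" unfolding em\<kappa>[of UNIV, simplified] by simp
  moreover have "emeasure \<kappa> UNIV = (\<integral>\<^sup>+t. h t \<partial>lborel)"
    using \<kappa>[of "\<lambda>z. 1"] by (simp add: \<kappa>_def)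
  ultimately have h1: "(\<integral>\<^sup>+t. h t \<partial>lborel) \<le> 1" using \<mu>(2) by simp
  have "(\<integral>\<^sup>+t. indicator {0..<2*pi} t * ennreal (w t) \<partial>lborel) = (\<integral>\<^sup>+t. ennreal (2 * pi) * h t \<partial>lborel)"
    by (intro nn_integral_cong) (simp add: h_def indicator_def ennreal_mult[symmetric] w)
  also have "\<dots> = ennreal (2 * pi) * (\<integral>\<^sup>+t. h t \<partial>lborel)" by (rule nn_integral_cmult[OF hm])
  also have "\<dots> \<le> ennreal (2 * pi) * 1" using h1 by (intro mult_left_mono) auto
  finally show "(\<integral>\<^sup>+t. indicator {0..<2*pi} t * ennreal (w t) \<partial>lborel) \<le> ennreal (2 * pi)" by simp
  have dens: "density \<mu> (indicator (-N)) = density \<kappa> (indicator (-N))"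
  proof (rule measure_eqI)
    fix A assume "A \<in> sets (density \<mu> (indicator (-N)))"
    hence A: "A \<in> sets borel" by (simp add: \<mu>)
    have "emeasure \<mu>s (- N \<inter> A) \<le> emeasure \<mu>s (UNIV - N)" using N A by (intro emeasure_mono) (auto simp: s)
    hence z: "emeasure \<mu>s (- N \<inter> A) = 0" using N by simp
    have "emeasure (density \<mu> (indicator (-N))) A = emeasure \<mu> (- N \<inter> A)"
      using N A \<mu> by (intro emeasure_restricted) auto
    also have "\<dots> = emeasure \<kappa> (- N \<inter> A)" using em\<kappa>[of "- N \<inter> A"] N A z by simp
    also have "\<dots> = emeasure (density \<kappa> (indicator (-N))) A"
      using N A by (intro emeasure_restricted[symmetric]) (auto simp: \<kappa>_def)
    finally show "emeasure (density \<mu> (indicator (-N))) A = emeasure (density \<kappa> (indicator (-N))) A" .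
  qed (simp add: \<mu> \<kappa>_def)
  have NF: "indicator (-N) \<in> borel_measurable M" "(\<lambda>z. ennreal (F z)) \<in> borel_measurable M" if "sets M = sets borel" for M :: "complex measure"
    using N F(1) that measurable_cong_sets[OF that refl, of "borel :: ennreal measure"] by auto
  have \<kappa>s: "sets \<kappa> = sets borel" by (simp add: \<kappa>_def)
  have "(\<integral>\<^sup>+z. indicator (-N) z * ennreal (F z) \<partial>\<mu>) = (\<integral>\<^sup>+z. ennreal (F z) \<partial>density \<mu> (indicator (-N)))"
    by (rule nn_integral_density[OF NF[OF \<mu>(1)], symmetric])
  also have "\<dots> = (\<integral>\<^sup>+z. indicator (-N) z * ennreal (F z) \<partial>\<kappa>)"
    unfolding dens by (rule nn_integral_density[OF NF[OF \<kappa>s]])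
  also have "\<dots> = (\<integral>\<^sup>+t. h t * (indicator (-N) (cis t) * ennreal (F (cis t))) \<partial>lborel)"
    by (rule \<kappa>) (use NF[OF refl] in measurable)
  also have "\<dots> \<le> (\<integral>\<^sup>+t. ennreal (1 / (2 * pi)) * indicator {0..2*pi} t + h t \<partial>lborel)"
  proof (rule nn_integral_mono)
    fix t
    show "h t * (indicator (-N) (cis t) * ennreal (F (cis t))) \<le> ennreal (1 / (2 * pi)) * indicator {0..2*pi} t + h t"
    proof (cases "t \<in> {0..<2*pi} \<and> cis t \<notin> N")
      case True
      have "w t / (2 * pi) * F (cis t) = (w t * F (cis t)) / (2 * pi)" by simp
      also have "\<dots> \<le> (1 + w t) / (2 * pi)" using F(4)[of t] True by (intro divide_right_mono) auto
      finally have "ennreal (w t / (2 * pi) * F (cis t)) \<le> ennreal (1 / (2 * pi) + w t / (2 * pi))"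
        by (intro ennreal_leI) (simp add: add_divide_distrib)
      moreover have "h t * (indicator (-N) (cis t) * ennreal (F (cis t))) = ennreal (w t / (2 * pi) * F (cis t))"
        by (subst ennreal_mult) (use True w F(2) in \<open>auto simp: h_def\<close>)
      moreover have "ennreal (1 / (2 * pi)) * indicator {0..2*pi} t + h t = ennreal (1 / (2 * pi) + w t / (2 * pi))"
        by (subst ennreal_plus) (use True w in \<open>auto simp: h_def\<close>)
      ultimately show ?thesis by simp
    qed (auto simp: h_def)
  qed
  also have "\<dots> = (\<integral>\<^sup>+t. ennreal (1 / (2 * pi)) * indicator {0..2*pi} t \<partial>lborel) + (\<integral>\<^sup>+t. h t \<partial>lborel)"
    using hm by (intro nn_integral_add) auto
  also have "(\<integral>\<^sup>+t. ennreal (1 / (2 * pi)) * indicator {0..2*pi} t \<partial>lborel) = ennreal (1 / (2 * pi)) * emeasure lborel {0..2*pi}"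
    by (rule nn_integral_cmult_indicator) auto
  also have "\<dots> = 1" by (simp add: ennreal_mult[symmetric])
  also have "1 + (\<integral>\<^sup>+t. h t \<partial>lborel) \<le> 1 + 1" using h1 by (intro add_mono) auto
  finally have off: "(\<integral>\<^sup>+z. indicator (-N) z * ennreal (F z) \<partial>\<mu>) \<le> 2" by simp
  have "(\<integral>\<^sup>+z. ennreal (F z) \<partial>\<mu>) \<le> (\<integral>\<^sup>+z. 1 + indicator (-N) z * ennreal (F z) \<partial>\<mu>)"
  proof (rule nn_integral_mono)
    fix z
    show "ennreal (F z) \<le> 1 + indicator (-N) z * ennreal (F z)"
      using F(3)[of z] by (cases "z \<in> N") (auto simp: ennreal_le_1 add_increasing)
  qed
  also have "\<dots> = (\<integral>\<^sup>+z. 1 \<partial>\<mu>) + (\<integral>\<^sup>+z. indicator (-N) z * ennreal (F z) \<partial>\<mu>)"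
  proof (rule nn_integral_add)
    show "(\<lambda>z. indicator (-N) z * ennreal (F z)) \<in> borel_measurable \<mu>" using NF[OF \<mu>(1)] by measurable
  qed simp
  also have "\<dots> \<le> 1 + 2" using off \<mu> sets_eq_imp_space_eq[OF \<mu>(1)] by (intro add_mono) auto
  finally show "(\<integral>\<^sup>+z. ennreal (F z) \<partial>\<mu>) \<le> 3" by simp
qed

text \<open>Since \<open>ln\<close> is total, integrability by itself would say nothing about the
  points where w vanishes; the first conjunct confines them to a null set. The positive part of ln w
  is dominated by w, so the lower bound is equivalent to absolute integrability.\<close>

theorem theorem13:
  fixes \<mu> \<mu>s :: "complex measure" and w :: "real \<Rightarrow> real"
    and \<theta>1 :: real and m1 :: nat
  assumes "nontrivial_circle_prob \<mu>"
    and "lebesgue_decomp \<mu> w \<mu>s"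
    and "0 \<le> \<theta>1" and "\<theta>1 < 2 * pi"
    and "1 \<le> m1"
    and "in_lp 2 ((shift_minus (cis (-\<theta>1)) ^^ m1) (verblunsky \<mu>))"
    and "in_lp (2 * m1 + 2) (verblunsky \<mu>)"
  shows "(AE \<theta> in lborel. \<theta> \<in> {0..2*pi} \<longrightarrow> w \<theta> > 0) \<and>
         set_integrable lborel {0..2*pi} (\<lambda>\<theta>. (1 - cos (\<theta> - \<theta>1)) ^ m1 * ln (w \<theta>))"
proof -
  interpret nontrivial_circle_measure \<mu> by unfold_locales (rule assms(1))
  define \<omega> where "\<omega> t = ((1 - cos (t - \<theta>1)) / 2) ^ m1" for t
  have \<omega>: "continuous_on UNIV \<omega>" "0 \<le> \<omega> t" "\<omega> t \<le> 1" for t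
  proof -
    show "continuous_on UNIV \<omega>" unfolding \<omega>_def[abs_def] by (intro continuous_intros) auto
    have "0 \<le> (1 - cos (t - \<theta>1)) / 2" "(1 - cos (t - \<theta>1)) / 2 \<le> 1"
      using cos_le_one[of "t - \<theta>1"] cos_ge_minus_one[of "t - \<theta>1"] by auto
    thus "0 \<le> \<omega> t" "\<omega> t \<le> 1" unfolding \<omega>_def by (auto intro: power_le_one)
  qed
  obtain C where C: "\<And>N. integral {0..2*pi} (\<lambda>t. \<omega> t * (- ln (bernstein_szego \<alpha> N (cis t)))) \<le> C"
    using bernstein_szego_entropy_bounded[OF assms(5,6,7)] unfolding \<omega>_def by blast
  have w: "w \<in> borel_measurable borel" "\<And>t. 0 \<le> w t"
    using assms(2) by (auto simp: lebesgue_decomp_def)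
  obtain N where N: "N \<in> sets borel" "emeasure \<mu>s (UNIV - N) = 0" "emeasure lborel {t\<in>{0..<2*pi}. cis t \<in> N} = 0"
    using assms(2) by (auto simp: lebesgue_decomp_def)
  have total: "emeasure \<mu> UNIV = 1"
    using emeasure_space_1 sets_eq_imp_space_eq[OF sets_mu] by simp
  \<comment> \<open>A truncation of 1 / min 1 x to [1, k + 1]: ln (v k x) increases to the negative
    part of ln x, while x * v k x stays below 1 + x, so the integral of v k (w) against the
    absolutely continuous part is bounded uniformly in k.\<close>
  define v where "v k x = 1 / max (1 / real (Suc k)) (min 1 x)" for k and x :: real
  have v: "1 \<le> v k x" "v k x \<le> real (Suc k)" "x \<ge> 0 \<Longrightarrow> x * v k x \<le> 1 + x" for k x
  proof -
    define y where "y = max (1 / real (Suc k)) (min 1 x)"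
    have y: "0 < y" "y \<le> 1" "1 / real (Suc k) \<le> y" by (auto simp: y_def less_max_iff_disj)
    have vy: "v k x = 1 / y" by (simp add: v_def y_def)
    show "1 \<le> v k x" using y by (simp add: vy)
    show "v k x \<le> real (Suc k)" using y by (simp add: vy field_simps)
    assume x: "x \<ge> 0"
    have "x \<le> (1 + x) * y"
    proof (cases "x \<le> 1")
      case True
      hence "1 * x \<le> (1 + x) * y" using x y by (intro mult_mono) (auto simp: y_def)
      thus ?thesis by simp
    next
      case False
      hence "y = 1" by (auto simp: y_def)
      thus ?thesis by simp
    qed
    thus "x * v k x \<le> 1 + x" using y by (simp add: vy divide_le_eq)
  qed
  have vm: "v k \<in> borel_measurable borel" for k unfolding v_def[abs_def] by measurable
  \<comment> \<open>The value 1 on N hides the singular part from the test function; N meets the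
    circle in a set of angles of measure zero, so the integral over the angle is unaffected.\<close>
  define F where "F k z = (if z \<in> N then 1 else v k (w (Arg2pi z)))" for k z
  have F: "F k \<in> borel_measurable borel" "1 \<le> F k z" "F k z \<le> real (Suc k)" for k z
  proof -
    have "(\<lambda>z. v k (w (Arg2pi z))) \<in> borel_measurable borel"
      using vm w(1) Arg2pi_borel_measurable by measurable
    thus "F k \<in> borel_measurable borel" unfolding F_def[abs_def] using N(1) by measurable
    show "1 \<le> F k z" "F k z \<le> real (Suc k)" using v by (auto simp: F_def)
  qed
  have Fcis: "F k (cis t) = v k (w t)" if "0 \<le> t" "t < 2 * pi" "cis t \<notin> N" for k t
    using that by (simp add: F_def Arg2pi_cis)
  have IF: "(\<integral>z. F k z \<partial>\<mu>) \<le> 3" and nw: "(\<integral>\<^sup>+t. indicator {0..<2*pi} t * ennreal (w t) \<partial>lborel) \<le> ennreal (2 * pi)" for k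
  proof -
    have pre: "0 \<le> F k z" "z \<in> N \<Longrightarrow> F k z \<le> 1" for z
      using F(2)[of k z] by (auto simp: F_def)
    have pre2: "w t * F k (cis t) \<le> 1 + w t" if "0 \<le> t" "t < 2 * pi" "cis t \<notin> N" for t
      using v(3)[of "w t" k] w(2)[of t] by (simp add: Fcis[OF that])
    have "(\<integral>\<^sup>+z. ennreal (F k z) \<partial>\<mu>) \<le> 3"
      by (rule lebesgue_decomp_nn_integral_le(1)[OF assms(2) sets_mu total N(1,2) F(1) pre pre2])
    moreover have "(\<integral>\<^sup>+z. ennreal (F k z) \<partial>\<mu>) = ennreal (\<integral>z. F k z \<partial>\<mu>)"
    proof (rule nn_integral_eq_integral)
      show "integrable \<mu> (F k)"
      proof (rule finite_borel_measures.integrable_bounded[OF finite_borel_measures_circle _ F(1)])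
        show "\<bar>F k z\<bar> \<le> real (Suc k)" for z using F(2,3)[of k z] by linarith
      qed simp
    qed (use pre in auto)
    ultimately show "(\<integral>z. F k z \<partial>\<mu>) \<le> 3" by (metis ennreal_le_iff ennreal_numeral zero_le_numeral)
    show "(\<integral>\<^sup>+t. indicator {0..<2*pi} t * ennreal (w t) \<partial>lborel) \<le> ennreal (2 * pi)"
      by (rule lebesgue_decomp_nn_integral_le(2)[OF assms(2) sets_mu total N(1,2) F(1) pre pre2])
  qed
  define K where "K = 4 * pi * 3 + (C + 2 * pi * ln 2)"
  define g where "g k t = indicator {0..2*pi} t * ennreal (\<omega> t * ln (v k (w t)))" for k t
  have \<omega>m: "\<omega> \<in> borel_measurable borel" by (rule borel_measurable_continuous_onI[OF \<omega>(1)])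
  have gm: "g k \<in> borel_measurable lborel" for k
    unfolding g_def[abs_def] using \<omega>m vm w(1) by measurable
  have AE_N: "AE t in lborel. t \<in> {0..2*pi} \<longrightarrow> 0 \<le> t \<and> t < 2 * pi \<and> cis t \<notin> N"
  proof -
    have "{t\<in>{0..<2*pi}. cis t \<in> N} \<in> sets lborel"
    proof -
      have "cis -` N \<in> sets borel" using measurable_sets[OF cis_borel N(1)] by simp
      hence "{0..<2*pi} \<inter> cis -` N \<in> sets borel" by auto
      thus ?thesis by (simp add: Int_def vimage_def)
    qed
    hence "AE t in lborel. t \<notin> {t\<in>{0..<2*pi}. cis t \<in> N}"
      using N(3) by (intro AE_not_in) auto
    with AE_lborel_singleton[of "2 * pi"] show ?thesis by eventually_elim auto
  qed
  have gK: "(\<integral>\<^sup>+t. g k t \<partial>lborel) \<le> ennreal K" for k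
  proof -
    have nn: "0 \<le> \<omega> t * ln (F k (cis t))" for t using \<omega>(2) F(2) by (intro mult_nonneg_nonneg) auto
    have int: "set_integrable lborel {0..2*pi} (\<lambda>t. \<omega> t * ln (F k (cis t)))"
    proof (rule set_integrable_bounded_interval)
      show "(\<lambda>t. \<omega> t * ln (F k (cis t))) \<in> borel_measurable borel" using \<omega>m F(1) cis_borel by measurable
      fix t
      have "\<omega> t * ln (F k (cis t)) \<le> 1 * ln (real (Suc k))"
        using \<omega>(2,3)[of t] F(2,3)[of k "cis t"] by (intro mult_mono) auto
      thus "\<bar>\<omega> t * ln (F k (cis t))\<bar> \<le> ln (real (Suc k))" using nn[of t] by simp
    qed
    have "(\<integral>\<^sup>+t. g k t \<partial>lborel) = (\<integral>\<^sup>+t. ennreal (indicator {0..2*pi} t * (\<omega> t * ln (F k (cis t)))) \<partial>lborel)"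
    proof (rule nn_integral_cong_AE)
      show "AE t in lborel. g k t = ennreal (indicator {0..2*pi} t * (\<omega> t * ln (F k (cis t))))"
        using AE_N by eventually_elim (auto simp: g_def indicator_def Fcis)
    qed
    also have "\<dots> = ennreal (LINT t:{0..2*pi}|lborel. \<omega> t * ln (F k (cis t)))"
      unfolding set_lebesgue_integral_def real_scaleR_def
      by (rule nn_integral_eq_integral) (use int nn in \<open>auto simp: set_integrable_def\<close>)
    also have "\<dots> \<le> ennreal K"
    proof (rule ennreal_leI)
      have "(LINT t:{0..2*pi}|lborel. \<omega> t * ln (F k (cis t))) \<le> 4 * pi * (\<integral>z. F k z \<partial>\<mu>) + (C + 2 * pi * ln 2)"
        by (rule entropy_bound_borel[OF \<omega> C F])
      moreover have "4 * pi * (\<integral>z. F k z \<partial>\<mu>) \<le> 4 * pi * 3" using IF[of k] by (intro mult_left_mono) auto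
      ultimately show "(LINT t:{0..2*pi}|lborel. \<omega> t * ln (F k (cis t))) \<le> K" unfolding K_def by linarith
    qed
    finally show ?thesis .
  qed
  \<comment> \<open>On [0, 2 \<pi>] this is \<omega> times the negative part of ln w; it takes the
    value infinity where w vanishes and \<omega> does not.\<close>
  define G where "G t = (SUP k. g k t)" for t
  have Gm: "G \<in> borel_measurable lborel" unfolding G_def[abs_def] using gm by measurable
  have "(\<integral>\<^sup>+t. G t \<partial>lborel) = (SUP k. \<integral>\<^sup>+t. g k t \<partial>lborel)"
    unfolding G_def
  proof (rule nn_integral_monotone_convergence_SUP)
    show "incseq g"
    proof (rule incseq_SucI, rule le_funI)
      fix k t
      have "1 / real (Suc (Suc k)) \<le> 1 / real (Suc k)" by (simp add: field_simps)
      hence "v k (w t) \<le> v (Suc k) (w t)" unfolding v_def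
        by (intro divide_left_mono) (auto simp: less_max_iff_disj intro!: mult_pos_pos max.mono)
      hence "ln (v k (w t)) \<le> ln (v (Suc k) (w t))" using v(1)[of k "w t"] by simp
      thus "g k t \<le> g (Suc k) t" unfolding g_def using \<omega>(2)
        by (intro mult_left_mono ennreal_leI) auto
    qed
  qed (rule gm)
  also have "\<dots> \<le> ennreal K" by (rule SUP_least) (rule gK)
  finally have GK: "(\<integral>\<^sup>+t. G t \<partial>lborel) \<le> ennreal K" .
  hence "(\<integral>\<^sup>+t. G t \<partial>lborel) \<noteq> \<infinity>" by (metis ennreal_less_top infinity_ennreal_def leD)
  from nn_integral_PInf_AE[OF Gm this] have AE_G: "AE t in lborel. G t \<noteq> \<infinity>" .
  \<comment> \<open>The weight vanishes only at \<theta>1 modulo 2 \<pi>, which leaves at most two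
    points of [0, 2 \<pi>]. Hence finiteness of G almost everywhere forces w > 0 almost
    everywhere.\<close>
  have \<omega>pos: "\<omega> t > 0" if t: "0 \<le> t" "t \<le> 2 * pi" "t \<noteq> \<theta>1" "t \<noteq> \<theta>1 + 2 * pi" for t
  proof -
    have "cos (t - \<theta>1) \<noteq> 1"
    proof
      assume "cos (t - \<theta>1) = 1"
      then obtain n :: int where n: "t - \<theta>1 = n * 2 * pi" by (auto simp: cos_one_2pi_int)
      have "- (2 * pi) < t - \<theta>1" "t - \<theta>1 \<le> 2 * pi" using t assms(3,4) by auto
      hence "- 1 * (2 * pi) < real_of_int n * (2 * pi)" "real_of_int n * (2 * pi) \<le> 1 * (2 * pi)" unfolding n by auto
      hence "- 1 < real_of_int n" "real_of_int n \<le> 1" by (simp_all only: mult_less_cancel_right mult_le_cancel_right) auto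
      hence "n = 0 \<or> n = 1" by linarith
      thus False using n t by auto
    qed
    hence "cos (t - \<theta>1) < 1" using cos_le_one[of "t - \<theta>1"] by linarith
    thus ?thesis unfolding \<omega>_def by simp
  qed
  have AE_pos: "AE t in lborel. t \<in> {0..2*pi} \<longrightarrow> w t > 0"
    using AE_G AE_lborel_singleton[of \<theta>1] AE_lborel_singleton[of "\<theta>1 + 2 * pi"]
  proof eventually_elim
    case (elim t)
    show ?case
    proof (intro impI, rule ccontr)
      assume t: "t \<in> {0..2*pi}" and "\<not> w t > 0"
      hence w0: "w t = 0" using w(2)[of t] by linarith
      have p: "\<omega> t > 0" by (rule \<omega>pos) (use t elim in auto)
      have "G t \<ge> ennreal (\<omega> t * ln (real (Suc k)))" for k
      proof -
        have "v k (w t) = real (Suc k)" by (simp add: v_def w0 max_def)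
        hence "g k t = ennreal (\<omega> t * ln (real (Suc k)))" using t by (simp add: g_def)
        thus ?thesis unfolding G_def by (metis SUP_upper UNIV_I)
      qed
      moreover have "\<exists>k. B < \<omega> t * ln (real (Suc k))" for B
      proof -
        obtain k :: nat where "exp (B / \<omega> t) < real k" using reals_Archimedean2 by blast
        hence "exp (B / \<omega> t) < real (Suc k)" by simp
        hence "B / \<omega> t < ln (real (Suc k))" by (subst ln_exp[symmetric], subst ln_less_cancel_iff) auto
        thus ?thesis using p by (auto simp: field_simps)
      qed
      ultimately have big: "G t \<ge> ennreal B" for B
        by (meson ennreal_leI less_imp_le order_trans)
      show False
      proof (cases "G t")
        case (real r)
        thus False using big[of "r + 1"] by simp
      next
        case top
        thus False using elim by simp
      qed
    qed
  qed
  define \<phi> where "\<phi> t = indicator {0..2*pi} t *\<^sub>R ((1 - cos (t - \<theta>1)) ^ m1 * ln (w t))" for t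
  have \<phi>m: "\<phi> \<in> borel_measurable lborel" unfolding \<phi>_def[abs_def] using w(1) by measurable
  \<comment> \<open>G dominates where w < 1, and |ln w| <= w where w >= 1, with w integrable. The
    factor 2^m1 undoes the normalisation of the weight.\<close>
  define H where "H t = ennreal (2 ^ m1) * (G t + indicator {0..<2*pi} t * ennreal (w t))" for t
  have bound: "ennreal (norm (\<phi> t)) \<le> H t" if pos: "w t > 0" and t: "0 \<le> t" "t < 2 * pi" for t
  proof -
    have "(1 - cos (t - \<theta>1)) ^ m1 = 2 ^ m1 * \<omega> t" by (simp add: \<omega>_def power_divide)
    hence n\<phi>: "norm (\<phi> t) = 2 ^ m1 * (\<omega> t * \<bar>ln (w t)\<bar>)"
      using t \<omega>(2)[of t] by (simp add: \<phi>_def abs_mult)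
    have "ennreal (\<omega> t * \<bar>ln (w t)\<bar>) \<le> G t + indicator {0..<2*pi} t * ennreal (w t)"
    proof (cases "w t \<ge> 1")
      case True
      have "\<omega> t * \<bar>ln (w t)\<bar> \<le> 1 * ln (w t)" using True \<omega>(2,3)[of t] by (intro mult_mono) auto
      also have "\<dots> \<le> w t" using ln_le_minus_one[OF pos] by simp
      finally have "ennreal (\<omega> t * \<bar>ln (w t)\<bar>) \<le> ennreal (w t)" by (rule ennreal_leI)
      also have "\<dots> \<le> G t + indicator {0..<2*pi} t * ennreal (w t)" using t by simp
      finally show ?thesis .
    next
      case False
      obtain k :: nat where k: "1 / w t < real k" using reals_Archimedean2 by blast
      have "1 / real (Suc k) \<le> w t"
      proof -
        have "1 / w t \<le> real (Suc k)" using k by simp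
        thus ?thesis using pos by (simp add: field_simps)
      qed
      hence "v k (w t) = 1 / w t" using False by (simp add: v_def max_def min_def)
      hence "ln (v k (w t)) = \<bar>ln (w t)\<bar>" using False pos by (simp add: ln_div)
      hence "ennreal (\<omega> t * \<bar>ln (w t)\<bar>) = g k t" using t by (simp add: g_def)
      also have "\<dots> \<le> G t" unfolding G_def by (rule SUP_upper) simp
      also have "\<dots> \<le> G t + indicator {0..<2*pi} t * ennreal (w t)" by simp
      finally show ?thesis .
    qed
    hence "ennreal (2 ^ m1) * ennreal (\<omega> t * \<bar>ln (w t)\<bar>) \<le> H t" unfolding H_def by (intro mult_left_mono) auto
    moreover have "ennreal (2 ^ m1) * ennreal (\<omega> t * \<bar>ln (w t)\<bar>) = ennreal (norm (\<phi> t))"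
      unfolding n\<phi> using \<omega>(2)[of t] by (subst ennreal_mult) auto
    ultimately show ?thesis by simp
  qed
  have wm: "(\<lambda>t. indicator {0..<2*pi} t * ennreal (w t)) \<in> borel_measurable lborel"
    using w(1) by (intro borel_measurable_times_ennreal) auto
  have "(\<integral>\<^sup>+t. ennreal (norm (\<phi> t)) \<partial>lborel) \<le> (\<integral>\<^sup>+t. H t \<partial>lborel)"
  proof (rule nn_integral_mono_AE)
    show "AE t in lborel. ennreal (norm (\<phi> t)) \<le> H t"
      using AE_pos AE_lborel_singleton[of "2 * pi"]
    proof eventually_elim
      case (elim t)
      show ?case
      proof (cases "t \<in> {0..2*pi}")
        case True
        thus ?thesis using elim by (intro bound) auto
      qed (simp add: \<phi>_def)
    qed
  qed
  also have "\<dots> = ennreal (2 ^ m1) * (\<integral>\<^sup>+t. G t + indicator {0..<2*pi} t * ennreal (w t) \<partial>lborel)"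
    unfolding H_def by (rule nn_integral_cmult[OF borel_measurable_add[OF Gm wm]])
  also have "(\<integral>\<^sup>+t. G t + indicator {0..<2*pi} t * ennreal (w t) \<partial>lborel)
    = (\<integral>\<^sup>+t. G t \<partial>lborel) + (\<integral>\<^sup>+t. indicator {0..<2*pi} t * ennreal (w t) \<partial>lborel)"
    by (rule nn_integral_add[OF Gm wm])
  also have "ennreal (2 ^ m1) * \<dots> \<le> ennreal (2 ^ m1) * (ennreal K + ennreal (2 * pi))"
    using GK nw by (intro mult_left_mono add_mono) auto
  also have "\<dots> < \<infinity>" by (simp add: ennreal_mult_less_top)
  finally have "integrable lborel \<phi>" by (intro integrableI_bounded \<phi>m)
  hence "set_integrable lborel {0..2*pi} (\<lambda>\<theta>. (1 - cos (\<theta> - \<theta>1)) ^ m1 * ln (w \<theta>))"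
    unfolding set_integrable_def \<phi>_def[abs_def] .
  with AE_pos show ?thesis by blast
qed

end
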